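(* Let $R$ and $S$ be rings and let ${}_SC_R$ be a semidualizing bimodule. Then the Auslander class $\mathcal{A}_C(R)$ contains all weak flat left $R$-modules, and the Bass class $\mathcal{B}_C(S)$ contains all weak injective left $S$-modules.
   Context: Rings are associative with unit and modules are unitary; right $R$-modules are identified with left $R^{op}$-modules. A module is super finitely presented if it has a degreewise finite projective resolution, i.e. a projective resolution $\cdots\to P_1\to P_0\to M\to 0$ with each $P_i$ finitely generated projective. An $(S,R)$-bimodule $C={}_SC_R$ is semidualizing if: ${}_SC$ and $C_R$ both admit degreewise finite projective resolutions (over $S$, resp. $R^{op}$); the homothety maps $S\to\mathrm{Hom}_{R^{op}}(C,C)$ and $R\to\mathrm{Hom}_S(C,C)$ are isomorphisms; and $\mathrm{Ext}^i_S(C,C)=0=\mathrm{Ext}^i_{R^{op}}(C,C)$ for all $i\ge1$. The Auslander class $\mathcal{A}_C(R)$ consists of the left $R$-modules $M$ such that $\mathrm{Tor}^R_i(C,M)=0$ and $\mathrm{Ext}_S^i(C,C\otimes_RM)=0$ for all $i\ge1$ and the natural evaluation map $M\to\mathrm{Hom}_S(C,C\otimes_RM)$ is an isomorphism. The Bass class $\mathcal{B}_C(S)$ consists of the left $S$-modules $N$ such that $\mathrm{Ext}_S^i(C,N)=0$ and $\mathrm{Tor}^R_i(C,\mathrm{Hom}_S(C,N))=0$ for all $i\ge1$ and the natural evaluation map $C\otimes_R\mathrm{Hom}_S(C,N)\to N$ is an isomorphism. A left $S$-module $I$ is weak injective if $\mathrm{Ext}^1_S(F,I)=0$ for every super finitely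 presented left $S$-module $F$. A left $R$-module $M$ is weak flat if $\mathrm{Tor}^R_1(F,M)=0$ for every super finitely presented right $R$-module $F$. *)

theory Defs
  imports "HOL-Algebra.Free_Abelian_Groups" "HOL-Algebra.Module"
begin

section \<open>Modules over a not necessarily commutative ring\<close>

text \<open>The library locale \<open>module\<close> requires a commutative ring of scalars; the record type
  \<open>('r, 'm) module\<close> is reused here (its fields \<open>mult\<close> and \<open>one\<close> play no role for modules).
  The library locale \<open>ring\<close> is that of associative unital rings and admits the zero ring.\<close>

locale left_module = R?: ring R + M?: abelian_group M
  for R :: "('r, 'x) ring_scheme" (structure)
    and M :: "('r, 'm, 'y) module_scheme" (structure) +
  assumes smult_closed:
      "\<lbrakk>a \<in> carrier R; x \<in> carrier M\<rbrakk> \<Longrightarrow> a \<odot>\<^bsub>M\<^esub> x \<in> carrier M"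
    and smult_l_distr:
      "\<lbrakk>a \<in> carrier R; b \<in> carrier R; x \<in> carrier M\<rbrakk> \<Longrightarrow>
        (a \<oplus>\<^bsub>R\<^esub> b) \<odot>\<^bsub>M\<^esub> x = a \<odot>\<^bsub>M\<^esub> x \<oplus>\<^bsub>M\<^esub> b \<odot>\<^bsub>M\<^esub> x"
    and smult_r_distr:
      "\<lbrakk>a \<in> carrier R; x \<in> carrier M; y \<in> carrier M\<rbrakk> \<Longrightarrow>
        a \<odot>\<^bsub>M\<^esub> (x \<oplus>\<^bsub>M\<^esub> y) = a \<odot>\<^bsub>M\<^esub> x \<oplus>\<^bsub>M\<^esub> a \<odot>\<^bsub>M\<^esub> y"
    and smult_assoc1:
      "\<lbrakk>a \<in> carrier R; b \<in> carrier R; x \<in> carrier M\<rbrakk> \<Longrightarrow>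
        (a \<otimes>\<^bsub>R\<^esub> b) \<odot>\<^bsub>M\<^esub> x = a \<odot>\<^bsub>M\<^esub> (b \<odot>\<^bsub>M\<^esub> x)"
    and smult_one: "x \<in> carrier M \<Longrightarrow> \<one>\<^bsub>R\<^esub> \<odot>\<^bsub>M\<^esub> x = x"

text \<open>A right \<open>R\<close>-module is a left module over the opposite ring: \<open>r \<odot> x\<close> stands for \<open>x r\<close>.\<close>

definition opp :: "('r, 'x) ring_scheme \<Rightarrow> ('r, 'x) ring_scheme" where
  "opp R = R\<lparr>monoid.mult := \<lambda>a b. b \<otimes>\<^bsub>R\<^esub> a\<rparr>"

definition regular_module :: "('r, 'x) ring_scheme \<Rightarrow> ('r, 'r) module" where
  "regular_module R = \<lparr>carrier = carrier R, monoid.mult = undefined, one = undefined,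
     ring.zero = \<zero>\<^bsub>R\<^esub>, ring.add = ring.add R, smult = monoid.mult R\<rparr>"

text \<open>Homomorphisms are extensional, so that equality of homomorphisms is equality on the
  carrier.\<close>

definition mod_hom ::
  "('r, 'x) ring_scheme \<Rightarrow> ('r, 'm, 'y) module_scheme \<Rightarrow> ('r, 'n, 'z) module_scheme \<Rightarrow> ('m \<Rightarrow> 'n) set"
  where "mod_hom R M N = {f \<in> carrier M \<rightarrow>\<^sub>E carrier N.
     (\<forall>x\<in>carrier M. \<forall>y\<in>carrier M. f (x \<oplus>\<^bsub>M\<^esub> y) = f x \<oplus>\<^bsub>N\<^esub> f y) \<and>
     (\<forall>a\<in>carrier R. \<forall>x\<in>carrier M. f (a \<odot>\<^bsub>M\<^esub> x) = a \<odot>\<^bsub>N\<^esub> f x)}"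

definition mod_iso ::
  "('r, 'x) ring_scheme \<Rightarrow> ('r, 'm, 'y) module_scheme \<Rightarrow> ('r, 'n, 'z) module_scheme \<Rightarrow> ('m \<Rightarrow> 'n) set"
  where "mod_iso R M N = {f \<in> mod_hom R M N. bij_betw f (carrier M) (carrier N)}"

definition mod_ker ::
  "('r, 'm, 'y) module_scheme \<Rightarrow> ('r, 'n, 'z) module_scheme \<Rightarrow> ('m \<Rightarrow> 'n) \<Rightarrow> 'm set" where
  "mod_ker M N f = {x \<in> carrier M. f x = \<zero>\<^bsub>N\<^esub>}"

text \<open>The additive group \<open>Hom\<^sub>R(M, N)\<close>.\<close>

definition hom_ab ::
  "('r, 'x) ring_scheme \<Rightarrow> ('r, 'm, 'y) module_scheme \<Rightarrow> ('r, 'n, 'z) module_scheme \<Rightarrow> ('m \<Rightarrow> 'n) ring"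
  where "hom_ab R M N = \<lparr>carrier = mod_hom R M N, monoid.mult = undefined, one = undefined,
     ring.zero = (\<lambda>x\<in>carrier M. \<zero>\<^bsub>N\<^esub>), ring.add = (\<lambda>f g. \<lambda>x\<in>carrier M. f x \<oplus>\<^bsub>N\<^esub> g x)\<rparr>"

section \<open>Free, projective and finitely generated modules\<close>

text \<open>The free module on \<open>X\<close>: finitely supported functions, vanishing outside \<open>X\<close>.\<close>

definition free_module :: "('r, 'x) ring_scheme \<Rightarrow> 'a set \<Rightarrow> ('r, 'a \<Rightarrow> 'r) module" where
  "free_module R X = \<lparr>carrier = {f. range f \<subseteq> carrier R \<and> {x. f x \<noteq> \<zero>\<^bsub>R\<^esub>} \<subseteq> X \<and> finite {x. f x \<noteq> \<zero>\<^bsub>R\<^esub>}},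
     monoid.mult = undefined, one = undefined, ring.zero = (\<lambda>_. \<zero>\<^bsub>R\<^esub>), ring.add = (\<lambda>f g x. f x \<oplus>\<^bsub>R\<^esub> g x),
     smult = (\<lambda>a f x. a \<otimes>\<^bsub>R\<^esub> f x)\<rparr>"

definition basis_vec :: "('r, 'x) ring_scheme \<Rightarrow> 'a \<Rightarrow> 'a \<Rightarrow> 'r" where
  "basis_vec R x = (\<lambda>y. if y = x then \<one>\<^bsub>R\<^esub> else \<zero>\<^bsub>R\<^esub>)"

definition free_lift ::
  "('r, 'x) ring_scheme \<Rightarrow> ('r, 'm, 'y) module_scheme \<Rightarrow> ('a \<Rightarrow> 'm) \<Rightarrow> ('a \<Rightarrow> 'r) \<Rightarrow> 'm" where
  "free_lift R M g f = (\<Oplus>\<^bsub>M\<^esub>x\<in>{x. f x \<noteq> \<zero>\<^bsub>R\<^esub>}. f x \<odot>\<^bsub>M\<^esub> g x)"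

text \<open>Projective modules are the direct summands of free modules. If \<open>P\<close> is a summand of some
  free module then it is one of the free module on its own carrier, so taking the basis
  \<open>X\<close> in the type of elements of \<open>P\<close> is no restriction.\<close>

definition projective :: "('r, 'x) ring_scheme \<Rightarrow> ('r, 'm, 'y) module_scheme \<Rightarrow> bool" where
  "projective R P \<longleftrightarrow> left_module R P \<and>
     (\<exists>X :: 'm set. \<exists>i \<in> mod_hom R P (free_module R X). \<exists>p \<in> mod_hom R (free_module R X) P.
        \<forall>x\<in>carrier P. p (i x) = x)"

definition fin_gen :: "('r, 'x) ring_scheme \<Rightarrow> ('r, 'm, 'y) module_scheme \<Rightarrow> bool" where
  "fin_gen R M \<longleftrightarrow> (\<exists>A. finite A \<and> A \<subseteq> carrier M \<and>
     (\<forall>m\<in>carrier M. \<exists>a\<in>A \<rightarrow> carrier R. m = (\<Oplus>\<^bsub>M\<^esub>x\<in>A. a x \<odot>\<^bsub>M\<^esub> x)))"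

text \<open>\<open>\<cdots> \<rightarrow> P 1 \<rightarrow> P 0 \<rightarrow> M \<rightarrow> 0\<close> with \<open>d n : P (n + 1) \<rightarrow> P n\<close> and augmentation \<open>e : P 0 \<rightarrow> M\<close>.\<close>

definition proj_resolution ::
  "('r, 'x) ring_scheme \<Rightarrow> ('r, 'm, 'y) module_scheme \<Rightarrow> (nat \<Rightarrow> ('r, 'p, 'z) module_scheme) \<Rightarrow>
   (nat \<Rightarrow> 'p \<Rightarrow> 'p) \<Rightarrow> ('p \<Rightarrow> 'm) \<Rightarrow> bool" where
  "proj_resolution R M P d e \<longleftrightarrow>
     (\<forall>n. projective R (P n)) \<and>
     (\<forall>n. d n \<in> mod_hom R (P (Suc n)) (P n)) \<and>
     e \<in> mod_hom R (P 0) M \<and>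
     e ` carrier (P 0) = carrier M \<and>
     d 0 ` carrier (P (Suc 0)) = mod_ker (P 0) M e \<and>
     (\<forall>n. d (Suc n) ` carrier (P (Suc (Suc n))) = mod_ker (P (Suc n)) (P n) (d n))"

text \<open>Every finitely generated projective module is isomorphic to a submodule of some \<open>R\<^sup>k\<close>,
  hence to one with elements in \<open>nat \<Rightarrow> 'r\<close>; so fixing the element type of the resolution
  is no restriction.\<close>

definition super_fin_pres :: "('r, 'x) ring_scheme \<Rightarrow> ('r, 'm, 'y) module_scheme \<Rightarrow> bool" where
  "super_fin_pres R M \<longleftrightarrow> left_module R M \<and>
     (\<exists>(P :: nat \<Rightarrow> ('r, nat \<Rightarrow> 'r) module) d e.
        proj_resolution R M P d e \<and> (\<forall>n. fin_gen R (P n)))"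

section \<open>The standard free resolution\<close>

text \<open>Ext and Tor are computed from one explicit functorial free resolution
  \<open>\<cdots> \<rightarrow> F 1 \<rightarrow> F 0 \<rightarrow> M \<rightarrow> 0\<close>, which exists for every module and has all its terms in one type.
  \<open>F 0\<close> is free on the elements of \<open>M\<close>. \<open>F (n + 1)\<close> is free on the
  formal linear combinations of basis elements of \<open>F n\<close> that represent cycles, and the
  differential maps each of these basis elements to the cycle it represents.\<close>

datatype ('r, 'm) gen = Elt 'm | Cyc "('r \<times> ('r, 'm) gen) list"

definition lincomb :: "('r, 'x) ring_scheme \<Rightarrow> ('r \<times> 'a) list \<Rightarrow> 'a \<Rightarrow> 'r" where
  "lincomb R l = foldr
     (\<lambda>(a, x) f. a \<odot>\<^bsub>free_module R UNIV\<^esub> basis_vec R x \<oplus>\<^bsub>free_module R UNIV\<^esub> f)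
     l \<zero>\<^bsub>free_module R UNIV\<^esub>"

definition res_aug ::
  "('r, 'x) ring_scheme \<Rightarrow> ('r, 'm, 'y) module_scheme \<Rightarrow> (('r, 'm) gen \<Rightarrow> 'r) \<Rightarrow> 'm" where
  "res_aug R M = free_lift R M (\<lambda>g. case g of Elt m \<Rightarrow> m | Cyc l \<Rightarrow> \<zero>\<^bsub>M\<^esub>)"

definition res_bd ::
  "('r, 'x) ring_scheme \<Rightarrow> (('r, 'm) gen \<Rightarrow> 'r) \<Rightarrow> ('r, 'm) gen \<Rightarrow> 'r" where
  "res_bd R = free_lift R (free_module R UNIV)
     (\<lambda>g. case g of Elt m \<Rightarrow> \<zero>\<^bsub>free_module R UNIV\<^esub> | Cyc l \<Rightarrow> lincomb R l)"

primrec res_gens ::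
  "('r, 'x) ring_scheme \<Rightarrow> ('r, 'm, 'y) module_scheme \<Rightarrow> nat \<Rightarrow> ('r, 'm) gen set" where
  "res_gens R M 0 = Elt ` carrier M"
| "res_gens R M (Suc n) = {Cyc l | l. set l \<subseteq> carrier R \<times> res_gens R M n \<and>
     (if n = 0 then res_aug R M (lincomb R l) = \<zero>\<^bsub>M\<^esub>
      else res_bd R (lincomb R l) = \<zero>\<^bsub>free_module R UNIV\<^esub>)}"

definition res_mod ::
  "('r, 'x) ring_scheme \<Rightarrow> ('r, 'm, 'y) module_scheme \<Rightarrow> nat \<Rightarrow> ('r, ('r, 'm) gen \<Rightarrow> 'r) module" where
  "res_mod R M n = free_module R (res_gens R M n)"

definition res_diff ::
  "('r, 'x) ring_scheme \<Rightarrow> ('r, 'm, 'y) module_scheme \<Rightarrow> nat \<Rightarrow>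
   (('r, 'm) gen \<Rightarrow> 'r) \<Rightarrow> ('r, 'm) gen \<Rightarrow> 'r" where
  "res_diff R M n = restrict (res_bd R) (carrier (res_mod R M (Suc n)))"

section \<open>Ext\<close>

text \<open>The subquotient \<open>Z / B\<close> of the additive group of \<open>G\<close>.\<close>

definition subquotient :: "('g, 'x) ring_scheme \<Rightarrow> 'g set \<Rightarrow> 'g set \<Rightarrow> 'g set monoid" where
  "subquotient G Z B = (add_monoid G)\<lparr>carrier := Z\<rparr> Mod B"

definition Ext ::
  "('r, 'x) ring_scheme \<Rightarrow> ('r, 'm, 'y) module_scheme \<Rightarrow> ('r, 'n, 'z) module_scheme \<Rightarrow> nat \<Rightarrow>
   ((('r, 'm) gen \<Rightarrow> 'r) \<Rightarrow> 'n) set monoid" where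
  "Ext R M N i = subquotient (hom_ab R (res_mod R M i) N)
     {f \<in> mod_hom R (res_mod R M i) N.
        compose (carrier (res_mod R M (Suc i))) f (res_diff R M i) = \<zero>\<^bsub>hom_ab R (res_mod R M (Suc i)) N\<^esub>}
     (case i of 0 \<Rightarrow> {\<zero>\<^bsub>hom_ab R (res_mod R M 0) N\<^esub>}
      | Suc j \<Rightarrow> (\<lambda>g. compose (carrier (res_mod R M i)) g (res_diff R M j)) ` mod_hom R (res_mod R M j) N)"

section \<open>Tensor products and Tor\<close>

text \<open>In \<open>A \<otimes>\<^sub>R M\<close> the first factor \<open>A\<close> is a right \<open>R\<close>-module, i.e. a module over \<open>opp R\<close>,
  and \<open>M\<close> is a left \<open>R\<close>-module.\<close>

definition tensor_rels ::
  "('r, 'x) ring_scheme \<Rightarrow> ('r, 'a, 'y) module_scheme \<Rightarrow> ('r, 'm, 'z) module_scheme \<Rightarrow>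
   ('a \<times> 'm \<Rightarrow>\<^sub>0 int) set" where
  "tensor_rels R A M = generate (free_Abelian_group (carrier A \<times> carrier M))
     ({frag_of (a \<oplus>\<^bsub>A\<^esub> a', m) - frag_of (a, m) - frag_of (a', m) | a a' m.
         a \<in> carrier A \<and> a' \<in> carrier A \<and> m \<in> carrier M} \<union>
      {frag_of (a, m \<oplus>\<^bsub>M\<^esub> m') - frag_of (a, m) - frag_of (a, m') | a m m'.
         a \<in> carrier A \<and> m \<in> carrier M \<and> m' \<in> carrier M} \<union>
      {frag_of (r \<odot>\<^bsub>A\<^esub> a, m) - frag_of (a, r \<odot>\<^bsub>M\<^esub> m) | r a m.
         r \<in> carrier R \<and> a \<in> carrier A \<and> m \<in> carrier M})"

definition tensor_ab ::
  "('r, 'x) ring_scheme \<Rightarrow> ('r, 'a, 'y) module_scheme \<Rightarrow> ('r, 'm, 'z) module_scheme \<Rightarrow>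
   ('a \<times> 'm \<Rightarrow>\<^sub>0 int) set ring" where
  "tensor_ab R A M =
     (let T = free_Abelian_group (carrier A \<times> carrier M) Mod tensor_rels R A M
      in \<lparr>carrier = carrier T, monoid.mult = undefined, one = undefined,
          ring.zero = one T, ring.add = monoid.mult T\<rparr>)"

definition tensor_elt ::
  "('r, 'x) ring_scheme \<Rightarrow> ('r, 'a, 'y) module_scheme \<Rightarrow> ('r, 'm, 'z) module_scheme \<Rightarrow>
   'a \<Rightarrow> 'm \<Rightarrow> ('a \<times> 'm \<Rightarrow>\<^sub>0 int) set" where
  "tensor_elt R A M a m =
     r_coset (free_Abelian_group (carrier A \<times> carrier M)) (tensor_rels R A M) (frag_of (a, m))"

text \<open>The additive map \<open>A \<otimes>\<^sub>R M \<rightarrow> G\<close> induced by an \<open>R\<close>-balanced map \<open>\<beta> : A \<times> M \<rightarrow> G\<close>; the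
  value of \<open>\<Sum> n\<^sub>p \<beta>(p)\<close> does not depend on the representative \<open>\<Sum> n\<^sub>p p\<close> of the coset.\<close>

definition tensor_lift ::
  "('r, 'x) ring_scheme \<Rightarrow> ('r, 'a, 'y) module_scheme \<Rightarrow> ('r, 'm, 'z) module_scheme \<Rightarrow>
   ('g, 'w) ring_scheme \<Rightarrow> ('a \<Rightarrow> 'm \<Rightarrow> 'g) \<Rightarrow> ('a \<times> 'm \<Rightarrow>\<^sub>0 int) set \<Rightarrow> 'g" where
  "tensor_lift R A M G \<beta> = (\<lambda>t\<in>carrier (tensor_ab R A M).
     the_elem ((\<lambda>u. \<Oplus>\<^bsub>G\<^esub>p\<in>Poly_Mapping.keys u.
                  add_pow G (Poly_Mapping.lookup u p) (\<beta> (fst p) (snd p))) ` t))"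

text \<open>\<open>f \<otimes> id : A \<otimes>\<^sub>R M \<rightarrow> B \<otimes>\<^sub>R M\<close>.\<close>

definition tensor_map ::
  "('r, 'x) ring_scheme \<Rightarrow> ('r, 'a, 'y) module_scheme \<Rightarrow> ('r, 'b, 'w) module_scheme \<Rightarrow>
   ('r, 'm, 'z) module_scheme \<Rightarrow> ('a \<Rightarrow> 'b) \<Rightarrow> ('a \<times> 'm \<Rightarrow>\<^sub>0 int) set \<Rightarrow> ('b \<times> 'm \<Rightarrow>\<^sub>0 int) set" where
  "tensor_map R A B M f =
     tensor_lift R A M (tensor_ab R B M) (\<lambda>a m. tensor_elt R B M (f a) m)"

text \<open>\<open>Tor\<^sup>R\<^sub>i(A, M)\<close>, from the standard resolution of the right module \<open>A\<close>.\<close>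

definition Tor ::
  "('r, 'x) ring_scheme \<Rightarrow> ('r, 'a, 'y) module_scheme \<Rightarrow> ('r, 'm, 'z) module_scheme \<Rightarrow> nat \<Rightarrow>
   ((('r, 'a) gen \<Rightarrow> 'r) \<times> 'm \<Rightarrow>\<^sub>0 int) set set monoid" where
  "Tor R A M i =
     (let F = res_mod (opp R) A;
          d = (\<lambda>j. tensor_map R (F (Suc j)) (F j) M (res_diff (opp R) A j))
      in subquotient (tensor_ab R (F i) M)
           (case i of 0 \<Rightarrow> carrier (tensor_ab R (F 0) M)
            | Suc j \<Rightarrow> {t \<in> carrier (tensor_ab R (F i) M). d j t = \<zero>\<^bsub>tensor_ab R (F j) M\<^esub>})
           (d i ` carrier (tensor_ab R (F (Suc i)) M)))"

section \<open>Bimodules\<close>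

record ('s, 'r, 'c) bimodule = "('s, 'c) module" +
  rsmult :: "'c \<Rightarrow> 'r \<Rightarrow> 'c"

text \<open>An \<open>(S, R)\<close>-bimodule \<open>C\<close> viewed as an \<open>(R\<^sup>o\<^sup>p, S\<^sup>o\<^sup>p)\<close>-bimodule; its underlying left module
  over \<open>opp R\<close> is the right \<open>R\<close>-module \<open>C\<^sub>R\<close>.\<close>

definition opp_bimod :: "('s, 'r, 'c) bimodule \<Rightarrow> ('r, 's, 'c) bimodule" where
  "opp_bimod C = \<lparr>carrier = carrier C, monoid.mult = monoid.mult C, one = one C, ring.zero = ring.zero C, ring.add = ring.add C,
     smult = (\<lambda>r c. rsmult C c r), rsmult = (\<lambda>c s. smult C s c)\<rparr>"

definition is_bimodule ::
  "('s, 'x) ring_scheme \<Rightarrow> ('r, 'y) ring_scheme \<Rightarrow> ('s, 'r, 'c) bimodule \<Rightarrow> bool" where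
  "is_bimodule S R C \<longleftrightarrow> left_module S C \<and> left_module (opp R) (opp_bimod C) \<and>
     (\<forall>s\<in>carrier S. \<forall>c\<in>carrier C. \<forall>r\<in>carrier R.
        rsmult C (s \<odot>\<^bsub>C\<^esub> c) r = s \<odot>\<^bsub>C\<^esub> (rsmult C c r))"

text \<open>For an \<open>(S, R)\<close>-bimodule \<open>C\<close>: the left \<open>R\<close>-module \<open>Hom\<^sub>S(C, N)\<close>, with \<open>(r f)(c) = f(c r)\<close>.\<close>

definition hom_mod ::
  "('s, 'x) ring_scheme \<Rightarrow> ('s, 'r, 'c) bimodule \<Rightarrow> ('s, 'n, 'z) module_scheme \<Rightarrow>
   ('r, 'c \<Rightarrow> 'n) module" where
  "hom_mod S C N = \<lparr>carrier = mod_hom S C N, monoid.mult = undefined, one = undefined,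
     ring.zero = ring.zero (hom_ab S C N), ring.add = ring.add (hom_ab S C N),
     smult = (\<lambda>r f. \<lambda>c\<in>carrier C. f (rsmult C c r))\<rparr>"

text \<open>The left \<open>S\<close>-module \<open>C \<otimes>\<^sub>R M\<close>, with \<open>s (c \<otimes> m) = s c \<otimes> m\<close>.\<close>

definition tensor_mod ::
  "('r, 'x) ring_scheme \<Rightarrow> ('s, 'r, 'c) bimodule \<Rightarrow> ('r, 'm, 'z) module_scheme \<Rightarrow>
   ('s, ('c \<times> 'm \<Rightarrow>\<^sub>0 int) set) module" where
  "tensor_mod R C M =
     (let T = tensor_ab R (opp_bimod C) M
      in \<lparr>carrier = carrier T, monoid.mult = undefined, one = undefined, ring.zero = ring.zero T, ring.add = ring.add T,
          smult = (\<lambda>s. tensor_map R (opp_bimod C) (opp_bimod C) M (\<lambda>c. s \<odot>\<^bsub>C\<^esub> c))\<rparr>)"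

text \<open>The homothety map \<open>R \<rightarrow> Hom\<^sub>S(C, C)\<close>, \<open>r \<mapsto> (c \<mapsto> c r)\<close>. For \<open>opp_bimod C\<close> it is the
  homothety map \<open>S \<rightarrow> Hom\<^bsub>R\<^sup>o\<^sup>p\<^esub>(C, C)\<close>, \<open>s \<mapsto> (c \<mapsto> s c)\<close>.\<close>

definition homothety ::
  "('r, 'x) ring_scheme \<Rightarrow> ('s, 'r, 'c) bimodule \<Rightarrow> 'r \<Rightarrow> 'c \<Rightarrow> 'c" where
  "homothety R C = (\<lambda>r\<in>carrier R. \<lambda>c\<in>carrier C. rsmult C c r)"

definition semidualizing ::
  "('s, 'x) ring_scheme \<Rightarrow> ('r, 'y) ring_scheme \<Rightarrow> ('s, 'r, 'c) bimodule \<Rightarrow> bool" where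
  "semidualizing S R C \<longleftrightarrow>
     is_bimodule S R C \<and>
     super_fin_pres S C \<and>
     super_fin_pres (opp R) (opp_bimod C) \<and>
     homothety (opp S) (opp_bimod C)
       \<in> mod_iso (opp S) (regular_module (opp S)) (hom_mod (opp R) (opp_bimod C) (opp_bimod C)) \<and>
     homothety R C \<in> mod_iso R (regular_module R) (hom_mod S C C) \<and>
     (\<forall>i\<ge>1. trivial_group (Ext S C C i)) \<and>
     (\<forall>i\<ge>1. trivial_group (Ext (opp R) (opp_bimod C) (opp_bimod C) i))"

section \<open>Auslander and Bass classes, weak injective and weak flat modules\<close>

definition auslander_eval ::
  "('r, 'x) ring_scheme \<Rightarrow> ('s, 'r, 'c) bimodule \<Rightarrow> ('r, 'm, 'z) module_scheme \<Rightarrow>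
   'm \<Rightarrow> 'c \<Rightarrow> ('c \<times> 'm \<Rightarrow>\<^sub>0 int) set" where
  "auslander_eval R C M = (\<lambda>m\<in>carrier M. \<lambda>c\<in>carrier C. tensor_elt R (opp_bimod C) M c m)"

definition auslander_class ::
  "('s, 'x) ring_scheme \<Rightarrow> ('r, 'y) ring_scheme \<Rightarrow> ('s, 'r, 'c) bimodule \<Rightarrow> ('r, 'm) module set" where
  "auslander_class S R C = {M. left_module R M \<and>
     (\<forall>i\<ge>1. trivial_group (Tor R (opp_bimod C) M i)) \<and>
     (\<forall>i\<ge>1. trivial_group (Ext S C (tensor_mod R C M) i)) \<and>
     auslander_eval R C M \<in> mod_iso R M (hom_mod S C (tensor_mod R C M))}"

definition bass_eval ::
  "('s, 'x) ring_scheme \<Rightarrow> ('r, 'y) ring_scheme \<Rightarrow> ('s, 'r, 'c) bimodule \<Rightarrow> ('s, 'n, 'z) module_scheme \<Rightarrow>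
   ('c \<times> ('c \<Rightarrow> 'n) \<Rightarrow>\<^sub>0 int) set \<Rightarrow> 'n" where
  "bass_eval S R C N = tensor_lift R (opp_bimod C) (hom_mod S C N) N (\<lambda>c f. f c)"

definition bass_class ::
  "('s, 'x) ring_scheme \<Rightarrow> ('r, 'y) ring_scheme \<Rightarrow> ('s, 'r, 'c) bimodule \<Rightarrow> ('s, 'n) module set" where
  "bass_class S R C = {N. left_module S N \<and>
     (\<forall>i\<ge>1. trivial_group (Ext S C N i)) \<and>
     (\<forall>i\<ge>1. trivial_group (Tor R (opp_bimod C) (hom_mod S C N) i)) \<and>
     bass_eval S R C N \<in> mod_iso S (tensor_mod R C (hom_mod S C N)) N}"

text \<open>Every finitely generated module is isomorphic to a quotient of some \<open>S\<^sup>k\<close>, hence to a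
  module whose elements are cosets, of type \<open>(nat \<Rightarrow> 's) set\<close>. Super finitely presented
  modules are finitely generated, so the test modules below cover all of them up to
  isomorphism.\<close>

definition weak_injective :: "('s, 'x) ring_scheme \<Rightarrow> ('s, 'n, 'z) module_scheme \<Rightarrow> bool" where
  "weak_injective S I \<longleftrightarrow> left_module S I \<and>
     (\<forall>F :: ('s, (nat \<Rightarrow> 's) set) module. super_fin_pres S F \<longrightarrow> trivial_group (Ext S F I 1))"

definition weak_flat :: "('r, 'x) ring_scheme \<Rightarrow> ('r, 'm, 'z) module_scheme \<Rightarrow> bool" where
  "weak_flat R M \<longleftrightarrow> left_module R M \<and>
     (\<forall>F :: ('r, (nat \<Rightarrow> 'r) set) module. super_fin_pres (opp R) F \<longrightarrow> trivial_group (Tor R F M 1))"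

end

theory Submission
  imports Defs
begin

text \<open>Weak injectivity of \<open>N\<close> means that \<open>Ext\<^sup>1(D, N)\<close> vanishes for super finitely presented \<open>D\<close>, so
  \<open>Hom(-, N)\<close> is exact on every exact complex whose cosyzygies are super finitely presented; weak
  flatness gives the same for \<open>- \<otimes> M\<close>. Such complexes arise by dualizing a resolution \<open>P\<close> of
  \<open>\<^sub>SC\<close> by modules \<open>S\<^sup>n\<close>: since \<open>Ext\<^sup>i(C, C) = 0\<close> for \<open>i \<ge> 1\<close> and \<open>Hom\<^sub>S(C, C) = R\<close>, the complex
  \<open>0 \<rightarrow> R \<rightarrow> Hom\<^sub>S(P\<^sub>0, C) \<rightarrow> Hom\<^sub>S(P\<^sub>1, C) \<rightarrow> \<cdots>\<close> of right \<open>R\<close>-modules is exact, its terms are powers of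
  \<open>C\<^sub>R\<close>, and cokernels of monomorphisms between super finitely presented modules are super finitely
  presented. Tensoring with a weak flat \<open>M\<close> and using
  \<open>Hom\<^sub>S(P, C) \<otimes>\<^sub>R M \<cong> Hom\<^sub>S(P, C \<otimes>\<^sub>R M)\<close> yields the Auslander conditions on \<open>C \<otimes>\<^sub>R M\<close>. Symmetrically, for a
  resolution \<open>Q\<close> of \<open>C\<^sub>R\<close> and a weak injective \<open>N\<close>, the isomorphism
  \<open>Q \<otimes>\<^sub>R Hom\<^sub>S(C, N) \<cong> Hom\<^sub>S(Hom\<^bsub>R\<^sup>o\<^sup>p\<^esub>(Q, C), N)\<close> yields the Bass conditions on \<open>Hom\<^sub>S(C, N)\<close>.\<close>

section \<open>Additive and linear maps\<close>

text \<open>Vanishing is given only in degree one and only against super finitely presented modules.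
  It says that maps into a weak injective \<open>N\<close> extend along monomorphisms with super
  finitely presented cokernel, and that \<open>- \<otimes> M\<close> keeps such monomorphisms
  injective. So the argument rests on controlling the cokernels along the dual complex, a chain that
  starts from a copy of the ring. The natural isomorphisms are verified coordinatewise on finite
  free modules, so the finitely generated projective resolutions of the definition are first
  replaced by resolutions with terms \<open>R^n\<close>; the summands that this change leaves behind
  are kernels of idempotents. Ext and Tor, on the other hand, are defined by one standard resolution
  with huge terms, so vanishing has to be moved between resolutions. Element types add a constraint:
  syzygies must stay in one type for the construction to be iterated, and the test modules for weak
  injectivity and weak flatness live in a fixed type, which calls for copies.\<close>

definition ab_hom :: "('a, 'x) ring_scheme \<Rightarrow> ('b, 'y) ring_scheme \<Rightarrow> ('a \<Rightarrow> 'b) set" where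
  "ab_hom G H = {f \<in> carrier G \<rightarrow> carrier H.
     \<forall>x\<in>carrier G. \<forall>y\<in>carrier G. f (x \<oplus>\<^bsub>G\<^esub> y) = f x \<oplus>\<^bsub>H\<^esub> f y}"

text \<open>In contrast to \<open>mod_hom\<close>, nothing is fixed outside the carrier, so
  composites, sums and maps into submodules are plain lambda terms; \<open>linmap_restrict\<close>
  leads back to \<open>mod_hom\<close>.\<close>

definition linmap ::
  "('r, 'x) ring_scheme \<Rightarrow> ('r, 'm, 'y) module_scheme \<Rightarrow> ('r, 'n, 'z) module_scheme \<Rightarrow> ('m \<Rightarrow> 'n) set"
  where "linmap R M N = {f \<in> ab_hom M N.
     \<forall>a\<in>carrier R. \<forall>x\<in>carrier M. f (a \<odot>\<^bsub>M\<^esub> x) = a \<odot>\<^bsub>N\<^esub> f x}"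

lemma ab_homI:
  assumes "\<And>x. x \<in> carrier G \<Longrightarrow> f x \<in> carrier H"
    and "\<And>x y. \<lbrakk>x \<in> carrier G; y \<in> carrier G\<rbrakk> \<Longrightarrow> f (x \<oplus>\<^bsub>G\<^esub> y) = f x \<oplus>\<^bsub>H\<^esub> f y"
  shows "f \<in> ab_hom G H"
  using assms by (auto simp: ab_hom_def)

lemma ab_hom_closed: "\<lbrakk>f \<in> ab_hom G H; x \<in> carrier G\<rbrakk> \<Longrightarrow> f x \<in> carrier H"
  by (auto simp: ab_hom_def)

lemma ab_hom_add:
  "\<lbrakk>f \<in> ab_hom G H; x \<in> carrier G; y \<in> carrier G\<rbrakk> \<Longrightarrow> f (x \<oplus>\<^bsub>G\<^esub> y) = f x \<oplus>\<^bsub>H\<^esub> f y"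
  by (auto simp: ab_hom_def)

lemma ab_hom_group_hom:
  assumes "abelian_group G" "abelian_group H" "f \<in> ab_hom G H"
  shows "group_hom (add_monoid G) (add_monoid H) f"
  using assms(3) abelian_group.a_group[OF assms(1)] abelian_group.a_group[OF assms(2)]
  unfolding group_hom_def group_hom_axioms_def hom_def ab_hom_def by simp

lemma ab_hom_zero:
  assumes "abelian_group G" "abelian_group H" "f \<in> ab_hom G H"
  shows "f \<zero>\<^bsub>G\<^esub> = \<zero>\<^bsub>H\<^esub>"
  using group_hom.hom_one[OF ab_hom_group_hom[OF assms]] by simp

lemma ab_hom_neg:
  assumes "abelian_group G" "abelian_group H" "f \<in> ab_hom G H" "x \<in> carrier G"
  shows "f (\<ominus>\<^bsub>G\<^esub> x) = \<ominus>\<^bsub>H\<^esub> f x"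
  using group_hom.hom_inv[OF ab_hom_group_hom[OF assms(1-3)]] assms(4) by (simp add: a_inv_def)

lemma ab_hom_minus:
  assumes "abelian_group G" "abelian_group H" "f \<in> ab_hom G H" "x \<in> carrier G" "y \<in> carrier G"
  shows "f (x \<ominus>\<^bsub>G\<^esub> y) = f x \<ominus>\<^bsub>H\<^esub> f y"
  using assms by (simp add: a_minus_def ab_hom_add ab_hom_neg abelian_group.a_inv_closed)

lemma ab_hom_comp: "\<lbrakk>f \<in> ab_hom G H; g \<in> ab_hom H K\<rbrakk> \<Longrightarrow> (\<lambda>x. g (f x)) \<in> ab_hom G K"
  by (auto simp: ab_hom_def Pi_iff)

lemma ab_hom_finsum:
  assumes "abelian_group G" "abelian_group H" "f \<in> ab_hom G H" "finite I" "u \<in> I \<rightarrow> carrier G"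
  shows "f (\<Oplus>\<^bsub>G\<^esub>i\<in>I. u i) = (\<Oplus>\<^bsub>H\<^esub>i\<in>I. f (u i))"
proof -
  interpret G: abelian_group G by fact
  interpret H: abelian_group H by fact
  show ?thesis using assms(4,5)
  proof (induction I rule: finite_induct)
    case empty
    then show ?case by (simp add: ab_hom_zero[OF assms(1-3)])
  next
    case (insert i I)
    then have "f (u i) \<in> carrier H" "(\<lambda>i. f (u i)) \<in> I \<rightarrow> carrier H" "u \<in> I \<rightarrow> carrier G"
      using assms(3) by (auto simp: Pi_iff intro: ab_hom_closed)
    then show ?case
      using insert by (simp add: ab_hom_add[OF assms(3)])
  qed
qed

section \<open>Cancellation in abelian groups\<close>

lemma (in abelian_group) eq_zero_if_double: "x \<in> carrier G \<Longrightarrow> x = x \<oplus> x \<Longrightarrow> x = \<zero>"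
  by (metis add.r_cancel_one')

lemma (in abelian_group) minus_zero_iff:
  "\<lbrakk>x \<in> carrier G; y \<in> carrier G\<rbrakk> \<Longrightarrow> x \<ominus> y = \<zero> \<longleftrightarrow> x = y"
  by (metis a_inv_closed a_minus_def local.minus_minus minus_equality r_neg)

lemma (in abelian_group) minus_add_cancel:
  "\<lbrakk>x \<in> carrier G; y \<in> carrier G\<rbrakk> \<Longrightarrow> (x \<ominus> y) \<oplus> y = x"
  by (simp add: a_minus_def a_assoc l_neg)

lemma (in abelian_group) add_minus_cancel:
  "\<lbrakk>x \<in> carrier G; y \<in> carrier G\<rbrakk> \<Longrightarrow> (x \<oplus> y) \<ominus> y = x"
  by (simp add: a_minus_def a_assoc r_neg)

lemma (in abelian_group) add_add_swap:
  "\<lbrakk>x \<in> carrier G; y \<in> carrier G; u \<in> carrier G; v \<in> carrier G\<rbrakk> \<Longrightarrow>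
   (x \<oplus> y) \<oplus> (u \<oplus> v) = (x \<oplus> u) \<oplus> (y \<oplus> v)"
  by (simp add: a_ac)

lemma linmapI:
  assumes "\<And>x. x \<in> carrier M \<Longrightarrow> f x \<in> carrier N"
    and "\<And>x y. \<lbrakk>x \<in> carrier M; y \<in> carrier M\<rbrakk> \<Longrightarrow> f (x \<oplus>\<^bsub>M\<^esub> y) = f x \<oplus>\<^bsub>N\<^esub> f y"
    and "\<And>a x. \<lbrakk>a \<in> carrier R; x \<in> carrier M\<rbrakk> \<Longrightarrow> f (a \<odot>\<^bsub>M\<^esub> x) = a \<odot>\<^bsub>N\<^esub> f x"
  shows "f \<in> linmap R M N"
  using assms by (auto simp: linmap_def ab_hom_def)

lemma linmap_ab_hom: "f \<in> linmap R M N \<Longrightarrow> f \<in> ab_hom M N"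
  by (simp add: linmap_def)

lemma linmap_closed: "\<lbrakk>f \<in> linmap R M N; x \<in> carrier M\<rbrakk> \<Longrightarrow> f x \<in> carrier N"
  by (auto simp: linmap_def intro: ab_hom_closed)

lemma linmap_add:
  "\<lbrakk>f \<in> linmap R M N; x \<in> carrier M; y \<in> carrier M\<rbrakk> \<Longrightarrow> f (x \<oplus>\<^bsub>M\<^esub> y) = f x \<oplus>\<^bsub>N\<^esub> f y"
  by (simp add: linmap_def ab_hom_add)

lemma linmap_smult:
  "\<lbrakk>f \<in> linmap R M N; a \<in> carrier R; x \<in> carrier M\<rbrakk> \<Longrightarrow> f (a \<odot>\<^bsub>M\<^esub> x) = a \<odot>\<^bsub>N\<^esub> f x"
  by (simp add: linmap_def)

lemma mod_hom_iff: "f \<in> mod_hom R M N \<longleftrightarrow> f \<in> linmap R M N \<and> f \<in> extensional (carrier M)"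
  by (auto simp: mod_hom_def linmap_def ab_hom_def PiE_def)

lemma mod_hom_linmap: "f \<in> mod_hom R M N \<Longrightarrow> f \<in> linmap R M N"
  by (simp add: mod_hom_iff)

lemma linmap_comp: "\<lbrakk>f \<in> linmap R M N; g \<in> linmap R N K\<rbrakk> \<Longrightarrow> (\<lambda>x. g (f x)) \<in> linmap R M K"
  by (auto intro!: linmapI simp: linmap_closed linmap_add linmap_smult)

lemma linmap_id: "(\<lambda>x. x) \<in> linmap R M M"
  by (auto intro!: linmapI)

section \<open>Modules\<close>

lemma left_moduleI:
  assumes "ring R" "abelian_group M"
    "\<And>a x. \<lbrakk>a \<in> carrier R; x \<in> carrier M\<rbrakk> \<Longrightarrow> a \<odot>\<^bsub>M\<^esub> x \<in> carrier M"
    "\<And>a b x. \<lbrakk>a \<in> carrier R; b \<in> carrier R; x \<in> carrier M\<rbrakk> \<Longrightarrow>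
        (a \<oplus>\<^bsub>R\<^esub> b) \<odot>\<^bsub>M\<^esub> x = a \<odot>\<^bsub>M\<^esub> x \<oplus>\<^bsub>M\<^esub> b \<odot>\<^bsub>M\<^esub> x"
    "\<And>a x y. \<lbrakk>a \<in> carrier R; x \<in> carrier M; y \<in> carrier M\<rbrakk> \<Longrightarrow>
        a \<odot>\<^bsub>M\<^esub> (x \<oplus>\<^bsub>M\<^esub> y) = a \<odot>\<^bsub>M\<^esub> x \<oplus>\<^bsub>M\<^esub> a \<odot>\<^bsub>M\<^esub> y"
    "\<And>a b x. \<lbrakk>a \<in> carrier R; b \<in> carrier R; x \<in> carrier M\<rbrakk> \<Longrightarrow>
        (a \<otimes>\<^bsub>R\<^esub> b) \<odot>\<^bsub>M\<^esub> x = a \<odot>\<^bsub>M\<^esub> (b \<odot>\<^bsub>M\<^esub> x)"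
    "\<And>x. x \<in> carrier M \<Longrightarrow> \<one>\<^bsub>R\<^esub> \<odot>\<^bsub>M\<^esub> x = x"
  shows "left_module R M"
  using assms by (simp add: left_module_def left_module_axioms_def)

lemma module_ring: "left_module R M \<Longrightarrow> ring R"
  by (rule left_module.axioms)

lemma module_abelian: "left_module R M \<Longrightarrow> abelian_group M"
  by (rule left_module.axioms)

lemma smult_ab_hom: "\<lbrakk>left_module R M; a \<in> carrier R\<rbrakk> \<Longrightarrow> (\<lambda>x. a \<odot>\<^bsub>M\<^esub> x) \<in> ab_hom M M"
  by (auto intro!: ab_homI left_module.smult_closed left_module.smult_r_distr)

lemma scalar_ab_hom: "\<lbrakk>left_module R M; x \<in> carrier M\<rbrakk> \<Longrightarrow> (\<lambda>a. a \<odot>\<^bsub>M\<^esub> x) \<in> ab_hom R M"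
  by (auto intro!: ab_homI left_module.smult_closed left_module.smult_l_distr)

lemma smult_zero_right: "\<lbrakk>left_module R M; a \<in> carrier R\<rbrakk> \<Longrightarrow> a \<odot>\<^bsub>M\<^esub> \<zero>\<^bsub>M\<^esub> = \<zero>\<^bsub>M\<^esub>"
  by (rule ab_hom_zero[OF module_abelian module_abelian smult_ab_hom])

lemma smult_zero_left: "\<lbrakk>left_module R M; x \<in> carrier M\<rbrakk> \<Longrightarrow> \<zero>\<^bsub>R\<^esub> \<odot>\<^bsub>M\<^esub> x = \<zero>\<^bsub>M\<^esub>"
  by (rule ab_hom_zero[OF ring.is_abelian_group[OF module_ring] module_abelian scalar_ab_hom])

lemma smult_neg_right:
  "\<lbrakk>left_module R M; a \<in> carrier R; x \<in> carrier M\<rbrakk> \<Longrightarrow> a \<odot>\<^bsub>M\<^esub> (\<ominus>\<^bsub>M\<^esub> x) = \<ominus>\<^bsub>M\<^esub> (a \<odot>\<^bsub>M\<^esub> x)"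
  by (rule ab_hom_neg[OF module_abelian module_abelian smult_ab_hom])

lemma smult_neg_left:
  "\<lbrakk>left_module R M; a \<in> carrier R; x \<in> carrier M\<rbrakk> \<Longrightarrow> (\<ominus>\<^bsub>R\<^esub> a) \<odot>\<^bsub>M\<^esub> x = \<ominus>\<^bsub>M\<^esub> (a \<odot>\<^bsub>M\<^esub> x)"
  by (rule ab_hom_neg[OF ring.is_abelian_group[OF module_ring] module_abelian scalar_ab_hom])

lemma linmap_zero: "\<lbrakk>left_module R M; left_module R N; f \<in> linmap R M N\<rbrakk> \<Longrightarrow> f \<zero>\<^bsub>M\<^esub> = \<zero>\<^bsub>N\<^esub>"
  by (meson ab_hom_zero linmap_ab_hom module_abelian)

lemma linmap_neg:
  "\<lbrakk>left_module R M; left_module R N; f \<in> linmap R M N; x \<in> carrier M\<rbrakk> \<Longrightarrow>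
   f (\<ominus>\<^bsub>M\<^esub> x) = \<ominus>\<^bsub>N\<^esub> f x"
  by (meson ab_hom_neg linmap_ab_hom module_abelian)

lemma linmap_minus:
  "\<lbrakk>left_module R M; left_module R N; f \<in> linmap R M N; x \<in> carrier M; y \<in> carrier M\<rbrakk> \<Longrightarrow>
   f (x \<ominus>\<^bsub>M\<^esub> y) = f x \<ominus>\<^bsub>N\<^esub> f y"
  by (meson ab_hom_minus linmap_ab_hom module_abelian)

lemma linmap_restrict:
  assumes "left_module R M" "f \<in> linmap R M N"
  shows "restrict f (carrier M) \<in> mod_hom R M N"
proof -
  interpret M: abelian_group M using assms(1) by (rule module_abelian)
  show ?thesis using assms
    by (auto simp: mod_hom_iff left_module.smult_closed
        linmap_closed linmap_add linmap_smult intro!: linmapI)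
qed

lemma linmap_const_zero:
  assumes "left_module R N"
  shows "(\<lambda>x. \<zero>\<^bsub>N\<^esub>) \<in> linmap R M N"
proof -
  interpret N: abelian_group N using assms(1) by (rule module_abelian)
  show ?thesis using assms by (auto intro!: linmapI simp: smult_zero_right)
qed

lemma linmap_plus:
  assumes "left_module R N" "f \<in> linmap R M N" "g \<in> linmap R M N"
  shows "(\<lambda>x. f x \<oplus>\<^bsub>N\<^esub> g x) \<in> linmap R M N"
proof -
  interpret N: abelian_group N using assms(1) by (rule module_abelian)
  show ?thesis using assms
    by (intro linmapI) (auto simp: linmap_closed linmap_add linmap_smult N.add_add_swap
        left_module.smult_r_distr)
qed

lemma linmap_uminus:
  assumes "left_module R N" "f \<in> linmap R M N"
  shows "(\<lambda>x. \<ominus>\<^bsub>N\<^esub> f x) \<in> linmap R M N"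
proof -
  interpret N: abelian_group N using assms(1) by (rule module_abelian)
  show ?thesis using assms
    by (intro linmapI) (auto simp: linmap_closed linmap_add linmap_smult N.minus_add smult_neg_right)
qed

lemma linmap_diff:
  assumes "left_module R N" "f \<in> linmap R M N" "g \<in> linmap R M N"
  shows "(\<lambda>x. f x \<ominus>\<^bsub>N\<^esub> g x) \<in> linmap R M N"
  unfolding a_minus_def using assms by (intro linmap_plus linmap_uminus)

subsection \<open>Submodules, kernels and images\<close>

definition submod :: "('r, 'x) ring_scheme \<Rightarrow> ('r, 'm, 'y) module_scheme \<Rightarrow> 'm set \<Rightarrow> bool" where
  "submod R M K \<longleftrightarrow> K \<subseteq> carrier M \<and> \<zero>\<^bsub>M\<^esub> \<in> K \<and> (\<forall>x\<in>K. \<forall>y\<in>K. x \<oplus>\<^bsub>M\<^esub> y \<in> K) \<and>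
     (\<forall>a\<in>carrier R. \<forall>x\<in>K. a \<odot>\<^bsub>M\<^esub> x \<in> K)"

lemma submod_left_module:
  assumes M: "left_module R M" and K: "submod R M K"
  shows "left_module R (M\<lparr>carrier := K\<rparr>)"
proof -
  interpret M: abelian_group M using M by (rule module_abelian)
  interpret R: ring R using M by (rule module_ring)
  have K': "\<And>x. x \<in> K \<Longrightarrow> x \<in> carrier M" using K by (auto simp: submod_def)
  show ?thesis
  proof (intro left_moduleI abelian_groupI)
    fix x assume "x \<in> carrier (M\<lparr>carrier := K\<rparr>)"
    then have x: "x \<in> K" by simp
    \<comment> \<open>\<open>submod\<close> does not list closure under negatives; it comes from
      scaling by -1.\<close>
    have "(\<ominus>\<^bsub>R\<^esub> \<one>\<^bsub>R\<^esub>) \<odot>\<^bsub>M\<^esub> x \<in> K" using K x by (simp add: submod_def)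
    moreover have "(\<ominus>\<^bsub>R\<^esub> \<one>\<^bsub>R\<^esub>) \<odot>\<^bsub>M\<^esub> x = \<ominus>\<^bsub>M\<^esub> x"
      using K' x by (simp add: smult_neg_left[OF M] left_module.smult_one[OF M])
    ultimately show "\<exists>y\<in>carrier (M\<lparr>carrier := K\<rparr>).
        y \<oplus>\<^bsub>M\<lparr>carrier := K\<rparr>\<^esub> x = \<zero>\<^bsub>M\<lparr>carrier := K\<rparr>\<^esub>"
      using x K' by (auto intro!: bexI[of _ "\<ominus>\<^bsub>M\<^esub> x"] simp: M.l_neg)
  qed (use K K' M in \<open>auto simp: submod_def M.a_ac R.ring_axioms left_module.smult_l_distr
        left_module.smult_r_distr left_module.smult_assoc1 left_module.smult_one\<close>)
qed

lemma submod_ker: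
  assumes "left_module R M" "left_module R N" "f \<in> linmap R M N"
  shows "submod R M (mod_ker M N f)"
proof -
  interpret M: abelian_group M using assms(1) by (rule module_abelian)
  interpret N: abelian_group N using assms(2) by (rule module_abelian)
  show ?thesis using assms
    by (auto simp: submod_def mod_ker_def linmap_zero linmap_add linmap_smult smult_zero_right
        left_module.smult_closed)
qed

lemma submod_image:
  assumes "left_module R M" "left_module R N" "f \<in> linmap R M N"
  shows "submod R N (f ` carrier M)"
proof -
  interpret M: abelian_group M using assms(1) by (rule module_abelian)
  interpret N: abelian_group N using assms(2) by (rule module_abelian)
  show ?thesis
    unfolding submod_def
  proof (intro conjI ballI)
    show "\<zero>\<^bsub>N\<^esub> \<in> f ` carrier M"
      using linmap_zero[OF assms] by (metis M.zero_closed image_eqI)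
  next
    fix x y assume "x \<in> f ` carrier M" "y \<in> f ` carrier M"
    then obtain u v where "u \<in> carrier M" "v \<in> carrier M" "x = f u" "y = f v" by blast
    then show "x \<oplus>\<^bsub>N\<^esub> y \<in> f ` carrier M"
      by (auto intro!: image_eqI[of _ _ "u \<oplus>\<^bsub>M\<^esub> v"] simp: linmap_add[OF assms(3)])
  next
    fix a x assume "a \<in> carrier R" "x \<in> f ` carrier M"
    then obtain u where "u \<in> carrier M" "x = f u" "a \<in> carrier R" by blast
    then show "a \<odot>\<^bsub>N\<^esub> x \<in> f ` carrier M"
      by (auto intro!: image_eqI[of _ _ "a \<odot>\<^bsub>M\<^esub> u"] left_module.smult_closed[OF assms(1)]
          simp: linmap_smult[OF assms(3)])
  qed (use assms linmap_closed in auto)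
qed

lemma ker_left_module:
  "\<lbrakk>left_module R M; left_module R N; f \<in> linmap R M N\<rbrakk> \<Longrightarrow> left_module R (M\<lparr>carrier := mod_ker M N f\<rparr>)"
  by (intro submod_left_module submod_ker)

lemma image_left_module:
  "\<lbrakk>left_module R M; left_module R N; f \<in> linmap R M N\<rbrakk> \<Longrightarrow> left_module R (N\<lparr>carrier := f ` carrier M\<rparr>)"
  by (intro submod_left_module submod_image)

lemma linmap_into_sub:
  "\<lbrakk>f \<in> linmap R M N; f ` carrier M \<subseteq> K\<rbrakk> \<Longrightarrow> f \<in> linmap R M (N\<lparr>carrier := K\<rparr>)"
  by (auto simp: linmap_def ab_hom_def)

lemma linmap_from_sub:
  "\<lbrakk>f \<in> linmap R M N; K \<subseteq> carrier M\<rbrakk> \<Longrightarrow> f \<in> linmap R (M\<lparr>carrier := K\<rparr>) N"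
  by (auto simp: linmap_def ab_hom_def subset_iff)

lemma linmap_out_of_sub:
  "\<lbrakk>f \<in> linmap R M (N\<lparr>carrier := K\<rparr>); K \<subseteq> carrier N\<rbrakk> \<Longrightarrow> f \<in> linmap R M N"
  by (auto simp: linmap_def ab_hom_def)

lemma mod_ker_sub [simp]: "mod_ker M (N\<lparr>carrier := K\<rparr>) f = mod_ker M N f"
  by (simp add: mod_ker_def)

lemma linmap_eq_iff_ker:
  assumes "left_module R M" "left_module R N" "f \<in> linmap R M N" "x \<in> carrier M" "y \<in> carrier M"
  shows "f x = f y \<longleftrightarrow> x \<ominus>\<^bsub>M\<^esub> y \<in> mod_ker M N f"
proof -
  interpret M: abelian_group M using assms(1) by (rule module_abelian)
  interpret N: abelian_group N using assms(2) by (rule module_abelian)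
  show ?thesis
    using assms by (simp add: mod_ker_def linmap_minus N.minus_zero_iff linmap_closed)
qed

text \<open>The universal property of a quotient, phrased for an arbitrary surjection so that no
  coset type enters. \<open>H\<close> evaluates \<open>G\<close> at a chosen preimage; two preimages
  differ by an element of the kernel, which \<open>G\<close> kills.\<close>

lemma linmap_factor:
  assumes X: "left_module R X" and Y: "left_module R Y" and N: "left_module R N"
    and p: "p \<in> linmap R X Y" and surj: "p ` carrier X = carrier Y"
    and G: "G \<in> linmap R X N" and z: "\<And>x. x \<in> carrier X \<Longrightarrow> p x = \<zero>\<^bsub>Y\<^esub> \<Longrightarrow> G x = \<zero>\<^bsub>N\<^esub>"
  shows "\<exists>H\<in>linmap R Y N. \<forall>x\<in>carrier X. H (p x) = G x"
proof -
  interpret X: abelian_group X using X by (rule module_abelian)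
  define H where "H y = G (SOME x. x \<in> carrier X \<and> p x = y)" for y
  have H: "H (p x) = G x" if x: "x \<in> carrier X" for x
  proof -
    let ?x = "SOME x'. x' \<in> carrier X \<and> p x' = p x"
    have "?x \<in> carrier X \<and> p ?x = p x" by (rule someI_ex) (use x in blast)
    moreover from this have "?x \<ominus>\<^bsub>X\<^esub> x \<in> mod_ker X Y p"
      using linmap_eq_iff_ker[OF X Y p _ x] by blast
    ultimately show ?thesis
      using z x linmap_eq_iff_ker[OF X N G _ x] by (simp add: mod_ker_def H_def)
  qed
  have "H \<in> linmap R Y N"
  proof (rule linmapI)
    fix y assume "y \<in> carrier Y"
    then obtain x where "x \<in> carrier X" "y = p x" using surj by blast
    then show "H y \<in> carrier N" using H linmap_closed[OF G] by simp
  next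
    fix y y' assume "y \<in> carrier Y" "y' \<in> carrier Y"
    then obtain x x' where x: "x \<in> carrier X" "y = p x" "x' \<in> carrier X" "y' = p x'"
      using surj by blast
    then have "y \<oplus>\<^bsub>Y\<^esub> y' = p (x \<oplus>\<^bsub>X\<^esub> x')" by (simp add: linmap_add[OF p])
    then show "H (y \<oplus>\<^bsub>Y\<^esub> y') = H y \<oplus>\<^bsub>N\<^esub> H y'" using x by (simp add: H linmap_add[OF G])
  next
    fix a y assume a: "a \<in> carrier R" and "y \<in> carrier Y"
    then obtain x where x: "x \<in> carrier X" "y = p x" using surj by blast
    then have "a \<odot>\<^bsub>Y\<^esub> y = p (a \<odot>\<^bsub>X\<^esub> x)" using a by (simp add: linmap_smult[OF p])
    then show "H (a \<odot>\<^bsub>Y\<^esub> y) = a \<odot>\<^bsub>N\<^esub> H y"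
      using x a by (simp add: H linmap_smult[OF G] left_module.smult_closed[OF X])
  qed
  then show ?thesis using H by blast
qed

subsection \<open>Direct sums\<close>

definition dsum :: "('r, 'm, 'y) module_scheme \<Rightarrow> ('r, 'n, 'z) module_scheme \<Rightarrow> ('r, 'm \<times> 'n) module"
  where "dsum M N = \<lparr>carrier = carrier M \<times> carrier N, monoid.mult = undefined, one = undefined,
     ring.zero = (\<zero>\<^bsub>M\<^esub>, \<zero>\<^bsub>N\<^esub>), ring.add = (\<lambda>(x, y) (x', y'). (x \<oplus>\<^bsub>M\<^esub> x', y \<oplus>\<^bsub>N\<^esub> y')),
     smult = (\<lambda>a (x, y). (a \<odot>\<^bsub>M\<^esub> x, a \<odot>\<^bsub>N\<^esub> y))\<rparr>"

lemma dsum_simps [simp]: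
  "carrier (dsum M N) = carrier M \<times> carrier N"
  "\<zero>\<^bsub>dsum M N\<^esub> = (\<zero>\<^bsub>M\<^esub>, \<zero>\<^bsub>N\<^esub>)"
  "(x, y) \<oplus>\<^bsub>dsum M N\<^esub> (x', y') = (x \<oplus>\<^bsub>M\<^esub> x', y \<oplus>\<^bsub>N\<^esub> y')"
  "a \<odot>\<^bsub>dsum M N\<^esub> (x, y) = (a \<odot>\<^bsub>M\<^esub> x, a \<odot>\<^bsub>N\<^esub> y)"
  by (simp_all add: dsum_def)

lemma dsum_left_module:
  assumes M: "left_module R M" and N: "left_module R N"
  shows "left_module R (dsum M N)"
proof -
  interpret M: abelian_group M using M by (rule module_abelian)
  interpret N: abelian_group N using N by (rule module_abelian)
  show ?thesis
  proof (intro left_moduleI abelian_groupI)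
    fix x assume "x \<in> carrier (dsum M N)"
    then show "\<exists>y\<in>carrier (dsum M N). y \<oplus>\<^bsub>dsum M N\<^esub> x = \<zero>\<^bsub>dsum M N\<^esub>"
      by (auto intro!: bexI[of _ "(\<ominus>\<^bsub>M\<^esub> fst x, \<ominus>\<^bsub>N\<^esub> snd x)"] simp: M.l_neg N.l_neg)
  qed (use M N in \<open>auto simp: module_ring left_module.smult_closed left_module.smult_l_distr
        left_module.smult_r_distr left_module.smult_assoc1 left_module.smult_one
        M.a_ac N.a_ac\<close>)
qed

section \<open>Subquotients and quotients\<close>

lemma ab_hom_image_subgroup:
  assumes "abelian_group G" "abelian_group H" "f \<in> ab_hom G H"
  shows "subgroup (f ` carrier G) (add_monoid H)"
  using group_hom.img_is_subgroup[OF ab_hom_group_hom[OF assms]] by simp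

lemma ab_hom_ker_subgroup:
  assumes "abelian_group G" "abelian_group H" "f \<in> ab_hom G H"
  shows "subgroup {x \<in> carrier G. f x = \<zero>\<^bsub>H\<^esub>} (add_monoid G)"
  using group_hom.subgroup_kernel[OF ab_hom_group_hom[OF assms]] by (simp add: kernel_def)

text \<open>\<open>B\<close> is one of the cosets, so there is a single coset exactly when every
  element of \<open>Z\<close> lies in \<open>B\<close>. This turns vanishing of Ext and Tor into
  exactness statements about elements.\<close>

lemma subquotient_trivial_iff:
  assumes G: "abelian_group G" and Z: "subgroup Z (add_monoid G)"
    and B: "subgroup B (add_monoid G)" and BZ: "B \<subseteq> Z"
  shows "trivial_group (subquotient G Z B) \<longleftrightarrow> Z \<subseteq> B"
proof -
  interpret G: abelian_group G by fact
  let ?H = "(add_monoid G)\<lparr>carrier := Z\<rparr>"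
  interpret H: comm_group ?H
    using subgroup.subgroup_is_group[OF Z G.a_group] subgroup.subset[OF Z]
    by (intro group.group_comm_groupI) (auto simp: G.a_comm subset_iff)
  have BH: "subgroup B ?H"
    using group.subgroup_incl[OF G.a_group B Z BZ] .
  interpret N: normal B ?H using H.subgroup_imp_normal[OF BH] .
  show ?thesis
  proof
    assume "trivial_group (subquotient G Z B)"
    then have triv: "rcosets\<^bsub>?H\<^esub> B = {B}"
      by (simp add: trivial_group_def subquotient_def FactGroup_def)
    show "Z \<subseteq> B"
    proof
      fix z assume "z \<in> Z"
      then have z: "z \<in> carrier ?H" by simp
      then have "B #>\<^bsub>?H\<^esub> z \<in> rcosets\<^bsub>?H\<^esub> B" using BZ by (intro H.rcosetsI) auto
      then have "B #>\<^bsub>?H\<^esub> z = B" using triv by simp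
      then show "z \<in> B" using H.rcos_self[OF z BH] by simp
    qed
  next
    assume "Z \<subseteq> B"
    then have "carrier ?H = B" using BZ by auto
    then have "rcosets\<^bsub>?H\<^esub> B = {B}"
      using H.coset_join2[OF _ BH] BH H.one_closed by (auto simp: RCOSETS_def)
    moreover have "group (?H Mod B)" by (rule N.factorgroup_is_group)
    ultimately show "trivial_group (subquotient G Z B)"
      by (simp add: trivial_group_def subquotient_def FactGroup_def)
  qed
qed

text \<open>Factor groups are multiplicative monoids, whereas additive groups here are the additive
  part of a ring record; this translates the former into the latter.\<close>

definition ring_of_monoid :: "'a monoid \<Rightarrow> 'a ring" where
  "ring_of_monoid T = \<lparr>carrier = carrier T, monoid.mult = undefined, one = undefined,
     ring.zero = one T, ring.add = monoid.mult T\<rparr>"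

lemma ring_of_monoid_simps [simp]:
  "carrier (ring_of_monoid T) = carrier T" "\<zero>\<^bsub>ring_of_monoid T\<^esub> = \<one>\<^bsub>T\<^esub>"
  "x \<oplus>\<^bsub>ring_of_monoid T\<^esub> y = x \<otimes>\<^bsub>T\<^esub> y"
  by (simp_all add: ring_of_monoid_def)

lemma ring_of_monoid_abelian:
  assumes "comm_group T"
  shows "abelian_group (ring_of_monoid T)"
proof -
  interpret T: comm_group T by fact
  show ?thesis
    by (rule abelian_groupI) (auto simp: T.m_ac intro: T.l_inv_ex)
qed

definition quot_ab :: "('a, 'x) ring_scheme \<Rightarrow> 'a set \<Rightarrow> 'a set ring" where
  "quot_ab G I = ring_of_monoid (add_monoid G Mod I)"

lemma quot_ab:
  assumes G: "abelian_group G" and I: "subgroup I (add_monoid G)"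
  shows "abelian_group (quot_ab G I)"
    and "(\<lambda>x. I #>\<^bsub>add_monoid G\<^esub> x) \<in> ab_hom G (quot_ab G I)"
    and "x \<in> carrier G \<Longrightarrow> I #>\<^bsub>add_monoid G\<^esub> x = \<zero>\<^bsub>quot_ab G I\<^esub> \<longleftrightarrow> x \<in> I"
proof -
  interpret G: abelian_group G by fact
  interpret N: normal I "add_monoid G"
    using comm_group.subgroup_imp_normal[OF G.a_comm_group I] .
  show "abelian_group (quot_ab G I)"
    unfolding quot_ab_def
    by (intro ring_of_monoid_abelian comm_group.abelian_FactGroup[OF G.a_comm_group] I)
  show "(\<lambda>x. I #>\<^bsub>add_monoid G\<^esub> x) \<in> ab_hom G (quot_ab G I)"
    using N.r_coset_hom_Mod by (auto simp: hom_def ab_hom_def quot_ab_def)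
  show "I #>\<^bsub>add_monoid G\<^esub> x = \<zero>\<^bsub>quot_ab G I\<^esub> \<longleftrightarrow> x \<in> I" if "x \<in> carrier G"
    using group.coset_join1[OF G.a_group _ _ I] group.coset_join2[OF G.a_group _ I] that N.subset
    by (auto simp: quot_ab_def)
qed

section \<open>Tensor products\<close>

lemma opp_simps [simp]:
  "carrier (opp R) = carrier R" "\<zero>\<^bsub>opp R\<^esub> = \<zero>\<^bsub>R\<^esub>" "\<one>\<^bsub>opp R\<^esub> = \<one>\<^bsub>R\<^esub>"
  "ring.add (opp R) = ring.add R" "a \<otimes>\<^bsub>opp R\<^esub> b = b \<otimes>\<^bsub>R\<^esub> a" "opp (opp R) = R"
  by (simp_all add: opp_def)

text \<open>Linearity refers to \<open>R\<close> only through its carrier. Hence maps of right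
  modules are written with \<open>linmap R\<close>, although the modules themselves are over
  \<open>opp R\<close>.\<close>

lemma linmap_opp [simp]: "linmap (opp R) M N = linmap R M N"
  by (simp add: linmap_def)

lemma mod_hom_opp [simp]: "mod_hom (opp R) M N = mod_hom R M N"
  by (simp add: mod_hom_def)

lemma ring_opp:
  assumes "ring R"
  shows "ring (opp R)"
proof -
  interpret R: ring R by fact
  show ?thesis
    by (intro ringI abelian_groupI monoidI)
      (auto simp: R.a_ac R.m_assoc R.l_distr R.r_distr intro: bexI[of _ "\<ominus>\<^bsub>R\<^esub> _"] R.l_neg)
qed

lemma frag_diff_in_free:
  "\<lbrakk>x \<in> carrier (free_Abelian_group X); y \<in> carrier (free_Abelian_group X)\<rbrakk>
    \<Longrightarrow> x - y \<in> carrier (free_Abelian_group X)"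
  using keys_diff[of x y] by auto

lemma frag_add_in_free:
  "\<lbrakk>x \<in> carrier (free_Abelian_group X); y \<in> carrier (free_Abelian_group X)\<rbrakk>
    \<Longrightarrow> x + y \<in> carrier (free_Abelian_group X)"
  using keys_add[of x y] by auto

definition tensor_gens ::
  "('r, 'x) ring_scheme \<Rightarrow> ('r, 'a, 'y) module_scheme \<Rightarrow> ('r, 'm, 'z) module_scheme \<Rightarrow>
   ('a \<times> 'm \<Rightarrow>\<^sub>0 int) set" where
  "tensor_gens R A M =
     {frag_of (a \<oplus>\<^bsub>A\<^esub> a', m) - frag_of (a, m) - frag_of (a', m) | a a' m.
         a \<in> carrier A \<and> a' \<in> carrier A \<and> m \<in> carrier M} \<union>
      {frag_of (a, m \<oplus>\<^bsub>M\<^esub> m') - frag_of (a, m) - frag_of (a, m') | a m m'.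
         a \<in> carrier A \<and> m \<in> carrier M \<and> m' \<in> carrier M} \<union>
      {frag_of (r \<odot>\<^bsub>A\<^esub> a, m) - frag_of (a, r \<odot>\<^bsub>M\<^esub> m) | r a m.
         r \<in> carrier R \<and> a \<in> carrier A \<and> m \<in> carrier M}"

text \<open>Since \<open>A\<close> is a right module, \<open>r \<odot> a\<close> in the last clause
  stands for a r: the clause is the usual condition that \<open>\<beta>\<close> agrees on (a r, m)
  and (a, r m).\<close>

definition balanced ::
  "('r, 'x) ring_scheme \<Rightarrow> ('r, 'a, 'y) module_scheme \<Rightarrow> ('r, 'm, 'z) module_scheme \<Rightarrow>
   ('g, 'w) ring_scheme \<Rightarrow> ('a \<Rightarrow> 'm \<Rightarrow> 'g) \<Rightarrow> bool" where
  "balanced R A M G \<beta> \<longleftrightarrow>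
     (\<forall>a\<in>carrier A. \<forall>m\<in>carrier M. \<beta> a m \<in> carrier G) \<and>
     (\<forall>a\<in>carrier A. \<forall>a'\<in>carrier A. \<forall>m\<in>carrier M. \<beta> (a \<oplus>\<^bsub>A\<^esub> a') m = \<beta> a m \<oplus>\<^bsub>G\<^esub> \<beta> a' m) \<and>
     (\<forall>a\<in>carrier A. \<forall>m\<in>carrier M. \<forall>m'\<in>carrier M. \<beta> a (m \<oplus>\<^bsub>M\<^esub> m') = \<beta> a m \<oplus>\<^bsub>G\<^esub> \<beta> a m') \<and>
     (\<forall>r\<in>carrier R. \<forall>a\<in>carrier A. \<forall>m\<in>carrier M. \<beta> (r \<odot>\<^bsub>A\<^esub> a) m = \<beta> a (r \<odot>\<^bsub>M\<^esub> m))"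

locale tensor_pair =
  fixes R :: "('r, 'x) ring_scheme" and A :: "('r, 'a, 'y) module_scheme"
    and M :: "('r, 'm, 'z) module_scheme"
  assumes A: "left_module (opp R) A" and M: "left_module R M"
begin

abbreviation "FA \<equiv> free_Abelian_group (carrier A \<times> carrier M)"
abbreviation "Rels \<equiv> tensor_rels R A M"
abbreviation "T \<equiv> tensor_ab R A M"
abbreviation elt (infixl \<open>\<boxtimes>\<close> 75) where "a \<boxtimes> m \<equiv> tensor_elt R A M a m"

sublocale A: abelian_group A using A by (rule module_abelian)
sublocale M: abelian_group M using M by (rule module_abelian)

lemma rels_generate: "Rels = generate FA (tensor_gens R A M)"
  by (simp add: tensor_rels_def tensor_gens_def)

lemma gens_in_FA: "tensor_gens R A M \<subseteq> carrier FA"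
  unfolding tensor_gens_def
  by (auto intro!: frag_diff_in_free simp del: carrier_free_Abelian_group_iff
      simp: left_module.smult_closed[OF M] left_module.smult_closed[OF A, simplified])

lemma rels_subgroup: "subgroup Rels FA"
  unfolding rels_generate
  by (rule group.generate_is_subgroup[OF group_free_Abelian_group gens_in_FA])

lemma rels_normal: "normal Rels FA"
  by (rule comm_group.subgroup_imp_normal[OF abelian_free_Abelian_group rels_subgroup])

lemma T_eq: "T = ring_of_monoid (FA Mod Rels)"
  by (simp add: tensor_ab_def ring_of_monoid_def Let_def)

lemma T_ab: "abelian_group T"
  unfolding T_eq
  by (intro ring_of_monoid_abelian comm_group.abelian_FactGroup abelian_free_Abelian_group
      rels_subgroup)

sublocale T: abelian_group T by (rule T_ab)

definition proj where "proj u = Rels #>\<^bsub>FA\<^esub> u"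

lemma carrier_T: "carrier T = proj ` carrier FA"
  by (auto simp: T_eq FactGroup_def RCOSETS_def proj_def)

lemma proj_closed: "u \<in> carrier FA \<Longrightarrow> proj u \<in> carrier T"
  unfolding carrier_T by blast

lemma proj_add: "\<lbrakk>u \<in> carrier FA; v \<in> carrier FA\<rbrakk> \<Longrightarrow> proj (u + v) = proj u \<oplus>\<^bsub>T\<^esub> proj v"
  using normal.r_coset_hom_Mod[OF rels_normal]
  unfolding hom_def T_eq proj_def by (simp del: carrier_free_Abelian_group_iff)

lemma proj_eqI:
  assumes "u \<in> carrier FA" "v \<in> carrier FA" "u - v \<in> Rels"
  shows "proj u = proj v"
proof -
  have "u \<in> Rels #>\<^bsub>FA\<^esub> v"
    using assms(3) by (auto simp: r_coset_def intro!: bexI[of _ "u - v"])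
  then show ?thesis
    unfolding proj_def
    using group.repr_independence[OF group_free_Abelian_group _ assms(2) rels_subgroup] by simp
qed

lemma proj_frag: "proj (frag_of (a, m)) = a \<boxtimes> m"
  by (simp add: proj_def tensor_elt_def)

lemma elt_closed: "\<lbrakk>a \<in> carrier A; m \<in> carrier M\<rbrakk> \<Longrightarrow> a \<boxtimes> m \<in> carrier T"
  unfolding proj_frag[symmetric] by (rule proj_closed) simp

lemma gens_rels: "u \<in> tensor_gens R A M \<Longrightarrow> u \<in> Rels"
  unfolding rels_generate by (rule generate.incl)

lemma elt_add_left:
  assumes "a \<in> carrier A" "a' \<in> carrier A" "m \<in> carrier M"
  shows "(a \<oplus>\<^bsub>A\<^esub> a') \<boxtimes> m = a \<boxtimes> m \<oplus>\<^bsub>T\<^esub> a' \<boxtimes> m"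
proof -
  have "frag_of (a \<oplus>\<^bsub>A\<^esub> a', m) - (frag_of (a, m) + frag_of (a', m)) \<in> Rels"
    by (rule gens_rels) (use assms in \<open>auto simp: tensor_gens_def diff_diff_eq[symmetric]\<close>)
  then have "proj (frag_of (a \<oplus>\<^bsub>A\<^esub> a', m)) = proj (frag_of (a, m) + frag_of (a', m))"
    using assms by (intro proj_eqI frag_add_in_free) auto
  then show ?thesis using assms by (simp add: proj_add proj_frag)
qed

lemma elt_add_right:
  assumes "a \<in> carrier A" "m \<in> carrier M" "m' \<in> carrier M"
  shows "a \<boxtimes> (m \<oplus>\<^bsub>M\<^esub> m') = a \<boxtimes> m \<oplus>\<^bsub>T\<^esub> a \<boxtimes> m'"
proof -
  have "frag_of (a, m \<oplus>\<^bsub>M\<^esub> m') - (frag_of (a, m) + frag_of (a, m')) \<in> Rels"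
    by (rule gens_rels) (use assms in \<open>auto simp: tensor_gens_def diff_diff_eq[symmetric]\<close>)
  then have "proj (frag_of (a, m \<oplus>\<^bsub>M\<^esub> m')) = proj (frag_of (a, m) + frag_of (a, m'))"
    using assms by (intro proj_eqI frag_add_in_free) auto
  then show ?thesis using assms by (simp add: proj_add proj_frag)
qed

lemma elt_smult:
  assumes "r \<in> carrier R" "a \<in> carrier A" "m \<in> carrier M"
  shows "(r \<odot>\<^bsub>A\<^esub> a) \<boxtimes> m = a \<boxtimes> (r \<odot>\<^bsub>M\<^esub> m)"
proof -
  have "frag_of (r \<odot>\<^bsub>A\<^esub> a, m) - frag_of (a, r \<odot>\<^bsub>M\<^esub> m) \<in> Rels"
    by (rule gens_rels) (use assms in \<open>auto simp: tensor_gens_def\<close>)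
  then have "proj (frag_of (r \<odot>\<^bsub>A\<^esub> a, m)) = proj (frag_of (a, r \<odot>\<^bsub>M\<^esub> m))"
    using assms by (intro proj_eqI)
      (auto simp: left_module.smult_closed[OF M] left_module.smult_closed[OF A, simplified])
  then show ?thesis by (simp add: proj_frag)
qed

lemma elt_left_hom: "m \<in> carrier M \<Longrightarrow> (\<lambda>a. a \<boxtimes> m) \<in> ab_hom A T"
  by (intro ab_homI elt_closed elt_add_left)

lemma elt_right_hom: "a \<in> carrier A \<Longrightarrow> (\<lambda>m. a \<boxtimes> m) \<in> ab_hom M T"
  by (intro ab_homI elt_closed elt_add_right)

lemma elt_zero_left: "m \<in> carrier M \<Longrightarrow> \<zero>\<^bsub>A\<^esub> \<boxtimes> m = \<zero>\<^bsub>T\<^esub>"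
  by (rule ab_hom_zero[OF A.abelian_group_axioms T.abelian_group_axioms elt_left_hom])

lemma elt_neg_left: "\<lbrakk>a \<in> carrier A; m \<in> carrier M\<rbrakk> \<Longrightarrow> (\<ominus>\<^bsub>A\<^esub> a) \<boxtimes> m = \<ominus>\<^bsub>T\<^esub> (a \<boxtimes> m)"
  by (rule ab_hom_neg[OF A.abelian_group_axioms T.abelian_group_axioms elt_left_hom])

text \<open>The induction rule of the free abelian group proceeds by differences, so
  \<open>P\<close> is carried along for a tensor and its negative at once. The negative of
  \<open>a \<boxtimes> m\<close> is the pure tensor with -a in place of a, which absorbs negatives
  into the case \<open>elt\<close>.\<close>

lemma T_induct [consumes 1, case_names elt add]:
  assumes t: "t \<in> carrier T"
    and elt: "\<And>a m. \<lbrakk>a \<in> carrier A; m \<in> carrier M\<rbrakk> \<Longrightarrow> P (a \<boxtimes> m)"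
    and add: "\<And>s t. \<lbrakk>s \<in> carrier T; t \<in> carrier T; P s; P t\<rbrakk> \<Longrightarrow> P (s \<oplus>\<^bsub>T\<^esub> t)"
  shows "P t"
proof -
  obtain u where u: "u \<in> carrier FA" "t = proj u" using t by (auto simp: carrier_T)
  have "P (proj u) \<and> P (\<ominus>\<^bsub>T\<^esub> proj u)" if "Poly_Mapping.keys u \<subseteq> carrier A \<times> carrier M" for u
    using that
  proof (rule free_Abelian_group_induct)
    have "proj 0 = proj 0 \<oplus>\<^bsub>T\<^esub> proj 0" using proj_add[of 0 0] by simp
    then have "proj 0 = \<zero>\<^bsub>T\<^esub>" by (intro T.eq_zero_if_double proj_closed) auto
    moreover have "P \<zero>\<^bsub>T\<^esub>"
      using elt[of "\<zero>\<^bsub>A\<^esub>" "\<zero>\<^bsub>M\<^esub>"] by (simp add: elt_zero_left)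
    moreover have "\<ominus>\<^bsub>T\<^esub> \<zero>\<^bsub>T\<^esub> = \<zero>\<^bsub>T\<^esub>" by (rule T.minus_equality) simp_all
    ultimately show "P (proj 0) \<and> P (\<ominus>\<^bsub>T\<^esub> proj 0)" by (simp only: simp_thms)
  next
    fix x y :: "'a \<times> 'm \<Rightarrow>\<^sub>0 int"
    assume 2: "Poly_Mapping.keys x \<subseteq> carrier A \<times> carrier M"
      "Poly_Mapping.keys y \<subseteq> carrier A \<times> carrier M"
      "P (proj x) \<and> P (\<ominus>\<^bsub>T\<^esub> proj x)" "P (proj y) \<and> P (\<ominus>\<^bsub>T\<^esub> proj y)"
    have "proj (x - y) \<oplus>\<^bsub>T\<^esub> proj y = proj x"
      using proj_add[of "x - y" y] frag_diff_in_free[of x _ y] 2 by simp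
    then have *: "proj (x - y) = proj x \<oplus>\<^bsub>T\<^esub> \<ominus>\<^bsub>T\<^esub> proj y"
      using T.add_minus_cancel[of "proj (x - y)" "proj y"] 2 frag_diff_in_free[of x _ y]
      by (simp add: a_minus_def proj_closed)
    then have **: "\<ominus>\<^bsub>T\<^esub> proj (x - y) = \<ominus>\<^bsub>T\<^esub> proj x \<oplus>\<^bsub>T\<^esub> proj y"
      using 2 by (simp add: T.minus_add proj_closed)
    show "P (proj (x - y)) \<and> P (\<ominus>\<^bsub>T\<^esub> proj (x - y))"
      unfolding ** unfolding * using 2 by (auto intro!: add simp: proj_closed)
  next
    fix p assume "p \<in> carrier A \<times> carrier M"
    then obtain a m where p: "p = (a, m)" "a \<in> carrier A" "m \<in> carrier M" by auto
    then show "P (proj (frag_of p)) \<and> P (\<ominus>\<^bsub>T\<^esub> proj (frag_of p))"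
      using elt[of a m] elt[of "\<ominus>\<^bsub>A\<^esub> a" m] by (simp add: proj_frag elt_neg_left)
  qed
  then show ?thesis using u by simp
qed

lemma T_hom_eq:
  assumes G: "f \<in> ab_hom T G" "g \<in> ab_hom T G" and t: "t \<in> carrier T"
    and eq: "\<And>a m. \<lbrakk>a \<in> carrier A; m \<in> carrier M\<rbrakk> \<Longrightarrow> f (a \<boxtimes> m) = g (a \<boxtimes> m)"
  shows "f t = g t"
  using t by (induction t rule: T_induct) (auto simp: eq ab_hom_add[OF G(1)] ab_hom_add[OF G(2)])

section \<open>The universal property of the tensor product\<close>

context
  fixes G :: "('g, 'w) ring_scheme" and \<beta> :: "'a \<Rightarrow> 'm \<Rightarrow> 'g"
  assumes G: "abelian_group G" and bal: "balanced R A M G \<beta>"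
begin

interpretation G: abelian_group G by (rule G)

text \<open>\<open>tensor_lift\<close> is defined by an explicit finite sum, while additivity comes
  with the homomorphism given by freeness. The two agree because every element is the sum of its
  keys with their coefficients.\<close>

lemma lift_exists:
  "\<exists>h. (\<forall>u\<in>carrier FA. (\<Oplus>\<^bsub>G\<^esub>p\<in>Poly_Mapping.keys u.
                  add_pow G (Poly_Mapping.lookup u p) (\<beta> (fst p) (snd p))) = h u) \<and>
      h \<in> hom FA (add_monoid G) \<and> (\<forall>p\<in>carrier A \<times> carrier M. h (frag_of p) = \<beta> (fst p) (snd p))"
proof -
  have img: "(\<lambda>p. \<beta> (fst p) (snd p)) ` (carrier A \<times> carrier M) \<subseteq> carrier (add_monoid G)"
    using bal by (auto simp: balanced_def)
  obtain h where h: "h \<in> hom FA (add_monoid G)"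
    and hf: "\<And>p. p \<in> carrier A \<times> carrier M \<Longrightarrow> h (frag_of p) = \<beta> (fst p) (snd p)"
    using comm_group.free_Abelian_group_universal[OF G.a_comm_group img] by blast
  interpret h: group_hom FA "add_monoid G" h
    using h G.a_group by (simp add: group_hom_def group_hom_axioms_def)
  have pow: "h (frag_cmul n (frag_of p)) = add_pow G n (\<beta> (fst p) (snd p))"
    if p: "p \<in> carrier A \<times> carrier M" for n p
  proof -
    have "h (frag_of p [^]\<^bsub>FA\<^esub> n) = h (frag_of p) [^]\<^bsub>add_monoid G\<^esub> n"
      by (rule h.hom_int_pow) (use p in simp)
    then show ?thesis using p by (simp add: hf add_pow_def)
  qed
  have sum: "(\<Sum>p\<in>K. frag_cmul (c p) (frag_of p)) \<in> carrier FA \<and>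
     h (\<Sum>p\<in>K. frag_cmul (c p) (frag_of p)) = (\<Oplus>\<^bsub>G\<^esub>p\<in>K. add_pow G (c p) (\<beta> (fst p) (snd p)))"
    if "finite K" "K \<subseteq> carrier A \<times> carrier M" for K c
    using that
  proof (induction K rule: finite_induct)
    case empty
    then show ?case using h.hom_one by simp
  next
    case (insert p K)
    have \<beta>: "\<beta> (fst q) (snd q) \<in> carrier G" if "q \<in> insert p K" for q
      using img insert.prems that by auto
    have cl: "frag_cmul (c p) (frag_of p) \<in> carrier FA"
      using insert.prems keys_cmul[of "c p" "frag_of p"] by auto
    have IH: "(\<Sum>p\<in>K. frag_cmul (c p) (frag_of p)) \<in> carrier FA"
      "h (\<Sum>p\<in>K. frag_cmul (c p) (frag_of p)) = (\<Oplus>\<^bsub>G\<^esub>p\<in>K. add_pow G (c p) (\<beta> (fst p) (snd p)))"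
      using insert.IH insert.prems by blast+
    have "h (frag_cmul (c p) (frag_of p) + (\<Sum>p\<in>K. frag_cmul (c p) (frag_of p))) =
       h (frag_cmul (c p) (frag_of p)) \<oplus>\<^bsub>G\<^esub> h (\<Sum>p\<in>K. frag_cmul (c p) (frag_of p))"
      using h.hom_mult[OF cl IH(1)] by simp
    also have "\<dots> = (\<Oplus>\<^bsub>G\<^esub>p\<in>insert p K. add_pow G (c p) (\<beta> (fst p) (snd p)))"
      using insert \<beta> by (subst G.finsum_insert) (auto simp: IH(2) pow)
    finally show ?case
      using insert.hyps frag_add_in_free[OF cl IH(1)] by simp
  qed
  have "(\<Oplus>\<^bsub>G\<^esub>p\<in>Poly_Mapping.keys u. add_pow G (Poly_Mapping.lookup u p) (\<beta> (fst p) (snd p))) = h u"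
    if "u \<in> carrier FA" for u
    using sum[of "Poly_Mapping.keys u" "Poly_Mapping.lookup u"] that frag_expansion[of u]
    by (simp add: frag_extend_def)
  then show ?thesis using h hf by blast
qed

text \<open>Each family of generating relations is killed by one clause of \<open>balanced\<close>,
  and the kernel is a subgroup, so it contains the subgroup that they generate.\<close>

lemma lift_kills_rels:
  assumes h: "h \<in> hom FA (add_monoid G)"
    and hf: "\<And>p. p \<in> carrier A \<times> carrier M \<Longrightarrow> h (frag_of p) = \<beta> (fst p) (snd p)"
    and u: "u \<in> Rels"
  shows "h u = \<zero>\<^bsub>G\<^esub>"
proof -
  interpret h: group_hom FA "add_monoid G" h
    using h G.a_group by (simp add: group_hom_def group_hom_axioms_def)
  have hd: "h (x - y) = h x \<ominus>\<^bsub>G\<^esub> h y" if "x \<in> carrier FA" "y \<in> carrier FA" for x y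
  proof -
    have "h ((x - y) \<otimes>\<^bsub>FA\<^esub> y) = h (x - y) \<oplus>\<^bsub>G\<^esub> h y"
      using h.hom_mult[OF frag_diff_in_free[OF that] that(2)] by simp
    then show ?thesis
      using G.add_minus_cancel[of "h (x - y)" "h y"] h.hom_closed[OF frag_diff_in_free[OF that]]
        h.hom_closed[OF that(2)] by simp
  qed
  have \<beta>: "\<And>a m. \<lbrakk>a \<in> carrier A; m \<in> carrier M\<rbrakk> \<Longrightarrow> \<beta> a m \<in> carrier G"
    using bal by (simp add: balanced_def)
  have A_smult: "\<And>r a. \<lbrakk>r \<in> carrier R; a \<in> carrier A\<rbrakk> \<Longrightarrow> r \<odot>\<^bsub>A\<^esub> a \<in> carrier A"
    using left_module.smult_closed[OF A] by simp
  note cl = frag_of_in_free_Abelian_group[THEN iffD2] frag_diff_in_free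
  have G3: "x \<oplus>\<^bsub>G\<^esub> y \<ominus>\<^bsub>G\<^esub> x \<ominus>\<^bsub>G\<^esub> y = \<zero>\<^bsub>G\<^esub>" if "x \<in> carrier G" "y \<in> carrier G" for x y
    using that by (simp add: G.a_comm[of x y] G.add_minus_cancel G.minus_zero_iff)
  have "tensor_gens R A M \<subseteq> kernel FA (add_monoid G) h"
  proof
    fix u assume u: "u \<in> tensor_gens R A M"
    then have "h u = \<zero>\<^bsub>G\<^esub>"
      unfolding tensor_gens_def
    proof (elim UnE CollectE exE conjE)
      fix a a' m assume "a \<in> carrier A" "a' \<in> carrier A" "m \<in> carrier M"
        and u: "u = frag_of (a \<oplus>\<^bsub>A\<^esub> a', m) - frag_of (a, m) - frag_of (a', m)"
      then show "h u = \<zero>\<^bsub>G\<^esub>"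
        using bal G3[of "\<beta> a m" "\<beta> a' m"] \<beta> unfolding u balanced_def by (simp add: hd cl hf del: carrier_free_Abelian_group_iff)
    next
      fix a m m' assume "a \<in> carrier A" "m' \<in> carrier M" "m \<in> carrier M"
        and u: "u = frag_of (a, m \<oplus>\<^bsub>M\<^esub> m') - frag_of (a, m) - frag_of (a, m')"
      then show "h u = \<zero>\<^bsub>G\<^esub>"
        using bal G3[of "\<beta> a m" "\<beta> a m'"] \<beta> unfolding u balanced_def by (simp add: hd cl hf del: carrier_free_Abelian_group_iff)
    next
      fix r a m assume "r \<in> carrier R" "a \<in> carrier A" "m \<in> carrier M"
        and u: "u = frag_of (r \<odot>\<^bsub>A\<^esub> a, m) - frag_of (a, r \<odot>\<^bsub>M\<^esub> m)"
      then show "h u = \<zero>\<^bsub>G\<^esub>"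
        using bal \<beta> A_smult left_module.smult_closed[OF M] unfolding u balanced_def
        by (simp add: hd cl hf G.minus_zero_iff del: carrier_free_Abelian_group_iff)
    qed
    then show "u \<in> kernel FA (add_monoid G) h"
      using subsetD[OF gens_in_FA u] by (simp add: kernel_def del: carrier_free_Abelian_group_iff)
  qed
  then have "Rels \<subseteq> kernel FA (add_monoid G) h"
    unfolding rels_generate
    by (intro group.generate_subgroup_incl[OF group_free_Abelian_group] h.subgroup_kernel)
  then show ?thesis using u by (auto simp: kernel_def)
qed

text \<open>\<open>the_elem\<close> in \<open>tensor_lift\<close> makes sense only if the sum is
  constant on a coset: representatives of \<open>proj u\<close> differ from \<open>u\<close> by a
  relation, and \<open>h\<close> vanishes there.\<close>

lemma lift_proj:
  "\<exists>h. h \<in> hom FA (add_monoid G) \<and>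
    (\<forall>p\<in>carrier A \<times> carrier M. h (frag_of p) = \<beta> (fst p) (snd p)) \<and>
    (\<forall>u\<in>carrier FA. tensor_lift R A M G \<beta> (proj u) = h u)"
proof -
  obtain h where fin: "\<And>u. u \<in> carrier FA \<Longrightarrow> (\<Oplus>\<^bsub>G\<^esub>p\<in>Poly_Mapping.keys u.
                  add_pow G (Poly_Mapping.lookup u p) (\<beta> (fst p) (snd p))) = h u"
    and h: "h \<in> hom FA (add_monoid G)"
    and hf: "\<And>p. p \<in> carrier A \<times> carrier M \<Longrightarrow> h (frag_of p) = \<beta> (fst p) (snd p)"
    using lift_exists by blast
  have "tensor_lift R A M G \<beta> (proj u) = h u" if u: "u \<in> carrier FA" for u
  proof -
    let ?S = "\<lambda>u. \<Oplus>\<^bsub>G\<^esub>p\<in>Poly_Mapping.keys u. add_pow G (Poly_Mapping.lookup u p) (\<beta> (fst p) (snd p))"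
    have eq: "?S v = h u" if v: "v \<in> proj u" for v
    proof -
      obtain n where n: "n \<in> Rels" "v = n + u" using v by (auto simp: proj_def r_coset_def)
      have nF: "n \<in> carrier FA" using n(1) subgroup.subset[OF rels_subgroup] by blast
      have "h v = h n \<oplus>\<^bsub>G\<^esub> h u"
        using h nF u n(2) unfolding hom_def by (simp del: carrier_free_Abelian_group_iff)
      also have "\<dots> = h u"
        using lift_kills_rels[OF h hf n(1)] hom_in_carrier[OF h u] by simp
      finally show ?thesis using fin[of v] frag_add_in_free[OF nF u] n(2) by simp
    qed
    have "u \<in> proj u"
      unfolding proj_def by (rule group.rcos_self[OF group_free_Abelian_group u rels_subgroup])
    then have "?S ` proj u = {h u}" using eq by force
    then show ?thesis using proj_closed[OF u] by (simp add: tensor_lift_def)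
  qed
  then show ?thesis using h hf by blast
qed

lemma tensor_lift_hom: "tensor_lift R A M G \<beta> \<in> ab_hom T G"
proof -
  obtain h where h: "h \<in> hom FA (add_monoid G)"
    and L: "\<And>u. u \<in> carrier FA \<Longrightarrow> tensor_lift R A M G \<beta> (proj u) = h u"
    using lift_proj by blast
  show ?thesis
  proof (rule ab_homI)
    fix x assume "x \<in> carrier T"
    then show "tensor_lift R A M G \<beta> x \<in> carrier G"
      using h L unfolding carrier_T hom_def by auto
  next
    fix x y assume "x \<in> carrier T" "y \<in> carrier T"
    then obtain u v where "u \<in> carrier FA" "v \<in> carrier FA" "x = proj u" "y = proj v"
      unfolding carrier_T by blast
    then show "tensor_lift R A M G \<beta> (x \<oplus>\<^bsub>T\<^esub> y) = tensor_lift R A M G \<beta> x \<oplus>\<^bsub>G\<^esub> tensor_lift R A M G \<beta> y"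
      using h unfolding hom_def
      by (simp add: proj_add[symmetric] L frag_add_in_free del: carrier_free_Abelian_group_iff)
  qed
qed

lemma tensor_lift_elt:
  assumes "a \<in> carrier A" "m \<in> carrier M"
  shows "tensor_lift R A M G \<beta> (a \<boxtimes> m) = \<beta> a m"
proof -
  obtain h where "\<forall>p\<in>carrier A \<times> carrier M. h (frag_of p) = \<beta> (fst p) (snd p)"
    and "\<And>u. u \<in> carrier FA \<Longrightarrow> tensor_lift R A M G \<beta> (proj u) = h u"
    using lift_proj by blast
  then show ?thesis using assms by (simp add: proj_frag[symmetric])
qed

end

end

subsection \<open>Functoriality\<close>

lemma tensor_map_balanced:
  assumes A: "left_module (opp R) A" and B: "left_module (opp R) B" and M: "left_module R M"
    and f: "f \<in> linmap R A B"
  shows "balanced R A M (tensor_ab R B M) (\<lambda>a m. tensor_elt R B M (f a) m)"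
proof -
  interpret B: tensor_pair R B M by (rule tensor_pair.intro) fact+
  show ?thesis
    using f by (auto simp: balanced_def linmap_closed linmap_add linmap_smult B.elt_closed
        B.elt_add_left B.elt_add_right B.elt_smult)
qed

lemma tensor_map_hom:
  assumes A: "left_module (opp R) A" and B: "left_module (opp R) B" and M: "left_module R M"
    and f: "f \<in> linmap R A B"
  shows "tensor_map R A B M f \<in> ab_hom (tensor_ab R A M) (tensor_ab R B M)"
  unfolding tensor_map_def
  by (rule tensor_pair.tensor_lift_hom[OF _ tensor_pair.T_ab tensor_map_balanced])
    (use assms in \<open>auto intro: tensor_pair.intro\<close>)

lemma tensor_map_elt:
  assumes A: "left_module (opp R) A" and B: "left_module (opp R) B" and M: "left_module R M"
    and f: "f \<in> linmap R A B" and "a \<in> carrier A" "m \<in> carrier M"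
  shows "tensor_map R A B M f (tensor_elt R A M a m) = tensor_elt R B M (f a) m"
  unfolding tensor_map_def
  by (rule tensor_pair.tensor_lift_elt[OF _ tensor_pair.T_ab tensor_map_balanced])
    (use assms in \<open>auto intro: tensor_pair.intro\<close>)

text \<open>The composite is any \<open>h\<close> agreeing with it on the carrier, so that commuting
  squares, which hold only there, can be plugged in directly.\<close>

lemma tensor_map_comp:
  assumes A: "left_module (opp R) A" and B: "left_module (opp R) B" and D: "left_module (opp R) D"
    and M: "left_module R M"
    and f: "f \<in> linmap R A B" and g: "g \<in> linmap R B D" and h: "h \<in> linmap R A D"
    and hgf: "\<And>a. a \<in> carrier A \<Longrightarrow> h a = g (f a)"
    and t: "t \<in> carrier (tensor_ab R A M)"
  shows "tensor_map R B D M g (tensor_map R A B M f t) = tensor_map R A D M h t"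
proof -
  interpret A: tensor_pair R A M by (rule tensor_pair.intro) fact+
  show ?thesis
    by (rule A.T_hom_eq[OF ab_hom_comp[OF tensor_map_hom[OF A B M f] tensor_map_hom[OF B D M g]]
            tensor_map_hom[OF A D M h] t])
      (simp add: tensor_map_elt[OF A B M f] tensor_map_elt[OF B D M g] tensor_map_elt[OF A D M h]
        linmap_closed[OF f] hgf)
qed

lemma tensor_map_id:
  assumes A: "left_module (opp R) A" and M: "left_module R M"
    and f: "f \<in> linmap R A A" and fid: "\<And>a. a \<in> carrier A \<Longrightarrow> f a = a"
    and t: "t \<in> carrier (tensor_ab R A M)"
  shows "tensor_map R A A M f t = t"
proof -
  interpret A: tensor_pair R A M by (rule tensor_pair.intro) fact+
  have "(\<lambda>x. x) \<in> ab_hom A.T A.T" by (simp add: ab_hom_def)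
  from A.T_hom_eq[OF tensor_map_hom[OF A A M f] this t] show ?thesis
    by (simp add: tensor_map_elt[OF A A M f] fid)
qed

lemma tensor_map_zero:
  assumes A: "left_module (opp R) A" and B: "left_module (opp R) B" and M: "left_module R M"
    and f: "f \<in> linmap R A B" and z: "\<And>a. a \<in> carrier A \<Longrightarrow> f a = \<zero>\<^bsub>B\<^esub>"
    and t: "t \<in> carrier (tensor_ab R A M)"
  shows "tensor_map R A B M f t = \<zero>\<^bsub>tensor_ab R B M\<^esub>"
proof -
  interpret A: tensor_pair R A M by (rule tensor_pair.intro) fact+
  interpret B: tensor_pair R B M by (rule tensor_pair.intro) fact+
  have "(\<lambda>x. \<zero>\<^bsub>B.T\<^esub>) \<in> ab_hom A.T B.T" by (rule ab_homI) simp_all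
  from A.T_hom_eq[OF tensor_map_hom[OF A B M f] this t] show ?thesis
    by (simp add: tensor_map_elt[OF A B M f] z B.elt_zero_left)
qed

lemma tensor_map_plus:
  assumes A: "left_module (opp R) A" and B: "left_module (opp R) B" and M: "left_module R M"
    and f: "f \<in> linmap R A B" and g: "g \<in> linmap R A B" and h: "h \<in> linmap R A B"
    and hfg: "\<And>a. a \<in> carrier A \<Longrightarrow> h a = f a \<oplus>\<^bsub>B\<^esub> g a"
    and t: "t \<in> carrier (tensor_ab R A M)"
  shows "tensor_map R A B M h t = tensor_map R A B M f t \<oplus>\<^bsub>tensor_ab R B M\<^esub> tensor_map R A B M g t"
proof -
  interpret A: tensor_pair R A M by (rule tensor_pair.intro) fact+
  interpret B: tensor_pair R B M by (rule tensor_pair.intro) fact+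
  note F = tensor_map_hom[OF A B M f] and G = tensor_map_hom[OF A B M g]
  have "(\<lambda>x. tensor_map R A B M f x \<oplus>\<^bsub>B.T\<^esub> tensor_map R A B M g x) \<in> ab_hom A.T B.T"
    by (rule ab_homI)
      (simp_all add: ab_hom_closed[OF F] ab_hom_closed[OF G] ab_hom_add[OF F] ab_hom_add[OF G]
        B.T.add_add_swap)
  from A.T_hom_eq[OF tensor_map_hom[OF A B M h] this t] show ?thesis
    by (simp add: tensor_map_elt[OF A B M f] tensor_map_elt[OF A B M g] tensor_map_elt[OF A B M h]
        hfg linmap_closed[OF f] linmap_closed[OF g] B.elt_add_left)
qed

text \<open>The inverse of \<open>(B \<otimes> M) / im (f \<otimes> M) \<rightarrow> D \<otimes> M\<close> is induced by
  \<open>(g b, m) \<mapsto> [b \<otimes> m]\<close>.\<close>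

lemma tensor_right_exact:
  assumes A: "left_module (opp R) A" and B: "left_module (opp R) B" and D: "left_module (opp R) D"
    and M: "left_module R M"
    and f: "f \<in> linmap R A B" and g: "g \<in> linmap R B D"
    and surj: "g ` carrier B = carrier D" and ex: "mod_ker B D g \<subseteq> f ` carrier A"
    and t: "t \<in> carrier (tensor_ab R B M)"
    and gt: "tensor_map R B D M g t = \<zero>\<^bsub>tensor_ab R D M\<^esub>"
  shows "t \<in> tensor_map R A B M f ` carrier (tensor_ab R A M)"
proof -
  interpret A: tensor_pair R A M by (rule tensor_pair.intro) fact+
  interpret B: tensor_pair R B M by (rule tensor_pair.intro) fact+
  interpret D: tensor_pair R D M by (rule tensor_pair.intro) fact+
  note F = tensor_map_hom[OF A B M f] and G = tensor_map_hom[OF B D M g]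
  let ?I = "tensor_map R A B M f ` carrier A.T"
  have I: "subgroup ?I (add_monoid B.T)"
    by (rule ab_hom_image_subgroup[OF A.T_ab B.T_ab F])
  let ?Q = "quot_ab B.T ?I"
  define q where "q x = ?I #>\<^bsub>add_monoid B.T\<^esub> x" for x
  note Q = quot_ab[OF B.T_ab I, folded q_def]
  interpret Q: abelian_group ?Q by (rule Q(1))
  define \<sigma> where "\<sigma> d = (SOME b. b \<in> carrier B \<and> g b = d)" for d
  have \<sigma>: "\<sigma> d \<in> carrier B \<and> g (\<sigma> d) = d" if "d \<in> carrier D" for d
  proof -
    have "\<exists>b. b \<in> carrier B \<and> g b = d" using that unfolding surj[symmetric] by auto
    then show ?thesis unfolding \<sigma>_def by (rule someI_ex)
  qed
  define \<beta> where "\<beta> d m = q (tensor_elt R B M (\<sigma> d) m)" for d m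
  \<comment> \<open>The choice of preimage is immaterial: \<open>\<sigma> (g b)\<close> and
    \<open>b\<close> differ by some \<open>f a\<close>, and \<open>f a \<otimes> m\<close> vanishes
    in the quotient by the image.\<close>
  have \<beta>: "\<beta> (g b) m = q (tensor_elt R B M b m)" if b: "b \<in> carrier B" and m: "m \<in> carrier M" for b m
  proof -
    have gb: "g b \<in> carrier D" using linmap_closed[OF g b] .
    have "\<sigma> (g b) \<ominus>\<^bsub>B\<^esub> b \<in> mod_ker B D g"
      using linmap_eq_iff_ker[OF B D, simplified, OF g, of "\<sigma> (g b)" b] \<sigma>[OF gb] b by simp
    then obtain a where a: "a \<in> carrier A" "\<sigma> (g b) \<ominus>\<^bsub>B\<^esub> b = f a" using ex by blast
    have "tensor_elt R B M (\<sigma> (g b)) m = tensor_elt R B M (f a \<oplus>\<^bsub>B\<^esub> b) m"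
      using B.A.minus_add_cancel[of "\<sigma> (g b)" b] \<sigma>[OF gb] b a by simp
    also have "\<dots> = tensor_elt R B M (f a) m \<oplus>\<^bsub>B.T\<^esub> tensor_elt R B M b m"
      using b a m by (simp add: B.elt_add_left linmap_closed[OF f])
    finally have eq: "tensor_elt R B M (\<sigma> (g b)) m = \<dots>" .
    have "tensor_elt R B M (f a) m \<in> ?I"
      using a m tensor_map_elt[OF A B M f] A.elt_closed by (metis image_eqI)
    then have "q (tensor_elt R B M (f a) m) = \<zero>\<^bsub>?Q\<^esub>"
      using Q(3) a m by (simp add: B.elt_closed linmap_closed[OF f])
    moreover have "q (tensor_elt R B M (f a) m \<oplus>\<^bsub>B.T\<^esub> tensor_elt R B M b m) =
        q (tensor_elt R B M (f a) m) \<oplus>\<^bsub>?Q\<^esub> q (tensor_elt R B M b m)"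
      using a b m by (intro ab_hom_add[OF Q(2)] B.elt_closed linmap_closed[OF f])
    moreover have "q (tensor_elt R B M b m) \<in> carrier ?Q"
      using b m by (intro ab_hom_closed[OF Q(2)] B.elt_closed)
    ultimately show ?thesis unfolding \<beta>_def eq by simp
  qed
  have "balanced R D M ?Q \<beta>"
    unfolding balanced_def
  proof (intro conjI ballI)
    fix d m assume "d \<in> carrier D" "m \<in> carrier M"
    then show "\<beta> d m \<in> carrier ?Q"
      using \<sigma> ab_hom_closed[OF Q(2)] by (simp add: \<beta>_def B.elt_closed)
  next
    fix d d' m assume d: "d \<in> carrier D" "d' \<in> carrier D" and m: "m \<in> carrier M"
    obtain b b' where b: "b \<in> carrier B" "b' \<in> carrier B" "d = g b" "d' = g b'"
      using surj d by blast
    have "d \<oplus>\<^bsub>D\<^esub> d' = g (b \<oplus>\<^bsub>B\<^esub> b')" using b by (simp add: linmap_add[OF g])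
    then show "\<beta> (d \<oplus>\<^bsub>D\<^esub> d') m = \<beta> d m \<oplus>\<^bsub>?Q\<^esub> \<beta> d' m"
      using b m by (simp add: \<beta> B.elt_add_left ab_hom_add[OF Q(2)] B.elt_closed)
  next
    fix d m m' assume "d \<in> carrier D" "m \<in> carrier M" "m' \<in> carrier M"
    then show "\<beta> d (m \<oplus>\<^bsub>M\<^esub> m') = \<beta> d m \<oplus>\<^bsub>?Q\<^esub> \<beta> d m'"
      using \<sigma> by (simp add: \<beta>_def B.elt_add_right ab_hom_add[OF Q(2)] B.elt_closed)
  next
    fix r d m assume r: "r \<in> carrier R" and d: "d \<in> carrier D" and m: "m \<in> carrier M"
    obtain b where b: "b \<in> carrier B" "d = g b" using surj d by blast
    then show "\<beta> (r \<odot>\<^bsub>D\<^esub> d) m = \<beta> d (r \<odot>\<^bsub>M\<^esub> m)"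
      using r m left_module.smult_closed[OF B] left_module.smult_closed[OF M]
      by (simp add: \<beta> B.elt_smult flip: linmap_smult[OF g])
  qed
  note L = D.tensor_lift_hom[OF Q(1) this] and Le = D.tensor_lift_elt[OF Q(1) this]
  have "tensor_lift R D M ?Q \<beta> (tensor_map R B D M g t) = q t"
    by (rule B.T_hom_eq[OF ab_hom_comp[OF G L] Q(2) t])
      (simp add: tensor_map_elt[OF B D M g] Le linmap_closed[OF g] \<beta>)
  then have "q t = \<zero>\<^bsub>?Q\<^esub>"
    using ab_hom_zero[OF D.T_ab Q(1) L] gt by simp
  then show ?thesis using Q(3)[OF t] by simp
qed

section \<open>Free and projective modules\<close>

lemma free_simps [simp]:
  "\<zero>\<^bsub>free_module R X\<^esub> = (\<lambda>_. \<zero>\<^bsub>R\<^esub>)"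
  "f \<oplus>\<^bsub>free_module R X\<^esub> g = (\<lambda>x. f x \<oplus>\<^bsub>R\<^esub> g x)"
  "a \<odot>\<^bsub>free_module R X\<^esub> f = (\<lambda>x. a \<otimes>\<^bsub>R\<^esub> f x)"
  by (simp_all add: free_module_def)

lemma free_carrier_iff:
  "f \<in> carrier (free_module R X) \<longleftrightarrow>
     (\<forall>x. f x \<in> carrier R) \<and> (\<forall>x. x \<notin> X \<longrightarrow> f x = \<zero>\<^bsub>R\<^esub>) \<and> finite {x. f x \<noteq> \<zero>\<^bsub>R\<^esub>}"
  by (auto simp: free_module_def)

text \<open>Free modules on subsets of one type differ only in their carrier, so each is a submodule
  of the one on \<open>UNIV\<close>. This is what connects \<open>res_bd\<close>, whose values are
  formed in the module on \<open>UNIV\<close>, with the terms of the standard resolution.\<close>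

lemma free_sub:
  "free_module R X = (free_module R UNIV)\<lparr>carrier := carrier (free_module R X)\<rparr>"
  by (simp add: free_module_def)

lemma free_mono: "X \<subseteq> Y \<Longrightarrow> carrier (free_module R X) \<subseteq> carrier (free_module R Y)"
  by (auto simp: free_carrier_iff) blast

lemma free_left_module:
  assumes "ring R"
  shows "left_module R (free_module R X)"
proof -
  interpret R: ring R by fact
  have fin: "finite {x. f x \<oplus>\<^bsub>R\<^esub> g x \<noteq> \<zero>\<^bsub>R\<^esub>}"
    if "finite {x. f x \<noteq> \<zero>\<^bsub>R\<^esub>}" "finite {x. g x \<noteq> \<zero>\<^bsub>R\<^esub>}" for f g :: "'c \<Rightarrow> 'a"
    by (rule finite_subset[OF _ finite_UnI[OF that]]) auto
  have fin': "finite {x. a \<otimes>\<^bsub>R\<^esub> f x \<noteq> \<zero>\<^bsub>R\<^esub>}"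
    if "finite {x. f x \<noteq> \<zero>\<^bsub>R\<^esub>}" "a \<in> carrier R" "\<forall>x. f x \<in> carrier R" for a and f :: "'c \<Rightarrow> 'a"
    by (rule finite_subset[OF _ that(1)]) (use that in auto)
  have fin'': "finite {x. \<ominus>\<^bsub>R\<^esub> f x \<noteq> \<zero>\<^bsub>R\<^esub>}"
    if "finite {x. f x \<noteq> \<zero>\<^bsub>R\<^esub>}" "\<forall>x. f x \<in> carrier R" for f :: "'c \<Rightarrow> 'a"
    by (rule finite_subset[OF _ that(1)]) auto
  show ?thesis
  proof (intro left_moduleI abelian_groupI)
    fix f assume "f \<in> carrier (free_module R X)"
    then show "\<exists>g\<in>carrier (free_module R X). g \<oplus>\<^bsub>free_module R X\<^esub> f = \<zero>\<^bsub>free_module R X\<^esub>"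
      by (intro bexI[of _ "\<lambda>x. \<ominus>\<^bsub>R\<^esub> f x"]) (auto simp: free_carrier_iff fin'' R.l_neg)
  qed (use assms in \<open>auto simp: free_carrier_iff fin fin' R.a_ac R.l_distr R.r_distr R.m_assoc\<close>)
qed

lemma basis_in_free:
  assumes "ring R" "x \<in> X"
  shows "basis_vec R x \<in> carrier (free_module R X)"
proof -
  interpret R: ring R by fact
  have "finite {y. basis_vec R x y \<noteq> \<zero>\<^bsub>R\<^esub>}"
    by (rule finite_subset[of _ "{x}"]) (auto simp: basis_vec_def)
  then show ?thesis using assms(2) by (auto simp: free_carrier_iff basis_vec_def)
qed

lemma free_induct [consumes 2, case_names zero basis add]:
  assumes R: "ring R" and v: "v \<in> carrier (free_module R X)"
    and zero: "P \<zero>\<^bsub>free_module R X\<^esub>"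
    and basis: "\<And>a x. \<lbrakk>a \<in> carrier R; x \<in> X\<rbrakk> \<Longrightarrow> P (a \<odot>\<^bsub>free_module R X\<^esub> basis_vec R x)"
    and add: "\<And>u v. \<lbrakk>u \<in> carrier (free_module R X); v \<in> carrier (free_module R X); P u; P v\<rbrakk>
                \<Longrightarrow> P (u \<oplus>\<^bsub>free_module R X\<^esub> v)"
  shows "P v"
proof -
  interpret R: ring R by fact
  have "P v" if "finite I" "{x. v x \<noteq> \<zero>\<^bsub>R\<^esub>} \<subseteq> I" "v \<in> carrier (free_module R X)" for I v
    using that
  proof (induction I arbitrary: v rule: finite_induct)
    case empty
    then have "v = \<zero>\<^bsub>free_module R X\<^esub>" by auto
    then show ?case using zero by simp
  next
    case (insert x I)
    show ?case
    proof (cases "v x = \<zero>\<^bsub>R\<^esub>")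
      case True
      then show ?thesis using insert by auto
    next
      case False
      let ?w = "v(x := \<zero>\<^bsub>R\<^esub>)" and ?b = "v x \<odot>\<^bsub>free_module R X\<^esub> basis_vec R x"
      have x: "x \<in> X" and vx: "\<And>y. v y \<in> carrier R" and fin: "finite {x. v x \<noteq> \<zero>\<^bsub>R\<^esub>}"
        using False insert.prems(2) by (auto simp: free_carrier_iff)
      have w: "?w \<in> carrier (free_module R X)"
        using insert.prems(2) finite_subset[OF _ fin, of "{y. y \<noteq> x \<and> v y \<noteq> \<zero>\<^bsub>R\<^esub>}"]
        by (auto simp: free_carrier_iff elim!: rev_finite_subset)
      have "P ?w" using insert.prems by (intro insert.IH w) auto
      moreover have "?b \<in> carrier (free_module R X)"
        by (rule left_module.smult_closed[OF free_left_module[OF R] vx basis_in_free[OF R x]])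
      moreover have "v = ?b \<oplus>\<^bsub>free_module R X\<^esub> ?w"
        using vx by (auto simp: basis_vec_def)
      ultimately show ?thesis using add[of ?b ?w] basis[OF vx x] w by metis
    qed
  qed
  then show ?thesis using v by (auto simp: free_carrier_iff)
qed

lemma free_ext:
  assumes R: "ring R" and v: "v \<in> carrier (free_module R X)"
    and M: "left_module R M"
    and f: "f \<in> linmap R (free_module R X) M" and g: "g \<in> linmap R (free_module R X) M"
    and eq: "\<And>x. x \<in> X \<Longrightarrow> f (basis_vec R x) = g (basis_vec R x)"
  shows "f v = g v"
  using R v
proof (induction v rule: free_induct)
  case zero
  then show ?case using linmap_zero[OF free_left_module[OF R] M] f g by metis
next
  case (basis a x)
  then show ?case using linmap_smult[OF f] linmap_smult[OF g] basis_in_free[OF R] eq by metis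
next
  case (add u v)
  then show ?case using linmap_add[OF f] linmap_add[OF g] by metis
qed

text \<open>\<open>free_lift\<close> sums over the support of its argument, which changes from
  vector to vector; a common larger index set makes different vectors comparable.\<close>

lemma free_lift_eq:
  assumes M: "left_module R M" and g: "\<And>x. x \<in> X \<Longrightarrow> g x \<in> carrier M"
    and f: "f \<in> carrier (free_module R X)"
    and I: "finite I" "{x. f x \<noteq> \<zero>\<^bsub>R\<^esub>} \<subseteq> I" "I \<subseteq> X"
  shows "free_lift R M g f = (\<Oplus>\<^bsub>M\<^esub>x\<in>I. f x \<odot>\<^bsub>M\<^esub> g x)"
proof -
  interpret M: abelian_group M using M by (rule module_abelian)
  show ?thesis
    unfolding free_lift_def
  proof (rule M.add.finprod_mono_neutral_cong_left)
    show "f i \<odot>\<^bsub>M\<^esub> g i = \<zero>\<^bsub>M\<^esub>" if "i \<in> I - {x. f x \<noteq> \<zero>\<^bsub>R\<^esub>}" for i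
      using that I g smult_zero_left[OF M] by auto
    show "(\<lambda>x. f x \<odot>\<^bsub>M\<^esub> g x) \<in> I \<rightarrow> carrier M"
      using I f g left_module.smult_closed[OF M] by (auto simp: free_carrier_iff)
  qed (use I in auto)
qed

lemma free_lift_linmap:
  assumes M: "left_module R M" and g: "\<And>x. x \<in> X \<Longrightarrow> g x \<in> carrier M"
  shows "free_lift R M g \<in> linmap R (free_module R X) M"
proof -
  interpret M: abelian_group M using M by (rule module_abelian)
  interpret R: ring R using M by (rule module_ring)
  let ?F = "free_module R X"
  note F = free_left_module[OF R.ring_axioms, of X]
  interpret F: abelian_group ?F using F by (rule module_abelian)
  have cl: "\<And>f x. f \<in> carrier ?F \<Longrightarrow> x \<in> X \<Longrightarrow> f x \<odot>\<^bsub>M\<^esub> g x \<in> carrier M"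
    using g left_module.smult_closed[OF M] by (auto simp: free_carrier_iff)
  have fin: "finite {x. f x \<noteq> \<zero>\<^bsub>R\<^esub>}" "{x. f x \<noteq> \<zero>\<^bsub>R\<^esub>} \<subseteq> X" if "f \<in> carrier ?F" for f
    using that by (auto simp: free_carrier_iff)
  have fc: "\<And>f x. f \<in> carrier ?F \<Longrightarrow> f x \<in> carrier R"
    by (auto simp: free_carrier_iff)
  show ?thesis
  proof (rule linmapI)
    fix f assume f: "f \<in> carrier ?F"
    show "free_lift R M g f \<in> carrier M"
      unfolding free_lift_def using fin[OF f] cl[OF f] by (intro M.finsum_closed) auto
  next
    fix f h assume f: "f \<in> carrier ?F" and h: "h \<in> carrier ?F"
    let ?I = "{x. f x \<noteq> \<zero>\<^bsub>R\<^esub>} \<union> {x. h x \<noteq> \<zero>\<^bsub>R\<^esub>}"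
    have I: "finite ?I" "?I \<subseteq> X" using fin f h by auto
    have "free_lift R M g (f \<oplus>\<^bsub>?F\<^esub> h) = (\<Oplus>\<^bsub>M\<^esub>x\<in>?I. (f \<oplus>\<^bsub>?F\<^esub> h) x \<odot>\<^bsub>M\<^esub> g x)"
      by (rule free_lift_eq[OF M g F.a_closed[OF f h] I(1) _ I(2)]) auto
    also have "\<dots> = (\<Oplus>\<^bsub>M\<^esub>x\<in>?I. f x \<odot>\<^bsub>M\<^esub> g x \<oplus>\<^bsub>M\<^esub> h x \<odot>\<^bsub>M\<^esub> g x)"
      using I cl[OF f] cl[OF h] f h g
      by (intro M.finsum_cong') (auto simp: left_module.smult_l_distr[OF M] fc subset_iff)
    also have "\<dots> = (\<Oplus>\<^bsub>M\<^esub>x\<in>?I. f x \<odot>\<^bsub>M\<^esub> g x) \<oplus>\<^bsub>M\<^esub> (\<Oplus>\<^bsub>M\<^esub>x\<in>?I. h x \<odot>\<^bsub>M\<^esub> g x)"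
      using I cl[OF f] cl[OF h] by (intro M.finsum_addf) (auto simp: subset_iff)
    also have "\<dots> = free_lift R M g f \<oplus>\<^bsub>M\<^esub> free_lift R M g h"
      using free_lift_eq[OF M g f I(1) _ I(2)] free_lift_eq[OF M g h I(1) _ I(2)] by simp
    finally show "free_lift R M g (f \<oplus>\<^bsub>?F\<^esub> h) = free_lift R M g f \<oplus>\<^bsub>M\<^esub> free_lift R M g h" .
  next
    fix a f assume a: "a \<in> carrier R" and f: "f \<in> carrier ?F"
    let ?I = "{x. f x \<noteq> \<zero>\<^bsub>R\<^esub>}"
    have I: "finite ?I" "?I \<subseteq> X" using fin f by auto
    have "free_lift R M g (a \<odot>\<^bsub>?F\<^esub> f) = (\<Oplus>\<^bsub>M\<^esub>x\<in>?I. (a \<odot>\<^bsub>?F\<^esub> f) x \<odot>\<^bsub>M\<^esub> g x)"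
      by (rule free_lift_eq[OF M g left_module.smult_closed[OF F a f] I(1) _ I(2)]) (use a in auto)
    also have "\<dots> = (\<Oplus>\<^bsub>M\<^esub>x\<in>?I. a \<odot>\<^bsub>M\<^esub> (f x \<odot>\<^bsub>M\<^esub> g x))"
      using I cl[OF f] f g a
      by (intro M.finsum_cong')
        (auto simp: left_module.smult_assoc1[OF M] left_module.smult_closed[OF M] fc subset_iff)
    also have "\<dots> = a \<odot>\<^bsub>M\<^esub> (\<Oplus>\<^bsub>M\<^esub>x\<in>?I. f x \<odot>\<^bsub>M\<^esub> g x)"
      using I cl[OF f]
      by (intro ab_hom_finsum[OF module_abelian[OF M] module_abelian[OF M] smult_ab_hom[OF M a], symmetric]) auto
    finally show "free_lift R M g (a \<odot>\<^bsub>?F\<^esub> f) = a \<odot>\<^bsub>M\<^esub> free_lift R M g f"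
      by (simp add: free_lift_def)
  qed
qed

lemma free_lift_basis:
  assumes M: "left_module R M" and g: "\<And>x. x \<in> X \<Longrightarrow> g x \<in> carrier M" and x: "x \<in> X"
  shows "free_lift R M g (basis_vec R x) = g x"
proof -
  interpret M: abelian_group M using M by (rule module_abelian)
  have "free_lift R M g (basis_vec R x) = (\<Oplus>\<^bsub>M\<^esub>y\<in>{x}. basis_vec R x y \<odot>\<^bsub>M\<^esub> g y)"
    by (rule free_lift_eq[OF M g basis_in_free[OF module_ring[OF M] x]])
      (use x in \<open>auto simp: basis_vec_def\<close>)
  then show ?thesis
    using g[OF x] by (simp add: basis_vec_def left_module.smult_one[OF M])
qed

section \<open>Projective modules\<close>

lemma projective_left_module: "projective R P \<Longrightarrow> left_module R P"
  by (simp add: projective_def)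

text \<open>The images of the basis vectors of a free module containing \<open>P\<close> as a
  summand are lifted by choice, and the result is precomposed with \<open>i\<close>. The hypothesis
  speaks of the image of \<open>q\<close> because the typical \<open>q\<close> is a differential,
  which is onto a kernel and not onto its target.\<close>

lemma projective_lift:
  fixes P :: "('r, 'p, 'z) module_scheme"
  assumes P: "projective R P" and A: "left_module R A" and B: "left_module R B"
    and f: "f \<in> linmap R P B" and q: "q \<in> linmap R A B" and fq: "f ` carrier P \<subseteq> q ` carrier A"
  shows "\<exists>h\<in>linmap R P A. \<forall>x\<in>carrier P. q (h x) = f x"
proof -
  obtain X :: "'p set" and i p where i: "i \<in> linmap R P (free_module R X)"
    and p: "p \<in> linmap R (free_module R X) P" and pi: "\<And>x. x \<in> carrier P \<Longrightarrow> p (i x) = x"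
    using P by (auto simp: projective_def mod_hom_iff)
  have R: "ring R" using A by (rule module_ring)
  define g where "g x = (SOME a. a \<in> carrier A \<and> q a = f (p (basis_vec R x)))" for x
  have g: "g x \<in> carrier A \<and> q (g x) = f (p (basis_vec R x))" if "x \<in> X" for x
  proof -
    have "f (p (basis_vec R x)) \<in> q ` carrier A"
      using fq linmap_closed[OF p basis_in_free[OF R that]] by blast
    then have "\<exists>a. a \<in> carrier A \<and> q a = f (p (basis_vec R x))" by auto
    then show ?thesis unfolding g_def by (rule someI_ex)
  qed
  let ?k = "free_lift R A g"
  have k: "?k \<in> linmap R (free_module R X) A" using g by (intro free_lift_linmap[OF A]) blast
  have "q (?k v) = f (p v)" if "v \<in> carrier (free_module R X)" for v
    by (rule free_ext[OF R that B linmap_comp[OF k q] linmap_comp[OF p f]])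
      (use g free_lift_basis[OF A, of X g] in simp)
  then have "\<forall>x\<in>carrier P. q (?k (i x)) = f x" using pi linmap_closed[OF i] by simp
  then show ?thesis using linmap_comp[OF i k] by (intro bexI[of _ "\<lambda>x. ?k (i x)"])
qed

text \<open>\<open>projective\<close> asks for a basis inside the element type of the module itself.
  So the free module on \<open>X\<close> is split off the free module on its own carrier, sending
  the basis vector of x to the basis vector indexed by that basis vector.\<close>

lemma free_projective:
  fixes X :: "'a set"
  assumes R: "ring R"
  shows "projective R (free_module R X)"
proof -
  let ?P = "free_module R X"
  let ?F = "free_module R (carrier ?P)"
  note P = free_left_module[OF R, of X] and F = free_left_module[OF R, of "carrier ?P"]
  let ?i = "free_lift R ?F (\<lambda>x. basis_vec R (basis_vec R x))" and ?p = "free_lift R ?P (\<lambda>x. x)"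
  have ib: "basis_vec R (basis_vec R x) \<in> carrier ?F" if "x \<in> X" for x
    by (intro basis_in_free R that)
  have i: "?i \<in> linmap R ?P ?F" by (rule free_lift_linmap[OF F ib])
  have p: "?p \<in> linmap R ?F ?P" by (rule free_lift_linmap[OF P])
  have pi: "?p (?i v) = v" if "v \<in> carrier ?P" for v
  proof (rule free_ext[OF R that P linmap_comp[OF i p] linmap_id])
    fix x assume x: "x \<in> X"
    have "?i (basis_vec R x) = basis_vec R (basis_vec R x)" by (rule free_lift_basis[OF F ib x])
    moreover have "?p (basis_vec R (basis_vec R x)) = basis_vec R x"
      by (rule free_lift_basis[OF P _ basis_in_free[OF R x]])
    ultimately show "?p (?i (basis_vec R x)) = basis_vec R x" by simp
  qed
  show ?thesis
    unfolding projective_def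
    using P linmap_restrict[OF P i] linmap_restrict[OF F p] pi linmap_closed[OF i]
    by (intro conjI exI[of _ "carrier ?P"] bexI[of _ "restrict ?i (carrier ?P)"]
        bexI[of _ "restrict ?p (carrier ?F)"]) auto
qed

section \<open>The standard resolution is a projective resolution\<close>

lemma lincomb_Nil: "lincomb R [] = \<zero>\<^bsub>free_module R UNIV\<^esub>"
  by (simp add: lincomb_def)

lemma lincomb_Cons: "lincomb R ((a, x) # l) =
   a \<odot>\<^bsub>free_module R UNIV\<^esub> basis_vec R x \<oplus>\<^bsub>free_module R UNIV\<^esub> lincomb R l"
  by (simp add: lincomb_def)

lemma lincomb_closed:
  assumes R: "ring R"
  shows "set l \<subseteq> carrier R \<times> X \<Longrightarrow> lincomb R l \<in> carrier (free_module R X)"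
proof (induction l)
  case Nil
  interpret F: abelian_group "free_module R X" using free_left_module[OF R] by (rule module_abelian)
  show ?case using F.zero_closed by (simp add: lincomb_Nil)
next
  case (Cons p l)
  obtain a x where p: "p = (a, x)" by fastforce
  interpret F: abelian_group "free_module R X" using free_left_module[OF R] by (rule module_abelian)
  have "a \<odot>\<^bsub>free_module R X\<^esub> basis_vec R x \<in> carrier (free_module R X)"
    using Cons.prems p
    by (intro left_module.smult_closed[OF free_left_module[OF R]] basis_in_free[OF R]) auto
  then show ?case using F.a_closed[OF _ Cons.IH] Cons.prems unfolding p lincomb_Cons by simp
qed

lemma lincomb_append:
  assumes R: "ring R"
  shows "\<lbrakk>set l \<subseteq> carrier R \<times> UNIV; set l' \<subseteq> carrier R \<times> UNIV\<rbrakk> \<Longrightarrow>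
    lincomb R (l @ l') = lincomb R l \<oplus>\<^bsub>free_module R UNIV\<^esub> lincomb R l'"
proof (induction l)
  case Nil
  interpret F: abelian_group "free_module R UNIV" using free_left_module[OF R] by (rule module_abelian)
  show ?case
    using F.l_zero[OF lincomb_closed[OF R Nil(2)]] by (simp only: lincomb_Nil append_Nil)
next
  case (Cons p l)
  obtain a x where p: "p = (a, x)" by fastforce
  interpret F: abelian_group "free_module R UNIV" using free_left_module[OF R] by (rule module_abelian)
  have "a \<odot>\<^bsub>free_module R UNIV\<^esub> basis_vec R x \<in> carrier (free_module R UNIV)"
    "lincomb R l \<in> carrier (free_module R UNIV)" "lincomb R l' \<in> carrier (free_module R UNIV)"
    using Cons.prems p
    by (intro lincomb_closed[OF R] left_module.smult_closed[OF free_left_module[OF R]]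
        basis_in_free[OF R]; auto)+
  note F.a_assoc[OF this]
  moreover have "lincomb R (l @ l') = lincomb R l \<oplus>\<^bsub>free_module R UNIV\<^esub> lincomb R l'"
    using Cons.prems by (intro Cons.IH) auto
  ultimately show ?case unfolding p append_Cons lincomb_Cons by simp
qed

text \<open>Every element of a free module is named by some list, hence every cycle is hit by a
  generator \<open>Cyc l\<close>: this is where exactness of the standard resolution comes
  from.\<close>

lemma lincomb_surj:
  assumes R: "ring R" and v: "v \<in> carrier (free_module R X)"
  shows "\<exists>l. set l \<subseteq> carrier R \<times> X \<and> lincomb R l = v"
  using R v
proof (induction v rule: free_induct)
  case zero
  show ?case by (intro exI[of _ "[]"]) (simp add: lincomb_Nil)
next
  case (basis a x)
  interpret F: abelian_group "free_module R X" using free_left_module[OF R] by (rule module_abelian)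
  have "a \<odot>\<^bsub>free_module R X\<^esub> basis_vec R x \<in> carrier (free_module R X)"
    using basis
    by (intro left_module.smult_closed[OF free_left_module[OF R]] basis_in_free[OF R]) auto
  from F.r_zero[OF this] show ?case
    using basis by (intro exI[of _ "[(a, x)]"]) (simp add: lincomb_Nil lincomb_Cons)
next
  case (add u v)
  then obtain l l' where l: "set l \<subseteq> carrier R \<times> X" "lincomb R l = u"
    "set l' \<subseteq> carrier R \<times> X" "lincomb R l' = v" by blast
  then have "lincomb R (l @ l') = u \<oplus>\<^bsub>free_module R X\<^esub> v"
    using lincomb_append[OF R, of l l'] by auto
  then show ?case using l by (intro exI[of _ "l @ l'"]) auto
qed

lemma res_mod_left_module: "ring R \<Longrightarrow> left_module R (res_mod R M n)"
  unfolding res_mod_def by (rule free_left_module)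

text \<open>One name for the kernel of the augmentation (degree 0) and of the boundary (higher
  degrees), so that the passage from degree n to n + 1 is uniform.\<close>

definition res_cycles ::
  "('r, 'x) ring_scheme \<Rightarrow> ('r, 'm, 'y) module_scheme \<Rightarrow> nat \<Rightarrow> (('r, 'm) gen \<Rightarrow> 'r) set" where
  "res_cycles R M n = (case n of 0 \<Rightarrow> mod_ker (res_mod R M 0) M (res_aug R M)
     | Suc k \<Rightarrow> mod_ker (res_mod R M (Suc k)) (res_mod R M k) (res_bd R))"

lemma res_aug_linmap:
  assumes M: "left_module R M"
  shows "res_aug R M \<in> linmap R (res_mod R M 0) M"
  unfolding res_aug_def res_mod_def by (rule free_lift_linmap[OF M]) auto

lemma res_aug_surj:
  assumes M: "left_module R M"
  shows "res_aug R M ` carrier (res_mod R M 0) = carrier M"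
proof
  show "res_aug R M ` carrier (res_mod R M 0) \<subseteq> carrier M"
    using linmap_closed[OF res_aug_linmap[OF M]] by blast
  show "carrier M \<subseteq> res_aug R M ` carrier (res_mod R M 0)"
  proof
    fix m assume m: "m \<in> carrier M"
    have "res_aug R M (basis_vec R (Elt m)) = m"
      unfolding res_aug_def
      by (subst free_lift_basis[OF M, where X = "Elt ` carrier M"]) (use m in auto)
    moreover have "basis_vec R (Elt m) \<in> carrier (res_mod R M 0)"
      unfolding res_mod_def by (rule basis_in_free[OF module_ring[OF M]]) (use m in auto)
    ultimately show "m \<in> res_aug R M ` carrier (res_mod R M 0)" by force
  qed
qed

lemma res_gens_Suc:
  assumes R: "ring R"
  shows "res_gens R M (Suc n) =
    {Cyc l | l. set l \<subseteq> carrier R \<times> res_gens R M n \<and> lincomb R l \<in> res_cycles R M n}"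
proof -
  have "lincomb R l \<in> res_cycles R M n \<longleftrightarrow> (if n = 0 then res_aug R M (lincomb R l) = \<zero>\<^bsub>M\<^esub>
      else res_bd R (lincomb R l) = \<zero>\<^bsub>free_module R UNIV\<^esub>)"
    if "set l \<subseteq> carrier R \<times> res_gens R M n" for l
    using lincomb_closed[OF R that]
    by (cases n) (simp_all add: res_cycles_def mod_ker_def res_mod_def del: res_gens.simps)
  then show ?thesis unfolding res_gens.simps by blast
qed

text \<open>In positive degrees the cycles are known to be a submodule only once the boundary out of
  that degree is known to be linear. Therefore the submodule property is assumed here for one degree
  and established for all by the induction in \<open>res_cycles_submod\<close>.\<close>

lemma res_bd_step:
  assumes M: "left_module R M" and Z: "submod R (res_mod R M n) (res_cycles R M n)"
  shows "res_bd R \<in> linmap R (res_mod R M (Suc n)) (res_mod R M n)"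
    and "res_bd R ` carrier (res_mod R M (Suc n)) = res_cycles R M n"
proof -
  have R: "ring R" using M by (rule module_ring)
  let ?U = "free_module R (UNIV :: ('a, 'c) gen set)"
  let ?g = "\<lambda>g::('a, 'c) gen. case g of Elt m \<Rightarrow> \<zero>\<^bsub>?U\<^esub> | Cyc l \<Rightarrow> lincomb R l"
  have U: "left_module R ?U" by (rule free_left_module[OF R])
  have g: "?g x \<in> carrier ?U" if "x \<in> res_gens R M (Suc n)" for x
    using that lincomb_closed[OF R, of _ UNIV] unfolding res_gens_Suc[OF R] by fastforce
  have bdU: "res_bd R \<in> linmap R (res_mod R M (Suc n)) ?U"
    unfolding res_bd_def res_mod_def using g by (rule free_lift_linmap[OF U])
  have bdb: "res_bd R (basis_vec R (Cyc l)) = lincomb R l" if "Cyc l \<in> res_gens R M (Suc n)" for l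
    unfolding res_bd_def by (subst free_lift_basis[OF U g that]) auto
  have Zm: "left_module R ((res_mod R M n)\<lparr>carrier := res_cycles R M n\<rparr>)"
    by (rule submod_left_module[OF res_mod_left_module[OF R] Z])
  have ZU: "submod R ?U (res_cycles R M n)"
    using Z free_mono[of "res_gens R M n" UNIV R] unfolding submod_def res_mod_def by auto
  have sub: "res_bd R v \<in> res_cycles R M n" if "v \<in> carrier (res_mod R M (Suc n))" for v
    using R that unfolding res_mod_def
  proof (induction v rule: free_induct)
    case zero
    show ?case
      using linmap_zero[OF res_mod_left_module[OF R] U bdU] ZU
      by (simp add: submod_def res_mod_def)
  next
    case (basis a x)
    then obtain l where l: "x = Cyc l" "lincomb R l \<in> res_cycles R M n"
      unfolding res_gens_Suc[OF R] by blast
    have "res_bd R (a \<odot>\<^bsub>res_mod R M (Suc n)\<^esub> basis_vec R x) = a \<odot>\<^bsub>?U\<^esub> lincomb R l"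
      using linmap_smult[OF bdU basis(1)] basis_in_free[OF R basis(2)] bdb basis(2) l(1)
      by (simp add: res_mod_def)
    then show ?case using ZU l(2) basis(1) unfolding submod_def res_mod_def by metis
  next
    case (add u v)
    then have "res_bd R (u \<oplus>\<^bsub>res_mod R M (Suc n)\<^esub> v) = res_bd R u \<oplus>\<^bsub>?U\<^esub> res_bd R v"
      by (intro linmap_add[OF bdU]) (simp_all add: res_mod_def)
    then show ?case using ZU add unfolding submod_def res_mod_def by metis
  qed
  have "res_bd R ` carrier (res_mod R M (Suc n)) \<subseteq> carrier (res_mod R M n)"
    using sub Z by (auto simp: submod_def)
  from linmap_into_sub[OF bdU this]
  show "res_bd R \<in> linmap R (res_mod R M (Suc n)) (res_mod R M n)"
    unfolding res_mod_def free_sub[of R "res_gens R M n", symmetric] .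
  show "res_bd R ` carrier (res_mod R M (Suc n)) = res_cycles R M n"
  proof
    show "res_bd R ` carrier (res_mod R M (Suc n)) \<subseteq> res_cycles R M n" using sub by blast
    show "res_cycles R M n \<subseteq> res_bd R ` carrier (res_mod R M (Suc n))"
    proof
      fix z assume z: "z \<in> res_cycles R M n"
      then have "z \<in> carrier (free_module R (res_gens R M n))"
        using Z by (auto simp: submod_def res_mod_def)
      then obtain l where l: "set l \<subseteq> carrier R \<times> res_gens R M n" "lincomb R l = z"
        using lincomb_surj[OF R] by blast
      then have "Cyc l \<in> res_gens R M (Suc n)" using z unfolding res_gens_Suc[OF R] by blast
      moreover from this have "basis_vec R (Cyc l) \<in> carrier (res_mod R M (Suc n))"
        unfolding res_mod_def by (rule basis_in_free[OF R])
      ultimately show "z \<in> res_bd R ` carrier (res_mod R M (Suc n))" using bdb l(2) by force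
    qed
  qed
qed

lemma res_cycles_submod:
  assumes M: "left_module R M"
  shows "submod R (res_mod R M n) (res_cycles R M n)"
proof (induction n)
  case 0
  show ?case
    using submod_ker[OF res_mod_left_module[OF module_ring[OF M]] M res_aug_linmap[OF M]]
    by (simp add: res_cycles_def)
next
  case (Suc n)
  show ?case
    using submod_ker[OF res_mod_left_module[OF module_ring[OF M]] res_mod_left_module[OF module_ring[OF M]]
        res_bd_step(1)[OF M Suc]]
    by (simp add: res_cycles_def)
qed

lemma standard_resolution:
  assumes M: "left_module R M"
  shows "proj_resolution R M (res_mod R M) (res_diff R M)
           (restrict (res_aug R M) (carrier (res_mod R M 0)))"
proof -
  have R: "ring R" using M by (rule module_ring)
  note bd = res_bd_step[OF M res_cycles_submod[OF M]]
  note F = res_mod_left_module[OF R, of M]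
  have im: "res_diff R M n ` carrier (res_mod R M (Suc n)) = res_cycles R M n" for n
    using bd(2)[of n] by (simp add: res_diff_def)
  show ?thesis
    unfolding proj_resolution_def
  proof (intro conjI allI)
    fix n
    show "projective R (res_mod R M n)" unfolding res_mod_def by (rule free_projective[OF R])
    show "res_diff R M n \<in> mod_hom R (res_mod R M (Suc n)) (res_mod R M n)"
      unfolding res_diff_def by (rule linmap_restrict[OF F bd(1)])
    show "res_diff R M (Suc n) ` carrier (res_mod R M (Suc (Suc n))) =
        mod_ker (res_mod R M (Suc n)) (res_mod R M n) (res_diff R M n)"
      unfolding im by (auto simp: res_cycles_def mod_ker_def res_diff_def)
  next
    show "restrict (res_aug R M) (carrier (res_mod R M 0)) \<in> mod_hom R (res_mod R M 0) M"
      by (rule linmap_restrict[OF F res_aug_linmap[OF M]])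
    show "restrict (res_aug R M) (carrier (res_mod R M 0)) ` carrier (res_mod R M 0) = carrier M"
      using res_aug_surj[OF M] by simp
    show "res_diff R M 0 ` carrier (res_mod R M (Suc 0)) =
        mod_ker (res_mod R M 0) M (restrict (res_aug R M) (carrier (res_mod R M 0)))"
      unfolding im by (auto simp: res_cycles_def mod_ker_def)
  qed
qed

section \<open>Comparison of projective resolutions\<close>

locale resolution =
  fixes R :: "('r, 'x) ring_scheme" and M :: "('r, 'm, 'y) module_scheme"
    and P :: "nat \<Rightarrow> ('r, 'p, 'z) module_scheme" and d e
  assumes M: "left_module R M" and res: "proj_resolution R M P d e"
begin

lemma proj: "projective R (P n)" using res by (simp add: proj_resolution_def)

lemma mod: "left_module R (P n)" by (rule projective_left_module[OF proj])

lemma d: "d n \<in> linmap R (P (Suc n)) (P n)"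
  using res by (simp add: proj_resolution_def mod_hom_iff)

lemma e: "e \<in> linmap R (P 0) M"
  using res by (simp add: proj_resolution_def mod_hom_iff)

lemma e_surj: "e ` carrier (P 0) = carrier M"
  using res by (simp add: proj_resolution_def)

lemma ex0: "d 0 ` carrier (P (Suc 0)) = mod_ker (P 0) M e"
  using res by (simp add: proj_resolution_def)

lemma exS: "d (Suc n) ` carrier (P (Suc (Suc n))) = mod_ker (P (Suc n)) (P n) (d n)"
  using res by (simp add: proj_resolution_def)

lemma dd: "x \<in> carrier (P (Suc (Suc n))) \<Longrightarrow> d n (d (Suc n) x) = \<zero>\<^bsub>P n\<^esub>"
  using exS[of n] by (auto simp: mod_ker_def)

lemma ed: "x \<in> carrier (P (Suc 0)) \<Longrightarrow> e (d 0 x) = \<zero>\<^bsub>M\<^esub>"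
  using ex0 by (auto simp: mod_ker_def)

end

text \<open>The components are chosen recursively. The invariant demands, besides linearity, that
  \<open>\<phi>\<close> sends boundaries of \<open>P\<close> to boundaries of \<open>Q\<close>,
  which is the containment that the next application of \<open>projective_lift\<close> asks
  for.\<close>

lemma comparison_map:
  fixes P :: "nat \<Rightarrow> ('r, 'p, 'z) module_scheme" and Q :: "nat \<Rightarrow> ('r, 'q, 'w) module_scheme"
  assumes P: "resolution R M P d e" and Q: "resolution R M Q d' e'"
  shows "\<exists>\<phi>. (\<forall>n. \<phi> n \<in> linmap R (P n) (Q n)) \<and> (\<forall>x\<in>carrier (P 0). e' (\<phi> 0 x) = e x) \<and>
     (\<forall>n. \<forall>x\<in>carrier (P (Suc n)). \<phi> n (d n x) = d' n (\<phi> (Suc n) x))"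
proof -
  interpret P: resolution R M P d e by fact
  interpret Q: resolution R M Q d' e' by fact
  let ?P = "\<lambda>n \<phi>. \<phi> \<in> linmap R (P n) (Q n) \<and>
     (\<forall>x\<in>carrier (P (Suc n)). \<phi> (d n x) \<in> d' n ` carrier (Q (Suc n))) \<and>
     (n = 0 \<longrightarrow> (\<forall>x\<in>carrier (P 0). e' (\<phi> x) = e x))"
  let ?Q = "\<lambda>n \<phi> \<phi>'. \<forall>x\<in>carrier (P (Suc n)). \<phi> (d n x) = d' n (\<phi>' x)"
  have "\<exists>\<phi>. \<forall>n. ?P n (\<phi> n) \<and> ?Q n (\<phi> n) (\<phi> (Suc n))"
  proof (rule dependent_nat_choice)
    have "e ` carrier (P 0) \<subseteq> e' ` carrier (Q 0)" by (simp add: P.e_surj Q.e_surj)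
    then obtain \<phi> where \<phi>: "\<phi> \<in> linmap R (P 0) (Q 0)" "\<And>x. x \<in> carrier (P 0) \<Longrightarrow> e' (\<phi> x) = e x"
      using projective_lift[OF P.proj Q.mod P.M P.e Q.e] by blast
    have "\<phi> (d 0 x) \<in> d' 0 ` carrier (Q (Suc 0))" if "x \<in> carrier (P (Suc 0))" for x
      using that linmap_closed[OF P.d that] \<phi> linmap_closed[OF \<phi>(1)] P.ed
      unfolding Q.ex0 by (simp add: mod_ker_def)
    then show "\<exists>\<phi>. ?P 0 \<phi>" using \<phi> by blast
  next
    fix \<phi> n assume \<phi>: "?P n \<phi>"
    then have f: "(\<lambda>x. \<phi> (d n x)) \<in> linmap R (P (Suc n)) (Q n)"
      and im: "(\<lambda>x. \<phi> (d n x)) ` carrier (P (Suc n)) \<subseteq> d' n ` carrier (Q (Suc n))"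
      using linmap_comp[OF P.d] by blast+
    then obtain \<phi>' where \<phi>': "\<phi>' \<in> linmap R (P (Suc n)) (Q (Suc n))"
      "\<And>x. x \<in> carrier (P (Suc n)) \<Longrightarrow> d' n (\<phi>' x) = \<phi> (d n x)"
      using projective_lift[OF P.proj Q.mod Q.mod f Q.d im] by blast
    have "\<phi>' (d (Suc n) x) \<in> d' (Suc n) ` carrier (Q (Suc (Suc n)))"
      if x: "x \<in> carrier (P (Suc (Suc n)))" for x
    proof -
      have "d' n (\<phi>' (d (Suc n) x)) = \<phi> \<zero>\<^bsub>P n\<^esub>"
        using \<phi>'(2)[OF linmap_closed[OF P.d x]] P.dd[OF x] by simp
      also have "\<dots> = \<zero>\<^bsub>Q n\<^esub>" using \<phi> linmap_zero[OF P.mod Q.mod] by blast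
      finally show ?thesis
        unfolding Q.exS using linmap_closed[OF \<phi>'(1) linmap_closed[OF P.d x]]
        by (simp add: mod_ker_def)
    qed
    then show "\<exists>\<phi>'. ?P (Suc n) \<phi>' \<and> ?Q n \<phi> \<phi>'" using \<phi>' by (intro exI[of _ \<phi>']) auto
  qed
  then obtain \<phi> where H: "\<forall>n. ?P n (\<phi> n) \<and> ?Q n (\<phi> n) (\<phi> (Suc n))" by (rule exE)
  note \<phi> = spec[OF H, THEN conjunct1] spec[OF H, THEN conjunct2]
  show ?thesis
  proof (intro exI[of _ \<phi>] conjI allI)
    show "\<phi> n \<in> linmap R (P n) (Q n)" for n using \<phi>(1)[of n] by (rule conjunct1)
    show "\<forall>x\<in>carrier (P 0). e' (\<phi> 0 x) = e x" using \<phi>(1)[of 0] by simp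
    show "\<forall>x\<in>carrier (P (Suc n)). \<phi> n (d n x) = d' n (\<phi> (Suc n) x)" for n by (rule \<phi>(2))
  qed
qed

text \<open>Applied to the composite of two comparison maps. The homotopy identity is solved for
  \<open>x\<close>, so that an additive map can be applied to it term by term; it is recorded in
  positive degrees, those of the Ext and Tor groups in question.\<close>

lemma homotopy_to_identity:
  fixes P :: "nat \<Rightarrow> ('r, 'p, 'z) module_scheme"
  assumes P: "resolution R M P d e"
    and \<theta>: "\<And>n. \<theta> n \<in> linmap R (P n) (P n)"
    and \<theta>e: "\<And>x. x \<in> carrier (P 0) \<Longrightarrow> e (\<theta> 0 x) = e x"
    and \<theta>d: "\<And>n x. x \<in> carrier (P (Suc n)) \<Longrightarrow> \<theta> n (d n x) = d n (\<theta> (Suc n) x)"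
  shows "\<exists>s. (\<forall>n. s n \<in> linmap R (P n) (P (Suc n))) \<and>
     (\<forall>n. \<forall>x\<in>carrier (P (Suc n)).
        x = (\<theta> (Suc n) x \<oplus>\<^bsub>P (Suc n)\<^esub> s n (d n x)) \<oplus>\<^bsub>P (Suc n)\<^esub> d (Suc n) (s (Suc n) x))"
proof -
  interpret P: resolution R M P d e by fact
  \<comment> \<open>From ds = 1 - \<theta> - sd in one degree only the consequence on boundaries is
    kept, where the term sd vanishes. It is just enough to see that the next map to be lifted takes
    values in cycles.\<close>
  let ?P = "\<lambda>n s. s \<in> linmap R (P n) (P (Suc n)) \<and>
     (\<forall>x\<in>carrier (P (Suc n)). d n (s (d n x)) = d n x \<ominus>\<^bsub>P n\<^esub> \<theta> n (d n x))"
  let ?Q = "\<lambda>n s s'. \<forall>x\<in>carrier (P (Suc n)).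
     d (Suc n) (s' x) = x \<ominus>\<^bsub>P (Suc n)\<^esub> (\<theta> (Suc n) x \<oplus>\<^bsub>P (Suc n)\<^esub> s (d n x))"
  have "\<exists>s. \<forall>n. ?P n (s n) \<and> ?Q n (s n) (s (Suc n))"
  proof (rule dependent_nat_choice)
    let ?f = "\<lambda>x. x \<ominus>\<^bsub>P 0\<^esub> \<theta> 0 x"
    interpret P0: abelian_group "P 0" using P.mod by (rule module_abelian)
    interpret M: abelian_group M using P.M by (rule module_abelian)
    have f: "?f \<in> linmap R (P 0) (P 0)" by (rule linmap_diff[OF P.mod linmap_id \<theta>])
    have "?f ` carrier (P 0) \<subseteq> d 0 ` carrier (P (Suc 0))"
      unfolding P.ex0
      by (auto simp: mod_ker_def linmap_closed[OF \<theta>] linmap_minus[OF P.mod P.M P.e] \<theta>e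
          M.minus_zero_iff linmap_closed[OF P.e])
    then show "\<exists>s. ?P 0 s"
      using projective_lift[OF P.proj P.mod P.mod f P.d] linmap_closed[OF P.d] by meson
  next
    fix s n assume s: "?P n s"
    then have s1: "s \<in> linmap R (P n) (P (Suc n))" by blast
    interpret Pn: abelian_group "P n" using P.mod by (rule module_abelian)
    interpret PS: abelian_group "P (Suc n)" using P.mod by (rule module_abelian)
    let ?f = "\<lambda>x. x \<ominus>\<^bsub>P (Suc n)\<^esub> (\<theta> (Suc n) x \<oplus>\<^bsub>P (Suc n)\<^esub> s (d n x))"
    have f: "?f \<in> linmap R (P (Suc n)) (P (Suc n))"
      by (intro linmap_diff linmap_plus P.mod linmap_id \<theta> linmap_comp[OF P.d] s1)
    have im: "?f ` carrier (P (Suc n)) \<subseteq> d (Suc n) ` carrier (P (Suc (Suc n)))"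
      unfolding P.exS mod_ker_def
    proof (intro image_subsetI CollectI conjI)
      fix x assume x: "x \<in> carrier (P (Suc n))"
      show "?f x \<in> carrier (P (Suc n))" using linmap_closed[OF f x] .
      have cl: "\<theta> (Suc n) x \<in> carrier (P (Suc n))" "s (d n x) \<in> carrier (P (Suc n))"
        "d n x \<in> carrier (P n)" "\<theta> n (d n x) \<in> carrier (P n)"
        using x linmap_closed[OF \<theta>] linmap_closed[OF P.d] linmap_closed[OF s1] by auto
      have "d n (?f x) = d n x \<ominus>\<^bsub>P n\<^esub> (d n (\<theta> (Suc n) x) \<oplus>\<^bsub>P n\<^esub> d n (s (d n x)))"
        using x cl by (simp add: linmap_minus[OF P.mod P.mod P.d] linmap_add[OF P.d])
      also have "\<dots> = d n x \<ominus>\<^bsub>P n\<^esub> (\<theta> n (d n x) \<oplus>\<^bsub>P n\<^esub> (d n x \<ominus>\<^bsub>P n\<^esub> \<theta> n (d n x)))"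
        using s x by (simp add: \<theta>d)
      also have "\<dots> = \<zero>\<^bsub>P n\<^esub>"
        using cl by (simp add: Pn.a_comm[of "\<theta> n (d n x)"] Pn.minus_add_cancel Pn.minus_zero_iff)
      finally show "d n (?f x) = \<zero>\<^bsub>P n\<^esub>" .
    qed
    obtain s' where s': "s' \<in> linmap R (P (Suc n)) (P (Suc (Suc n)))"
      "\<And>x. x \<in> carrier (P (Suc n)) \<Longrightarrow> d (Suc n) (s' x) = ?f x"
      using projective_lift[OF P.proj P.mod P.mod f P.d im] by blast
    have "d (Suc n) (s' (d (Suc n) x)) = d (Suc n) x \<ominus>\<^bsub>P (Suc n)\<^esub> \<theta> (Suc n) (d (Suc n) x)"
      if x: "x \<in> carrier (P (Suc (Suc n)))" for x
      using s'(2)[OF linmap_closed[OF P.d x]] P.dd[OF x] linmap_zero[OF P.mod P.mod s1]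
        linmap_closed[OF \<theta> linmap_closed[OF P.d x]] by simp
    then show "\<exists>s'. ?P (Suc n) s' \<and> ?Q n s s'" using s' by blast
  qed
  then obtain s where s: "\<And>n. s n \<in> linmap R (P n) (P (Suc n))" and Q: "\<And>n. ?Q n (s n) (s (Suc n))"
    by blast
  have "x = (\<theta> (Suc n) x \<oplus>\<^bsub>P (Suc n)\<^esub> s n (d n x)) \<oplus>\<^bsub>P (Suc n)\<^esub> d (Suc n) (s (Suc n) x)"
    if x: "x \<in> carrier (P (Suc n))" for n x
  proof -
    interpret PS: abelian_group "P (Suc n)" using P.mod by (rule module_abelian)
    have cl: "\<theta> (Suc n) x \<oplus>\<^bsub>P (Suc n)\<^esub> s n (d n x) \<in> carrier (P (Suc n))"
      using x linmap_closed[OF \<theta>] linmap_closed[OF P.d] linmap_closed[OF s] by auto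
    show ?thesis
      using Q[of n] x PS.minus_add_cancel[OF x cl] PS.a_comm[OF cl PS.minus_closed[OF x cl]] by simp
  qed
  then show ?thesis using s by blast
qed

text \<open>Exactness is inherited by homotopy retracts, so only the homotopy between
  \<open>\<psi> \<phi>\<close> and the identity of \<open>P\<close> is produced.\<close>

lemma comparison_retract:
  fixes P :: "nat \<Rightarrow> ('r, 'p, 'z) module_scheme" and Q :: "nat \<Rightarrow> ('r, 'q, 'w) module_scheme"
  assumes P: "resolution R M P d e" and Q: "resolution R M Q d' e'"
  obtains \<phi> \<psi> s where
    "\<And>n. \<phi> n \<in> linmap R (P n) (Q n)" "\<And>n. \<psi> n \<in> linmap R (Q n) (P n)"
    "\<And>n. s n \<in> linmap R (P n) (P (Suc n))"
    "\<And>n x. x \<in> carrier (P (Suc n)) \<Longrightarrow> \<phi> n (d n x) = d' n (\<phi> (Suc n) x)"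
    "\<And>n x. x \<in> carrier (Q (Suc n)) \<Longrightarrow> \<psi> n (d' n x) = d n (\<psi> (Suc n) x)"
    "\<And>n x. x \<in> carrier (P (Suc n)) \<Longrightarrow>
      x = (\<psi> (Suc n) (\<phi> (Suc n) x) \<oplus>\<^bsub>P (Suc n)\<^esub> s n (d n x)) \<oplus>\<^bsub>P (Suc n)\<^esub> d (Suc n) (s (Suc n) x)"
proof -
  interpret P: resolution R M P d e by fact
  interpret Q: resolution R M Q d' e' by fact
  obtain \<phi> where \<phi>: "\<And>n. \<phi> n \<in> linmap R (P n) (Q n)" "\<And>x. x \<in> carrier (P 0) \<Longrightarrow> e' (\<phi> 0 x) = e x"
    "\<And>n x. x \<in> carrier (P (Suc n)) \<Longrightarrow> \<phi> n (d n x) = d' n (\<phi> (Suc n) x)"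
    using comparison_map[OF P Q] by blast
  obtain \<psi> where \<psi>: "\<And>n. \<psi> n \<in> linmap R (Q n) (P n)" "\<And>x. x \<in> carrier (Q 0) \<Longrightarrow> e (\<psi> 0 x) = e' x"
    "\<And>n x. x \<in> carrier (Q (Suc n)) \<Longrightarrow> \<psi> n (d' n x) = d n (\<psi> (Suc n) x)"
    using comparison_map[OF Q P] by blast
  obtain s where s: "\<And>n. s n \<in> linmap R (P n) (P (Suc n))"
    "\<And>n x. x \<in> carrier (P (Suc n)) \<Longrightarrow>
      x = (\<psi> (Suc n) (\<phi> (Suc n) x) \<oplus>\<^bsub>P (Suc n)\<^esub> s n (d n x)) \<oplus>\<^bsub>P (Suc n)\<^esub> d (Suc n) (s (Suc n) x)"
    using homotopy_to_identity[OF P linmap_comp[OF \<phi>(1) \<psi>(1)]]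
    by (force simp: \<phi> \<psi> linmap_closed[OF \<phi>(1)])
  show ?thesis by (rule that[OF \<phi>(1) \<psi>(1) s(1) \<phi>(3) \<psi>(3) s(2)])
qed

text \<open>Exactness in degree \<open>j + 1\<close> of the complexes obtained from \<open>P\<close> by applying
  \<open>Hom(-, N)\<close> and \<open>- \<otimes> M\<close>.\<close>

definition hom_exact ::
  "('r, 'x) ring_scheme \<Rightarrow> ('r, 'n, 'y) module_scheme \<Rightarrow> (nat \<Rightarrow> ('r, 'p, 'z) module_scheme) \<Rightarrow>
   (nat \<Rightarrow> 'p \<Rightarrow> 'p) \<Rightarrow> nat \<Rightarrow> bool" where
  "hom_exact R N P d j \<longleftrightarrow> (\<forall>f\<in>linmap R (P (Suc j)) N.
     (\<forall>x\<in>carrier (P (Suc (Suc j))). f (d (Suc j) x) = \<zero>\<^bsub>N\<^esub>) \<longrightarrow>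
     (\<exists>g\<in>linmap R (P j) N. \<forall>x\<in>carrier (P (Suc j)). f x = g (d j x)))"

definition tensor_exact ::
  "('r, 'x) ring_scheme \<Rightarrow> ('r, 'm, 'y) module_scheme \<Rightarrow> (nat \<Rightarrow> ('r, 'p, 'z) module_scheme) \<Rightarrow>
   (nat \<Rightarrow> 'p \<Rightarrow> 'p) \<Rightarrow> nat \<Rightarrow> bool" where
  "tensor_exact R M P d j \<longleftrightarrow> (\<forall>t\<in>carrier (tensor_ab R (P (Suc j)) M).
     tensor_map R (P (Suc j)) (P j) M (d j) t = \<zero>\<^bsub>tensor_ab R (P j) M\<^esub> \<longrightarrow>
     t \<in> tensor_map R (P (Suc (Suc j))) (P (Suc j)) M (d (Suc j)) `
           carrier (tensor_ab R (P (Suc (Suc j))) M))"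

text \<open>If \<open>f\<close> kills boundaries, so does \<open>f \<psi>\<close>, hence
  \<open>f \<psi> = g d'\<close> for some \<open>g\<close>. Applying \<open>f\<close> to x =
  \<psi>\<phi>x + s d x + d s x gives f x = g\<phi>(d x) + f s(d x), which exhibits \<open>f\<close>
  as a map composed with \<open>d\<close>.\<close>

lemma hom_exact_transfer:
  assumes P: "resolution R M P d e" and Q: "resolution R M Q d' e'" and N: "left_module R N"
    and ex: "hom_exact R N Q d' j"
  shows "hom_exact R N P d j"
  unfolding hom_exact_def
proof (intro ballI impI)
  fix f assume f: "f \<in> linmap R (P (Suc j)) N"
    and z: "\<forall>x\<in>carrier (P (Suc (Suc j))). f (d (Suc j) x) = \<zero>\<^bsub>N\<^esub>"
  interpret P: resolution R M P d e by fact
  interpret Q: resolution R M Q d' e' by fact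
  interpret N: abelian_group N using N by (rule module_abelian)
  interpret PS: abelian_group "P (Suc j)" using P.mod by (rule module_abelian)
  obtain \<phi> \<psi> s where \<phi>: "\<And>n. \<phi> n \<in> linmap R (P n) (Q n)" and \<psi>: "\<And>n. \<psi> n \<in> linmap R (Q n) (P n)"
    and s: "\<And>n. s n \<in> linmap R (P n) (P (Suc n))"
    and \<phi>d: "\<And>n x. x \<in> carrier (P (Suc n)) \<Longrightarrow> \<phi> n (d n x) = d' n (\<phi> (Suc n) x)"
    and \<psi>d: "\<And>n x. x \<in> carrier (Q (Suc n)) \<Longrightarrow> \<psi> n (d' n x) = d n (\<psi> (Suc n) x)"
    and h: "\<And>n x. x \<in> carrier (P (Suc n)) \<Longrightarrow>
      x = (\<psi> (Suc n) (\<phi> (Suc n) x) \<oplus>\<^bsub>P (Suc n)\<^esub> s n (d n x)) \<oplus>\<^bsub>P (Suc n)\<^esub> d (Suc n) (s (Suc n) x)"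
    by (rule comparison_retract[OF P Q]) blast
  have f\<psi>: "(\<lambda>y. f (\<psi> (Suc j) y)) \<in> linmap R (Q (Suc j)) N" by (rule linmap_comp[OF \<psi> f])
  have f\<psi>z: "\<forall>y\<in>carrier (Q (Suc (Suc j))). f (\<psi> (Suc j) (d' (Suc j) y)) = \<zero>\<^bsub>N\<^esub>"
    using z linmap_closed[OF \<psi>] by (simp add: \<psi>d)
  obtain g where g: "g \<in> linmap R (Q j) N"
    and fg: "\<And>y. y \<in> carrier (Q (Suc j)) \<Longrightarrow> f (\<psi> (Suc j) y) = g (d' j y)"
    using mp[OF bspec[OF ex[unfolded hom_exact_def] f\<psi>] f\<psi>z] by blast
  let ?g = "\<lambda>x. g (\<phi> j x) \<oplus>\<^bsub>N\<^esub> f (s j x)"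
  have "?g \<in> linmap R (P j) N" by (intro linmap_plus[OF N] linmap_comp[OF \<phi> g] linmap_comp[OF s f])
  moreover have "f x = ?g (d j x)" if x: "x \<in> carrier (P (Suc j))" for x
  proof -
    note cl = linmap_closed[OF \<phi> x] linmap_closed[OF P.d x] linmap_closed[OF s x]
    have cl2: "\<psi> (Suc j) (\<phi> (Suc j) x) \<in> carrier (P (Suc j))" "s j (d j x) \<in> carrier (P (Suc j))"
      "d (Suc j) (s (Suc j) x) \<in> carrier (P (Suc j))"
      using cl linmap_closed[OF \<psi>] linmap_closed[OF s] linmap_closed[OF P.d] by auto
    have "f x = f ((\<psi> (Suc j) (\<phi> (Suc j) x) \<oplus>\<^bsub>P (Suc j)\<^esub> s j (d j x)) \<oplus>\<^bsub>P (Suc j)\<^esub> d (Suc j) (s (Suc j) x))"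
      using h[OF x] by simp
    also have "\<dots> = (f (\<psi> (Suc j) (\<phi> (Suc j) x)) \<oplus>\<^bsub>N\<^esub> f (s j (d j x))) \<oplus>\<^bsub>N\<^esub> f (d (Suc j) (s (Suc j) x))"
      using cl2 by (simp add: linmap_add[OF f])
    also have "\<dots> = ?g (d j x)"
    proof -
      have 1: "f (\<psi> (Suc j) (\<phi> (Suc j) x)) = g (\<phi> j (d j x))"
        using fg[OF linmap_closed[OF \<phi> x]] by (simp add: \<phi>d[OF x])
      have 2: "f (d (Suc j) (s (Suc j) x)) = \<zero>\<^bsub>N\<^esub>" using z linmap_closed[OF s x] by blast
      have "g (\<phi> j (d j x)) \<in> carrier N" "f (s j (d j x)) \<in> carrier N"
        using linmap_closed[OF g linmap_closed[OF \<phi> cl(2)]] linmap_closed[OF f cl2(2)] by auto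
      then show ?thesis unfolding 1 2 by (simp only: N.r_zero N.a_closed)
    qed
    finally show ?thesis .
  qed
  ultimately show "\<exists>g\<in>linmap R (P j) N. \<forall>x\<in>carrier (P (Suc j)). f x = g (d j x)"
    by (intro bexI[of _ ?g]) blast+
qed

text \<open>The image of a cycle \<open>t\<close> in the complex of \<open>Q\<close> is the boundary
  of some \<open>w\<close>. The homotopy then writes \<open>t\<close> as d(\<psi>w) + d(s t), its
  middle term s d t being zero.\<close>

lemma tensor_exact_transfer:
  assumes P: "resolution (opp R) A P d e" and Q: "resolution (opp R) A Q d' e'"
    and M: "left_module R M" and ex: "tensor_exact R M Q d' j"
  shows "tensor_exact R M P d j"
  unfolding tensor_exact_def
proof (intro ballI impI)
  fix t assume t: "t \<in> carrier (tensor_ab R (P (Suc j)) M)"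
    and z: "tensor_map R (P (Suc j)) (P j) M (d j) t = \<zero>\<^bsub>tensor_ab R (P j) M\<^esub>"
  interpret P: resolution "opp R" A P d e by fact
  interpret Q: resolution "opp R" A Q d' e' by fact
  have tp: "tensor_pair R (P n) M" "tensor_pair R (Q n) M" for n
    using P.mod Q.mod M by (auto intro: tensor_pair.intro)
  interpret PS: abelian_group "tensor_ab R (P (Suc j)) M" by (rule tensor_pair.T_ab[OF tp(1)])
  interpret QJ: abelian_group "tensor_ab R (Q j) M" by (rule tensor_pair.T_ab[OF tp(2)])
  obtain \<phi> \<psi> s where "\<And>n. \<phi> n \<in> linmap (opp R) (P n) (Q n)" "\<And>n. \<psi> n \<in> linmap (opp R) (Q n) (P n)"
    "\<And>n. s n \<in> linmap (opp R) (P n) (P (Suc n))"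
    and \<phi>d: "\<And>n x. x \<in> carrier (P (Suc n)) \<Longrightarrow> \<phi> n (d n x) = d' n (\<phi> (Suc n) x)"
    and \<psi>d: "\<And>n x. x \<in> carrier (Q (Suc n)) \<Longrightarrow> \<psi> n (d' n x) = d n (\<psi> (Suc n) x)"
    and h: "\<And>n x. x \<in> carrier (P (Suc n)) \<Longrightarrow>
      x = (\<psi> (Suc n) (\<phi> (Suc n) x) \<oplus>\<^bsub>P (Suc n)\<^esub> s n (d n x)) \<oplus>\<^bsub>P (Suc n)\<^esub> d (Suc n) (s (Suc n) x)"
    by (rule comparison_retract[OF P Q]) blast
  then have \<phi>: "\<And>n. \<phi> n \<in> linmap R (P n) (Q n)" and \<psi>: "\<And>n. \<psi> n \<in> linmap R (Q n) (P n)"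
    and s: "\<And>n. s n \<in> linmap R (P n) (P (Suc n))" by simp_all
  note d = P.d[simplified] and d' = Q.d[simplified]
  let ?T = "\<lambda>A B f. tensor_map R A B M f"
  note TP = tensor_map_hom[OF P.mod P.mod M]
  have t1: "?T (P (Suc j)) (Q (Suc j)) (\<phi> (Suc j)) t \<in> carrier (tensor_ab R (Q (Suc j)) M)"
    by (rule ab_hom_closed[OF tensor_map_hom[OF P.mod Q.mod M \<phi>] t])
  have "?T (Q (Suc j)) (Q j) (d' j) (?T (P (Suc j)) (Q (Suc j)) (\<phi> (Suc j)) t) =
      ?T (P (Suc j)) (Q j) (\<lambda>x. \<phi> j (d j x)) t"
    by (rule tensor_map_comp[OF P.mod Q.mod Q.mod M \<phi> d' linmap_comp[OF d \<phi>] \<phi>d t])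
  also have "\<dots> = ?T (P j) (Q j) (\<phi> j) (?T (P (Suc j)) (P j) (d j) t)"
    by (rule tensor_map_comp[OF P.mod P.mod Q.mod M d \<phi> linmap_comp[OF d \<phi>] refl t, symmetric])
  also have "\<dots> = \<zero>\<^bsub>tensor_ab R (Q j) M\<^esub>"
    unfolding z
    by (rule ab_hom_zero[OF tensor_pair.T_ab[OF tp(1)] tensor_pair.T_ab[OF tp(2)]
        tensor_map_hom[OF P.mod Q.mod M \<phi>]])
  finally obtain w where w: "w \<in> carrier (tensor_ab R (Q (Suc (Suc j))) M)"
    and wt: "?T (P (Suc j)) (Q (Suc j)) (\<phi> (Suc j)) t = ?T (Q (Suc (Suc j))) (Q (Suc j)) (d' (Suc j)) w"
    using ex t1 unfolding tensor_exact_def by blast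
  let ?w = "?T (Q (Suc (Suc j))) (P (Suc (Suc j))) (\<psi> (Suc (Suc j))) w"
  let ?s = "?T (P (Suc j)) (P (Suc (Suc j))) (s (Suc j)) t"
  let ?D = "?T (P (Suc (Suc j))) (P (Suc j)) (d (Suc j))"
  have wc: "?w \<in> carrier (tensor_ab R (P (Suc (Suc j))) M)"
    by (rule ab_hom_closed[OF tensor_map_hom[OF Q.mod P.mod M \<psi>] w])
  have sc: "?s \<in> carrier (tensor_ab R (P (Suc (Suc j))) M)"
    by (rule ab_hom_closed[OF TP[OF s] t])
  interpret PSS: abelian_group "tensor_ab R (P (Suc (Suc j))) M" by (rule tensor_pair.T_ab[OF tp(1)])
  have Dw: "?D ?w = ?T (P (Suc j)) (P (Suc j)) (\<lambda>x. \<psi> (Suc j) (\<phi> (Suc j) x)) t"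
  proof -
    have "?D ?w = ?T (Q (Suc (Suc j))) (P (Suc j)) (\<lambda>x. \<psi> (Suc j) (d' (Suc j) x)) w"
      by (rule tensor_map_comp[OF Q.mod P.mod P.mod M \<psi> d linmap_comp[OF d' \<psi>] \<psi>d w])
    also have "\<dots> = ?T (Q (Suc j)) (P (Suc j)) (\<psi> (Suc j)) (?T (Q (Suc (Suc j))) (Q (Suc j)) (d' (Suc j)) w)"
      by (rule tensor_map_comp[OF Q.mod Q.mod P.mod M d' \<psi> linmap_comp[OF d' \<psi>] refl w, symmetric])
    also have "\<dots> = ?T (P (Suc j)) (P (Suc j)) (\<lambda>x. \<psi> (Suc j) (\<phi> (Suc j) x)) t"
      unfolding wt[symmetric]
      by (rule tensor_map_comp[OF P.mod Q.mod P.mod M \<phi> \<psi> linmap_comp[OF \<phi> \<psi>] refl t])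
    finally show ?thesis .
  qed
  have Ds: "?D ?s = ?T (P (Suc j)) (P (Suc j)) (\<lambda>x. d (Suc j) (s (Suc j) x)) t"
    by (rule tensor_map_comp[OF P.mod P.mod P.mod M s d linmap_comp[OF s d] refl t])
  have sd: "?T (P (Suc j)) (P (Suc j)) (\<lambda>x. s j (d j x)) t = \<zero>\<^bsub>tensor_ab R (P (Suc j)) M\<^esub>"
  proof -
    have "?T (P (Suc j)) (P (Suc j)) (\<lambda>x. s j (d j x)) t = ?T (P j) (P (Suc j)) (s j) (?T (P (Suc j)) (P j) (d j) t)"
      by (rule tensor_map_comp[OF P.mod P.mod P.mod M d s linmap_comp[OF d s] refl t, symmetric])
    also have "\<dots> = \<zero>\<^bsub>tensor_ab R (P (Suc j)) M\<^esub>"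
      unfolding z
      by (rule ab_hom_zero[OF tensor_pair.T_ab[OF tp(1)] tensor_pair.T_ab[OF tp(1)] TP[OF s]])
    finally show ?thesis .
  qed
  let ?u = "\<lambda>x. \<psi> (Suc j) (\<phi> (Suc j) x) \<oplus>\<^bsub>P (Suc j)\<^esub> s j (d j x)"
  have u: "?u \<in> linmap R (P (Suc j)) (P (Suc j))"
    using linmap_plus[OF P.mod, simplified, OF linmap_comp[OF \<phi> \<psi>] linmap_comp[OF d s]] .
  have "t = ?T (P (Suc j)) (P (Suc j)) (\<lambda>x. x) t"
    by (rule tensor_map_id[OF P.mod M linmap_id refl t, symmetric])
  also have "\<dots> = ?T (P (Suc j)) (P (Suc j)) ?u t \<oplus>\<^bsub>tensor_ab R (P (Suc j)) M\<^esub>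
      ?T (P (Suc j)) (P (Suc j)) (\<lambda>x. d (Suc j) (s (Suc j) x)) t"
    by (rule tensor_map_plus[OF P.mod P.mod M u linmap_comp[OF s d] linmap_id h t])
  also have "?T (P (Suc j)) (P (Suc j)) ?u t =
      ?T (P (Suc j)) (P (Suc j)) (\<lambda>x. \<psi> (Suc j) (\<phi> (Suc j) x)) t \<oplus>\<^bsub>tensor_ab R (P (Suc j)) M\<^esub>
      ?T (P (Suc j)) (P (Suc j)) (\<lambda>x. s j (d j x)) t"
    by (rule tensor_map_plus[OF P.mod P.mod M linmap_comp[OF \<phi> \<psi>] linmap_comp[OF d s] u refl t])
  also have "\<dots> = ?D ?w"
    unfolding sd Dw[symmetric] by (rule PS.r_zero[OF ab_hom_closed[OF TP[OF d] wc]])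
  finally have "t = ?D ?w \<oplus>\<^bsub>tensor_ab R (P (Suc j)) M\<^esub> ?D ?s" unfolding Ds .
  also have "\<dots> = ?D (?w \<oplus>\<^bsub>tensor_ab R (P (Suc (Suc j))) M\<^esub> ?s)"
    by (rule ab_hom_add[OF TP[OF d] wc sc, symmetric])
  finally show "t \<in> ?D ` carrier (tensor_ab R (P (Suc (Suc j))) M)"
    using PSS.a_closed[OF wc sc] by blast
qed

section \<open>Vanishing of Ext and Tor\<close>

lemma hom_ab_simps [simp]:
  "carrier (hom_ab R M N) = mod_hom R M N"
  "\<zero>\<^bsub>hom_ab R M N\<^esub> = (\<lambda>x\<in>carrier M. \<zero>\<^bsub>N\<^esub>)"
  "f \<oplus>\<^bsub>hom_ab R M N\<^esub> g = (\<lambda>x\<in>carrier M. f x \<oplus>\<^bsub>N\<^esub> g x)"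
  by (simp_all add: hom_ab_def)

lemma mod_hom_eqI:
  "\<lbrakk>f \<in> mod_hom R M N; g \<in> mod_hom R M N; \<And>x. x \<in> carrier M \<Longrightarrow> f x = g x\<rbrakk> \<Longrightarrow> f = g"
  by (auto simp: mod_hom_iff intro: extensionalityI)

lemma hom_ab_abelian:
  assumes M: "left_module R M" and N: "left_module R N"
  shows "abelian_group (hom_ab R M N)"
proof -
  interpret M: abelian_group M using M by (rule module_abelian)
  interpret N: abelian_group N using N by (rule module_abelian)
  have cl: "f x \<in> carrier N" if "f \<in> mod_hom R M N" "x \<in> carrier M" for f x
    using that by (auto simp: mod_hom_iff intro: linmap_closed)
  show ?thesis
  proof (rule abelian_groupI)
    fix f g assume "f \<in> carrier (hom_ab R M N)" "g \<in> carrier (hom_ab R M N)"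
    then show fg: "f \<oplus>\<^bsub>hom_ab R M N\<^esub> g \<in> carrier (hom_ab R M N)"
      by (auto intro!: linmap_restrict M linmap_plus N dest: mod_hom_linmap)
  next
    fix f assume f: "f \<in> carrier (hom_ab R M N)"
    then have "(\<lambda>x\<in>carrier M. \<ominus>\<^bsub>N\<^esub> f x) \<in> mod_hom R M N"
      by (auto intro!: linmap_restrict M linmap_uminus N dest: mod_hom_linmap)
    moreover have "(\<lambda>x\<in>carrier M. \<ominus>\<^bsub>N\<^esub> f x) \<oplus>\<^bsub>hom_ab R M N\<^esub> f = \<zero>\<^bsub>hom_ab R M N\<^esub>"
      using f cl by (auto simp: N.l_neg restrict_def)
    ultimately show "\<exists>g\<in>carrier (hom_ab R M N). g \<oplus>\<^bsub>hom_ab R M N\<^esub> f = \<zero>\<^bsub>hom_ab R M N\<^esub>"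
      by (intro bexI) (simp_all only: hom_ab_simps)
  next
    show "\<zero>\<^bsub>hom_ab R M N\<^esub> \<in> carrier (hom_ab R M N)"
      by (auto intro!: linmap_restrict M linmap_const_zero N)
  next
    fix f assume f: "f \<in> carrier (hom_ab R M N)"
    then have "f \<in> extensional (carrier M)" by (simp add: mod_hom_iff)
    then show "\<zero>\<^bsub>hom_ab R M N\<^esub> \<oplus>\<^bsub>hom_ab R M N\<^esub> f = f"
      using f cl by (auto simp: extensional_def)
  qed (use cl in \<open>auto simp: N.a_ac cong: restrict_cong\<close>)
qed

lemma precompose_hom:
  assumes A: "left_module R A" and B: "left_module R B" and d: "d \<in> linmap R A B"
  shows "(\<lambda>g. compose (carrier A) g d) \<in> ab_hom (hom_ab R B N) (hom_ab R A N)"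
proof (rule ab_homI)
  fix g assume "g \<in> carrier (hom_ab R B N)"
  then show "compose (carrier A) g d \<in> carrier (hom_ab R A N)"
    unfolding compose_def by (auto intro!: linmap_restrict A linmap_comp[OF d] dest: mod_hom_linmap)
qed (auto simp: compose_def linmap_closed[OF d] cong: restrict_cong)

text \<open>Cocycles are coboundaries; what remains is the passage between the extensional maps of
  \<open>hom_ab\<close> and the plain linear maps of \<open>hom_exact\<close>.\<close>

lemma Ext_trivial_iff:
  assumes M: "left_module R M" and N: "left_module R N"
  shows "trivial_group (Ext R M N (Suc j)) \<longleftrightarrow> hom_exact R N (res_mod R M) (res_diff R M) j"
proof -
  interpret resolution R M "res_mod R M" "res_diff R M" "restrict (res_aug R M) (carrier (res_mod R M 0))"
    by (intro resolution.intro M standard_resolution)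
  let ?F = "res_mod R M" and ?d = "res_diff R M"
  let ?H = "\<lambda>i. hom_ab R (?F i) N"
  let ?c = "\<lambda>i g. compose (carrier (?F (Suc i))) g (?d i)"
  have H: "abelian_group (?H i)" for i by (rule hom_ab_abelian[OF mod N])
  have c: "?c i \<in> ab_hom (?H i) (?H (Suc i))" for i by (rule precompose_hom[OF mod mod d])
  let ?Z = "{f \<in> carrier (?H (Suc j)). ?c (Suc j) f = \<zero>\<^bsub>?H (Suc (Suc j))\<^esub>}"
  let ?B = "?c j ` carrier (?H j)"
  have Z: "subgroup ?Z (add_monoid (?H (Suc j)))" by (rule ab_hom_ker_subgroup[OF H H c])
  have B: "subgroup ?B (add_monoid (?H (Suc j)))" by (rule ab_hom_image_subgroup[OF H H c])
  have BZ: "?B \<subseteq> ?Z"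
  proof
    fix f assume "f \<in> ?B"
    then obtain g where g: "g \<in> mod_hom R (?F j) N" "f = ?c j g" by auto
    have "?c (Suc j) f = \<zero>\<^bsub>?H (Suc (Suc j))\<^esub>"
      using linmap_closed[OF d, of _ "Suc j"] linmap_zero[OF mod N mod_hom_linmap[OF g(1)]] g(2)
      by (auto simp: compose_def dd intro!: restrict_ext)
    then show "f \<in> ?Z" using ab_hom_closed[OF c, of g j] g by simp
  qed
  have "Ext R M N (Suc j) = subquotient (?H (Suc j)) ?Z ?B"
    by (simp add: Ext_def)
  then have "trivial_group (Ext R M N (Suc j)) \<longleftrightarrow> ?Z \<subseteq> ?B"
    using subquotient_trivial_iff[OF H Z B BZ] by simp
  also have "\<dots> \<longleftrightarrow> hom_exact R N ?F ?d j"
  proof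
    assume ZB: "?Z \<subseteq> ?B"
    show "hom_exact R N ?F ?d j"
      unfolding hom_exact_def
    proof (intro ballI impI)
      fix f assume f: "f \<in> linmap R (?F (Suc j)) N"
        and z: "\<forall>x\<in>carrier (?F (Suc (Suc j))). f (?d (Suc j) x) = \<zero>\<^bsub>N\<^esub>"
      have "restrict f (carrier (?F (Suc j))) \<in> ?Z"
        using linmap_restrict[OF mod f] z linmap_closed[OF d, of _ "Suc j"]
        by (auto simp: compose_def intro!: restrict_ext)
      then obtain g where g: "g \<in> mod_hom R (?F j) N" "restrict f (carrier (?F (Suc j))) = ?c j g"
        using ZB by auto
      then have "\<forall>x\<in>carrier (?F (Suc j)). f x = g (?d j x)"
        by (metis (no_types, lifting) compose_eq restrict_apply)
      then show "\<exists>g\<in>linmap R (?F j) N. \<forall>x\<in>carrier (?F (Suc j)). f x = g (?d j x)"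
        using g mod_hom_linmap by blast
    qed
  next
    assume ex: "hom_exact R N ?F ?d j"
    show "?Z \<subseteq> ?B"
    proof
      fix f assume "f \<in> ?Z"
      then have f: "f \<in> mod_hom R (?F (Suc j)) N"
        and z: "?c (Suc j) f = \<zero>\<^bsub>?H (Suc (Suc j))\<^esub>" by auto
      have "f (?d (Suc j) x) = \<zero>\<^bsub>N\<^esub>" if "x \<in> carrier (?F (Suc (Suc j)))" for x
        using fun_cong[OF z, of x] that by (simp add: compose_def)
      then obtain g where g: "g \<in> linmap R (?F j) N" "\<forall>x\<in>carrier (?F (Suc j)). f x = g (?d j x)"
        using ex mod_hom_linmap[OF f] unfolding hom_exact_def by blast
      let ?g = "restrict g (carrier (?F j))"
      have g': "?g \<in> mod_hom R (?F j) N" by (rule linmap_restrict[OF mod g(1)])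
      moreover have "f = ?c j ?g"
        using ab_hom_closed[OF c, of ?g j] g g' linmap_closed[OF d, of _ j]
        by (intro mod_hom_eqI[OF f]) (auto simp: compose_def)
      ultimately show "f \<in> ?B" by auto
    qed
  qed
  finally show ?thesis .
qed

lemma Tor_trivial_iff:
  assumes A: "left_module (opp R) A" and M: "left_module R M"
  shows "trivial_group (Tor R A M (Suc j)) \<longleftrightarrow>
    tensor_exact R M (res_mod (opp R) A) (res_diff (opp R) A) j"
proof -
  let ?F = "res_mod (opp R) A" and ?d = "res_diff (opp R) A"
  interpret F: resolution "opp R" A ?F ?d "restrict (res_aug (opp R) A) (carrier (?F 0))"
    by (intro resolution.intro A standard_resolution)
  note mod = F.mod and dd = F.dd
  let ?T = "\<lambda>i. tensor_ab R (?F i) M"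
  let ?D = "\<lambda>i. tensor_map R (?F (Suc i)) (?F i) M (?d i)"
  note d = F.d[simplified]
  have T: "abelian_group (?T i)" for i by (intro tensor_pair.T_ab tensor_pair.intro mod M)
  have D: "?D i \<in> ab_hom (?T (Suc i)) (?T i)" for i by (rule tensor_map_hom[OF mod mod M d])
  let ?Z = "{t \<in> carrier (?T (Suc j)). ?D j t = \<zero>\<^bsub>?T j\<^esub>}"
  let ?B = "?D (Suc j) ` carrier (?T (Suc (Suc j)))"
  have Z: "subgroup ?Z (add_monoid (?T (Suc j)))" by (rule ab_hom_ker_subgroup[OF T T D])
  have B: "subgroup ?B (add_monoid (?T (Suc j)))" by (rule ab_hom_image_subgroup[OF T T D])
  have BZ: "?B \<subseteq> ?Z"
  proof
    fix t assume "t \<in> ?B"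
    then obtain w where w: "w \<in> carrier (?T (Suc (Suc j)))" "t = ?D (Suc j) w" by blast
    have "?D j t = tensor_map R (?F (Suc (Suc j))) (?F j) M (\<lambda>x. ?d j (?d (Suc j) x)) w"
      unfolding w(2) by (rule tensor_map_comp[OF mod mod mod M d[of "Suc j"] d[of j]
            linmap_comp[OF d[of "Suc j"] d[of j]] _ w(1)]) (rule refl)
    also have "\<dots> = \<zero>\<^bsub>?T j\<^esub>"
      by (rule tensor_map_zero[OF mod mod M linmap_comp[OF d[of "Suc j"] d[of j]] dd w(1)])
    finally show "t \<in> ?Z" using ab_hom_closed[OF D w(1)] w(2) by simp
  qed
  have "Tor R A M (Suc j) = subquotient (?T (Suc j)) ?Z ?B"
    by (simp add: Tor_def Let_def)
  then show ?thesis
    using subquotient_trivial_iff[OF T Z B BZ] unfolding tensor_exact_def by auto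
qed

text \<open>Independence of the resolution in the form in which it is used: not an isomorphism of
  Ext groups, but agreement on whether they vanish. The element type of \<open>P\<close> is
  free.\<close>

lemma Ext_trivial_iff_resolution:
  assumes "resolution R M P d e" and N: "left_module R N"
  shows "trivial_group (Ext R M N (Suc j)) \<longleftrightarrow> hom_exact R N P d j"
proof -
  interpret resolution R M P d e by fact
  have std: "resolution R M (res_mod R M) (res_diff R M)
      (restrict (res_aug R M) (carrier (res_mod R M 0)))"
    by (intro resolution.intro M standard_resolution)
  show ?thesis
    unfolding Ext_trivial_iff[OF M N]
    using hom_exact_transfer[OF assms(1) std N] hom_exact_transfer[OF std assms(1) N] by blast
qed

lemma Tor_trivial_iff_resolution:
  assumes "resolution (opp R) A P d e" and M: "left_module R M"
  shows "trivial_group (Tor R A M (Suc j)) \<longleftrightarrow> tensor_exact R M P d j"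
proof -
  note A = resolution.M[OF assms(1)]
  have std: "resolution (opp R) A (res_mod (opp R) A) (res_diff (opp R) A)
      (restrict (res_aug (opp R) A) (carrier (res_mod (opp R) A 0)))"
    by (intro resolution.intro A standard_resolution)
  show ?thesis
    unfolding Tor_trivial_iff[OF A M]
    using tensor_exact_transfer[OF assms(1) std M] tensor_exact_transfer[OF std assms(1) M] by blast
qed

section \<open>Super finitely presented modules\<close>

abbreviation fr :: "('r, 'x) ring_scheme \<Rightarrow> nat \<Rightarrow> ('r, nat \<Rightarrow> 'r) module" where
  "fr R n \<equiv> free_module R {..<n}"

text \<open>Only the carrier is replaced, so the kernel keeps the element type of its source. All
  syzygies inside modules \<open>fr R n\<close> thus share one type.\<close>

abbreviation ker_mod ::
  "('r, 'm, 'y) module_scheme \<Rightarrow> ('r, 'n, 'z) module_scheme \<Rightarrow> ('m \<Rightarrow> 'n) \<Rightarrow> ('r, 'm, 'y) module_scheme"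
  where "ker_mod M N f \<equiv> M\<lparr>carrier := mod_ker M N f\<rparr>"

lemma fin_gen_free_cover:
  assumes M: "left_module R M" and fg: "fin_gen R M"
  shows "\<exists>n. \<exists>q\<in>linmap R (fr R n) M. q ` carrier (fr R n) = carrier M"
proof -
  interpret M: abelian_group M using M by (rule module_abelian)
  interpret R: ring R using M by (rule module_ring)
  obtain A where A: "finite A" "A \<subseteq> carrier M"
    and gen: "\<And>m. m \<in> carrier M \<Longrightarrow> \<exists>a\<in>A \<rightarrow> carrier R. m = (\<Oplus>\<^bsub>M\<^esub>x\<in>A. a x \<odot>\<^bsub>M\<^esub> x)"
    using fg unfolding fin_gen_def by blast
  obtain g n where g: "bij_betw g {..<n::nat} A"
    using ex_bij_betw_nat_finite[OF A(1)] by (auto simp: lessThan_atLeast0)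
  have gM: "\<And>i. i \<in> {..<n} \<Longrightarrow> g i \<in> carrier M" using g A(2) by (auto simp: bij_betw_def)
  let ?q = "free_lift R M g"
  have q: "?q \<in> linmap R (fr R n) M" by (rule free_lift_linmap[OF M gM])
  have "m \<in> ?q ` carrier (fr R n)" if m: "m \<in> carrier M" for m
  proof -
    obtain a where a: "a \<in> A \<rightarrow> carrier R" "m = (\<Oplus>\<^bsub>M\<^esub>x\<in>A. a x \<odot>\<^bsub>M\<^esub> x)" using gen[OF m] by blast
    let ?v = "\<lambda>i. if i < n then a (g i) else \<zero>\<^bsub>R\<^esub>"
    have ag: "a (g i) \<in> carrier R" if "i < n" for i using g a(1) that by (auto simp: bij_betw_def)
    have fin: "finite {i. ?v i \<noteq> \<zero>\<^bsub>R\<^esub>}" by (rule finite_subset[of _ "{..<n}"]) auto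
    have v: "?v \<in> carrier (fr R n)" using ag fin by (auto simp: free_carrier_iff)
    have "?q ?v = (\<Oplus>\<^bsub>M\<^esub>i\<in>{..<n}. ?v i \<odot>\<^bsub>M\<^esub> g i)"
      by (rule free_lift_eq[OF M gM v]) auto
    also have "\<dots> = (\<Oplus>\<^bsub>M\<^esub>i\<in>{..<n}. a (g i) \<odot>\<^bsub>M\<^esub> g i)"
      using ag gM by (intro M.finsum_cong') (auto intro!: left_module.smult_closed[OF M])
    also have "\<dots> = (\<Oplus>\<^bsub>M\<^esub>x\<in>g ` {..<n}. a x \<odot>\<^bsub>M\<^esub> x)"
      using ag gM g
      by (intro M.finsum_reindex[symmetric])
        (auto intro!: left_module.smult_closed[OF M] simp: bij_betw_def)
    finally show ?thesis using v a(2) g by (auto simp: bij_betw_def intro!: image_eqI[of _ _ ?v])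
  qed
  then show ?thesis using q linmap_closed[OF q] by blast
qed

lemma fin_gen_free:
  assumes R: "ring R"
  shows "fin_gen R (fr R n)"
proof -
  let ?F = "fr R n" and ?A = "basis_vec R ` {..<n}"
  note F = free_left_module[OF R, of "{..<n}"]
  interpret R: ring R by fact
  interpret F: abelian_group ?F using F by (rule module_abelian)
  have A: "x \<in> carrier ?F" if "x \<in> ?A" for x using that basis_in_free[OF R, of _ "{..<n}"] by auto
  have cl: "a x \<odot>\<^bsub>?F\<^esub> x \<in> carrier ?F" if "a \<in> ?A \<rightarrow> carrier R" "x \<in> ?A" for a x
    using that A by (intro left_module.smult_closed[OF F]) auto
  have "\<exists>a\<in>?A \<rightarrow> carrier R. m = (\<Oplus>\<^bsub>?F\<^esub>x\<in>?A. a x \<odot>\<^bsub>?F\<^esub> x)" if "m \<in> carrier ?F" for m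
    using R that
  proof (induction m rule: free_induct)
    case zero
    have "(\<Oplus>\<^bsub>?F\<^esub>x\<in>?A. \<zero>\<^bsub>R\<^esub> \<odot>\<^bsub>?F\<^esub> x) = (\<Oplus>\<^bsub>?F\<^esub>x\<in>?A. \<zero>\<^bsub>?F\<^esub>)"
      using smult_zero_left[OF F A] by (intro F.finsum_cong') (auto simp del: free_simps)
    then show ?case by (intro bexI[of _ "\<lambda>_. \<zero>\<^bsub>R\<^esub>"]) (auto simp del: free_simps)
  next
    case (basis r i)
    let ?b = "basis_vec R i"
    \<comment> \<open>Coefficients are indexed by vectors and not by positions, since distinct
      positions can give the same basis vector (over the zero ring).\<close>
    let ?a = "\<lambda>x. if ?b = x then r else \<zero>\<^bsub>R\<^esub>"
    have b: "?b \<in> ?A" using basis by blast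
    have "(\<Oplus>\<^bsub>?F\<^esub>x\<in>?A. ?a x \<odot>\<^bsub>?F\<^esub> x) = (\<Oplus>\<^bsub>?F\<^esub>x\<in>?A. if ?b = x then r \<odot>\<^bsub>?F\<^esub> x else \<zero>\<^bsub>?F\<^esub>)"
      using smult_zero_left[OF F A] left_module.smult_closed[OF F basis(1) A]
      by (intro F.finsum_cong') (auto simp del: free_simps)
    also have "\<dots> = r \<odot>\<^bsub>?F\<^esub> ?b"
      using left_module.smult_closed[OF F basis(1) A]
      by (intro F.finsum_singleton[OF b]) auto
    finally show ?case using basis by (intro bexI[of _ ?a]) (auto simp del: free_simps)
  next
    case (add u v)
    then obtain a a' where a: "a \<in> ?A \<rightarrow> carrier R" "u = (\<Oplus>\<^bsub>?F\<^esub>x\<in>?A. a x \<odot>\<^bsub>?F\<^esub> x)"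
      "a' \<in> ?A \<rightarrow> carrier R" "v = (\<Oplus>\<^bsub>?F\<^esub>x\<in>?A. a' x \<odot>\<^bsub>?F\<^esub> x)" by blast
    let ?a = "\<lambda>x. a x \<oplus>\<^bsub>R\<^esub> a' x"
    have "(\<Oplus>\<^bsub>?F\<^esub>x\<in>?A. ?a x \<odot>\<^bsub>?F\<^esub> x) = (\<Oplus>\<^bsub>?F\<^esub>x\<in>?A. a x \<odot>\<^bsub>?F\<^esub> x \<oplus>\<^bsub>?F\<^esub> a' x \<odot>\<^bsub>?F\<^esub> x)"
    proof (rule F.finsum_cong')
      show "?a x \<odot>\<^bsub>?F\<^esub> x = a x \<odot>\<^bsub>?F\<^esub> x \<oplus>\<^bsub>?F\<^esub> a' x \<odot>\<^bsub>?F\<^esub> x" if "x \<in> ?A" for x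
        using a that by (intro left_module.smult_l_distr[OF F] A) auto
      show "(\<lambda>x. a x \<odot>\<^bsub>?F\<^esub> x \<oplus>\<^bsub>?F\<^esub> a' x \<odot>\<^bsub>?F\<^esub> x) \<in> ?A \<rightarrow> carrier ?F"
        using cl[OF a(1)] cl[OF a(3)] by (intro Pi_I F.a_closed)
    qed simp
    also have "\<dots> = u \<oplus>\<^bsub>?F\<^esub> v"
      unfolding a(2,4) using cl[OF a(1)] cl[OF a(3)] by (intro F.finsum_addf Pi_I)
    finally show ?case using a by (intro bexI[of _ ?a]) auto
  qed
  then show ?thesis
    unfolding fin_gen_def using A by (intro exI[of _ ?A]) auto
qed

lemma sfp_left_module: "super_fin_pres R M \<Longrightarrow> left_module R M"
  by (simp add: super_fin_pres_def)

text \<open>The tail of the resolution, starting in degree k + 1, resolves the image, with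
  \<open>d k\<close> as augmentation.\<close>

lemma sfp_image:
  fixes P :: "nat \<Rightarrow> ('r, nat \<Rightarrow> 'r) module"
  assumes P: "resolution R M P d e" and fg: "\<And>n. fin_gen R (P n)"
  shows "super_fin_pres R ((P k)\<lparr>carrier := d k ` carrier (P (Suc k))\<rparr>)"
proof -
  interpret P: resolution R M P d e by fact
  let ?I = "(P k)\<lparr>carrier := d k ` carrier (P (Suc k))\<rparr>"
  have I: "left_module R ?I" by (rule image_left_module[OF P.mod P.mod P.d])
  have "d k \<in> linmap R (P (Suc k)) ?I" by (rule linmap_into_sub[OF P.d]) simp
  moreover have "d n \<in> extensional (carrier (P (Suc n)))" for n
    using P.res by (simp add: proj_resolution_def mod_hom_iff)
  ultimately have "proj_resolution R ?I (\<lambda>n. P (Suc k + n)) (\<lambda>n. d (Suc k + n)) (d k)"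
    using P.proj P.d P.exS[of "k + _"] P.exS[of k] P.exS[of "Suc (k + _)"]
    by (simp add: proj_resolution_def mod_hom_iff)
  then show ?thesis using I fg unfolding super_fin_pres_def by blast
qed

text \<open>The closure of the super finitely presented submodules and of the kernels of idempotents
  of \<open>R\<^sup>n\<close> under extensions; each member is covered by some \<open>R\<^sup>n\<close> with kernel again in the
  closure, so that all of its members are super finitely presented.\<close>

inductive ext_closure :: "('r, 'x) ring_scheme \<Rightarrow> ('r, nat \<Rightarrow> 'r) module \<Rightarrow> bool" for R where
  base: "super_fin_pres R X \<Longrightarrow> ext_closure R X"
| idem: "\<lbrakk>ring R; f \<in> linmap R (fr R n) (fr R n); \<And>x. x \<in> carrier (fr R n) \<Longrightarrow> f (f x) = f x\<rbrakk> \<Longrightarrow>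
    ext_closure R (ker_mod (fr R n) (fr R n) f)"
| ext: "\<lbrakk>left_module R X; left_module R Y; p \<in> linmap R X Y; p ` carrier X = carrier Y;
    ext_closure R Y; ext_closure R (ker_mod X Y p)\<rbrakk> \<Longrightarrow> ext_closure R X"

text \<open>\<open>X\<close> may have any element type, but the kernel sits inside
  \<open>fr R n\<close>, so a condition on modules of that single type suffices to control all later
  syzygies.\<close>

definition free_pres :: "('r, 'x) ring_scheme \<Rightarrow> ('r, 'm, 'y) module_scheme \<Rightarrow> bool" where
  "free_pres R X \<longleftrightarrow> left_module R X \<and> (\<exists>n. \<exists>q\<in>linmap R (fr R n) X.
     q ` carrier (fr R n) = carrier X \<and> ext_closure R (ker_mod (fr R n) X q))"

text \<open>Cover \<open>P 0\<close> by \<open>u\<close> from some \<open>R^n\<close>, split by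
  \<open>s\<close> since \<open>P 0\<close> is projective. Then \<open>u\<close> maps the kernel of
  \<open>e u\<close> onto the kernel of \<open>e\<close>, which is super finitely presented by
  truncation, and what it kills is the kernel of the idempotent \<open>s u\<close>. This extension
  is the origin of the rules \<open>idem\<close> and \<open>ext\<close>.\<close>

lemma sfp_free_pres:
  assumes "super_fin_pres R X"
  shows "free_pres R X"
proof -
  obtain P :: "nat \<Rightarrow> ('a, nat \<Rightarrow> 'a) module" and d e
    where P: "proj_resolution R X P d e" and fg: "\<And>n. fin_gen R (P n)" and X: "left_module R X"
    using assms unfolding super_fin_pres_def by blast
  interpret P: resolution R X P d e by (rule resolution.intro[OF X P])
  have R: "ring R" using X by (rule module_ring)
  obtain n u where u: "u \<in> linmap R (fr R n) (P 0)" "u ` carrier (fr R n) = carrier (P 0)"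
    using fin_gen_free_cover[OF P.mod fg] by blast
  let ?F = "fr R n"
  note F = free_left_module[OF R, of "{..<n}"]
  have "(\<lambda>x. x) ` carrier (P 0) \<subseteq> u ` carrier ?F" using u(2) by simp
  then obtain s where s: "s \<in> linmap R (P 0) ?F" "\<And>x. x \<in> carrier (P 0) \<Longrightarrow> u (s x) = x"
    using projective_lift[OF P.proj F P.mod linmap_id u(1)] by blast
  let ?q = "\<lambda>x. e (u x)"
  have q: "?q \<in> linmap R ?F X" by (rule linmap_comp[OF u(1) P.e])
  have qs: "?q ` carrier ?F = carrier X" using P.e_surj u(2) by (simp flip: image_image)
  let ?K = "ker_mod (P 0) X e"
  have "?K = (P 0)\<lparr>carrier := d 0 ` carrier (P (Suc 0))\<rparr>" by (simp add: P.ex0)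
  then have K: "super_fin_pres R ?K" using sfp_image[OF P.resolution_axioms fg, of 0] by simp
  let ?X = "ker_mod ?F X ?q"
  have 1: "left_module R ?X" by (rule ker_left_module[OF F X q])
  have 2: "u \<in> linmap R ?X ?K"
    using linmap_closed[OF u(1)]
    by (intro linmap_into_sub linmap_from_sub u) (auto simp: mod_ker_def)
  have 3: "u ` carrier ?X = carrier ?K"
    using u(2) linmap_closed[OF u(1)] by (auto simp: mod_ker_def image_iff)
  have "mod_ker ?X ?K u = mod_ker ?F ?F (\<lambda>x. s (u x))"
  proof (rule Set.set_eqI)
    fix x
    have "u x = \<zero>\<^bsub>P 0\<^esub> \<longleftrightarrow> s (u x) = \<zero>\<^bsub>?F\<^esub>" if "x \<in> carrier ?F"
      using s(2)[OF linmap_closed[OF u(1) that]] linmap_zero[OF P.mod F s(1)]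
        linmap_zero[OF F P.mod u(1)] by metis
    then show "x \<in> mod_ker ?X ?K u \<longleftrightarrow> x \<in> mod_ker ?F ?F (\<lambda>x. s (u x))"
      using linmap_zero[OF P.mod X P.e] by (auto simp: mod_ker_def)
  qed
  then have "ker_mod ?X ?K u = ker_mod ?F ?F (\<lambda>x. s (u x))" by simp
  moreover have "ext_closure R (ker_mod ?F ?F (\<lambda>x. s (u x)))"
    by (rule ext_closure.idem[OF R linmap_comp[OF u(1) s(1)]])
      (simp add: s(2) linmap_closed[OF u(1)])
  ultimately have "ext_closure R ?X"
    using ext_closure.ext[OF 1 sfp_left_module[OF K] 2 3 ext_closure.base[OF K]] by simp
  then show ?thesis unfolding free_pres_def using X q qs by blast
qed

text \<open>The first step of the horseshoe construction: a cover of the kernel and a lift of a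
  cover of \<open>Y\<close> combine to a cover of \<open>X\<close> by \<open>R^(a+b)\<close>, whose
  kernel is an extension of the kernel of \<open>v\<close> by the kernel of
  \<open>u\<close>.\<close>

lemma free_pres_extension:
  assumes X: "left_module R X" and Y: "free_pres R Y" and p: "p \<in> linmap R X Y"
    and surj: "p ` carrier X = carrier Y" and L: "free_pres R (ker_mod X Y p)"
  shows "free_pres R X"
proof -
  have Ym: "left_module R Y" using Y by (simp add: free_pres_def)
  interpret R: ring R using X by (rule module_ring)
  interpret X: abelian_group X using X by (rule module_abelian)
  interpret Y: abelian_group Y using Ym by (rule module_abelian)
  note F = free_left_module[OF R.ring_axioms]
  obtain a u where u: "u \<in> linmap R (fr R a) (ker_mod X Y p)"
    and us: "u ` carrier (fr R a) = mod_ker X Y p"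
    and uK: "ext_closure R (ker_mod (fr R a) (ker_mod X Y p) u)"
    using L unfolding free_pres_def by auto
  obtain b v where v: "v \<in> linmap R (fr R b) Y" and vs: "v ` carrier (fr R b) = carrier Y"
    and vK: "ext_closure R (ker_mod (fr R b) Y v)"
    using Y unfolding free_pres_def by auto
  have uX: "u \<in> linmap R (fr R a) X"
    by (rule linmap_out_of_sub[OF u]) (auto simp: mod_ker_def)
  have pu: "p (u x) = \<zero>\<^bsub>Y\<^esub>" if "x \<in> carrier (fr R a)" for x
    using us that by (auto simp: mod_ker_def)
  have "v ` carrier (fr R b) \<subseteq> p ` carrier X" using vs surj by simp
  then obtain l where l: "l \<in> linmap R (fr R b) X" "\<And>x. x \<in> carrier (fr R b) \<Longrightarrow> p (l x) = v x"
    using projective_lift[OF free_projective[OF R.ring_axioms] X Ym v p] by blast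
  let ?F = "fr R (a + b)"
  \<comment> \<open>\<open>R^(a+b)\<close> is split as \<open>R^a\<close> plus \<open>R^b\<close>
    inside functions on the naturals: \<open>tr\<close> keeps the first a coordinates,
    \<open>sh\<close> moves the others down by a, and \<open>glue\<close> reassembles them.\<close>
  define tr where "tr w = (\<lambda>i. if i < a then w i else \<zero>\<^bsub>R\<^esub>)" for w :: "nat \<Rightarrow> 'a"
  define sh where "sh w = (\<lambda>i. w (i + a))" for w :: "nat \<Rightarrow> 'a"
  define glue where "glue x y = (\<lambda>i. if i < a then x i else y (i - a))" for x y :: "nat \<Rightarrow> 'a"
  have fin: "finite {i. f i \<noteq> \<zero>\<^bsub>R\<^esub>}" if "\<And>i. i \<ge> k \<Longrightarrow> f i = \<zero>\<^bsub>R\<^esub>" for f :: "nat \<Rightarrow> 'a" and k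
    by (rule finite_subset[of _ "{..<k}"]) (use that not_less in auto)
  have fr_iff: "f \<in> carrier (fr R k) \<longleftrightarrow> (\<forall>i. f i \<in> carrier R) \<and> (\<forall>i\<ge>k. f i = \<zero>\<^bsub>R\<^esub>)" for f k
    using fin[of k f] by (auto simp: free_carrier_iff not_less)
  have tr: "tr \<in> linmap R ?F (fr R a)"
    by (rule linmapI) (auto simp: fr_iff tr_def)
  have sh: "sh \<in> linmap R ?F (fr R b)"
    by (rule linmapI) (auto simp: fr_iff sh_def)
  have glue: "glue x y \<in> carrier ?F" "tr (glue x y) = x" "sh (glue x y) = y"
    if "x \<in> carrier (fr R a)" "y \<in> carrier (fr R b)" for x y
    using that by (auto simp: fr_iff glue_def tr_def sh_def)
  let ?q = "\<lambda>w. u (tr w) \<oplus>\<^bsub>X\<^esub> l (sh w)"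
  have q: "?q \<in> linmap R ?F X" by (intro linmap_plus X linmap_comp[OF tr uX] linmap_comp[OF sh l(1)])
  have lift: "\<exists>x\<in>carrier (fr R a). u x \<oplus>\<^bsub>X\<^esub> l y = z"
    if "z \<in> carrier X" "y \<in> carrier (fr R b)" "p z = v y" for y z
  proof -
    have ly: "l y \<in> carrier X" using that linmap_closed[OF l(1)] by blast
    then have "z \<ominus>\<^bsub>X\<^esub> l y \<in> mod_ker X Y p"
      using that l(2) linmap_eq_iff_ker[OF X Ym p, of z "l y"] by simp
    then obtain x where "x \<in> carrier (fr R a)" "z \<ominus>\<^bsub>X\<^esub> l y = u x" using us by force
    then show ?thesis using X.minus_add_cancel[OF that(1) ly] by metis
  qed
  have qs: "?q ` carrier ?F = carrier X"
  proof
    show "?q ` carrier ?F \<subseteq> carrier X" using linmap_closed[OF q] by blast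
    show "carrier X \<subseteq> ?q ` carrier ?F"
    proof
      fix z assume z: "z \<in> carrier X"
      then have "p z \<in> v ` carrier (fr R b)" using vs linmap_closed[OF p] by simp
      then obtain y where y: "y \<in> carrier (fr R b)" "p z = v y" by blast
      obtain x where x: "x \<in> carrier (fr R a)" "u x \<oplus>\<^bsub>X\<^esub> l y = z" using lift[OF z y] by blast
      then show "z \<in> ?q ` carrier ?F"
        using glue[OF x(1) y(1)] by (intro image_eqI[of _ _ "glue x y"]) simp_all
    qed
  qed
  let ?K = "ker_mod ?F X ?q" and ?KY = "ker_mod (fr R b) Y v"
  have pq: "p (?q w) = v (sh w)" if "w \<in> carrier ?F" for w
    using linmap_closed[OF tr that] linmap_closed[OF sh that] linmap_closed[OF uX] linmap_closed[OF l(1)]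
      linmap_closed[OF v]
    by (simp add: linmap_add[OF p] pu l(2))
  have p0: "p \<zero>\<^bsub>X\<^esub> = \<zero>\<^bsub>Y\<^esub>" by (rule linmap_zero[OF X Ym p])
  have 1: "left_module R ?K" by (rule ker_left_module[OF F X q])
  have 2: "left_module R ?KY" by (rule ker_left_module[OF F Ym v])
  have shK: "sh w \<in> mod_ker (fr R b) Y v" if "w \<in> mod_ker ?F X ?q" for w
    using that pq[of w] p0 linmap_closed[OF sh] by (simp add: mod_ker_def)
  have 3: "sh \<in> linmap R ?K ?KY"
    by (intro linmap_into_sub linmap_from_sub sh) (use shK in \<open>auto simp: mod_ker_def\<close>)
  have 4: "sh ` carrier ?K = carrier ?KY"
  proof
    show "sh ` carrier ?K \<subseteq> carrier ?KY" using shK by auto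
    show "carrier ?KY \<subseteq> sh ` carrier ?K"
    proof
      fix y assume "y \<in> carrier ?KY"
      then have y: "y \<in> carrier (fr R b)" "p \<zero>\<^bsub>X\<^esub> = v y" using p0 by (auto simp: mod_ker_def)
      obtain x where x: "x \<in> carrier (fr R a)" "u x \<oplus>\<^bsub>X\<^esub> l y = \<zero>\<^bsub>X\<^esub>"
        using lift[OF X.zero_closed y] by blast
      then show "y \<in> sh ` carrier ?K"
        using glue[OF x(1) y(1)] by (intro image_eqI[of _ _ "glue x y"]) (simp_all add: mod_ker_def)
    qed
  qed
  \<comment> \<open>An equality of sets and not merely an isomorphism: a vector whose coordinates
    from a onwards vanish already is an element of \<open>fr R a\<close>. So the hypothesis on the
    kernel of \<open>u\<close> applies literally.\<close>
  have "mod_ker ?K ?KY sh = mod_ker (fr R a) (ker_mod X Y p) u"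
  proof (rule Set.set_eqI)
    fix w
    have l0: "l \<zero>\<^bsub>fr R b\<^esub> = \<zero>\<^bsub>X\<^esub>" by (rule linmap_zero[OF F X l(1)])
    show "w \<in> mod_ker ?K ?KY sh \<longleftrightarrow> w \<in> mod_ker (fr R a) (ker_mod X Y p) u"
    proof
      assume "w \<in> mod_ker ?K ?KY sh"
      then have w: "w \<in> carrier ?F" "?q w = \<zero>\<^bsub>X\<^esub>" "sh w = \<zero>\<^bsub>fr R b\<^esub>" by (auto simp: mod_ker_def)
      have "w i = \<zero>\<^bsub>R\<^esub>" if "i \<ge> a" for i
        using fun_cong[OF w(3), of "i - a"] that by (simp add: sh_def)
      then have wa: "w \<in> carrier (fr R a)" using w(1) by (simp add: fr_iff)
      moreover from this have "tr w = w" by (auto simp: tr_def fr_iff)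
      ultimately show "w \<in> mod_ker (fr R a) (ker_mod X Y p) u"
        using w l0 linmap_closed[OF uX wa] by (simp add: mod_ker_def)
    next
      assume "w \<in> mod_ker (fr R a) (ker_mod X Y p) u"
      then have w: "w \<in> carrier (fr R a)" "u w = \<zero>\<^bsub>X\<^esub>" by (simp_all add: mod_ker_def)
      have "w \<in> carrier ?F" "tr w = w" "sh w = \<zero>\<^bsub>fr R b\<^esub>" using w(1) by (auto simp: fr_iff tr_def sh_def)
      then show "w \<in> mod_ker ?K ?KY sh" using w l0 by (simp add: mod_ker_def)
    qed
  qed
  then have "ker_mod ?K ?KY sh = ker_mod (fr R a) (ker_mod X Y p) u"
    by (simp add: free_module_def)
  then have "ext_closure R ?K" using ext_closure.ext[OF 1 2 3 4 vK] uK by simp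
  then show ?thesis unfolding free_pres_def using X q qs by blast
qed

lemma ext_closure_free_pres: "ext_closure R X \<Longrightarrow> free_pres R X"
proof (induction rule: ext_closure.induct)
  case (base X)
  then show ?case by (rule sfp_free_pres)
next
  case (ext X Y p)
  then show ?case by (intro free_pres_extension[of R X Y p])
next
  case (idem f n)
  \<comment> \<open>The kernel of the idempotent \<open>f\<close> is the image of 1 - f. This
    covering map is itself idempotent, so its kernel is again of the form provided by
    \<open>idem\<close>.\<close>
  let ?F = "fr R n" and ?q = "\<lambda>x. x \<ominus>\<^bsub>fr R n\<^esub> f x"
  note F = free_left_module[OF idem(1), of "{..<n}"] and f = idem(2)
  interpret F: abelian_group ?F using F by (rule module_abelian)
  have q: "?q \<in> linmap R ?F ?F" by (rule linmap_diff[OF F linmap_id f])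
  have fq: "f (?q x) = \<zero>\<^bsub>?F\<^esub>" if "x \<in> carrier ?F" for x
    using that linmap_closed[OF f that] idem(3)[OF that] F.minus_zero_iff[of "f x" "f x"]
    by (simp add: linmap_minus[OF F F f] del: free_simps)
  have fix_ker: "?q x = x" if "x \<in> carrier ?F" "f x = \<zero>\<^bsub>?F\<^esub>" for x
    using that F.add_minus_cancel[of x "\<zero>\<^bsub>?F\<^esub>"] by (simp add: F.r_zero del: free_simps)
  have im: "?q ` carrier ?F = mod_ker ?F ?F f"
  proof
    show "?q ` carrier ?F \<subseteq> mod_ker ?F ?F f"
      using fq linmap_closed[OF q] by (auto simp: mod_ker_def simp del: free_simps)
    show "mod_ker ?F ?F f \<subseteq> ?q ` carrier ?F"
      using fix_ker by (force simp: mod_ker_def simp del: free_simps)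
  qed
  have qq: "?q (?q x) = ?q x" if "x \<in> carrier ?F" for x
    by (rule fix_ker[OF linmap_closed[OF q that] fq[OF that]])
  let ?K = "ker_mod ?F ?F f"
  have "?q \<in> linmap R ?F ?K" using im by (intro linmap_into_sub[OF q]) simp
  moreover have "?q ` carrier ?F = carrier ?K" using im by simp
  moreover have "ext_closure R (ker_mod ?F ?K ?q)"
    using ext_closure.idem[OF idem(1) q qq] by simp
  ultimately show ?case
    unfolding free_pres_def using ker_left_module[OF F F f] by blast
qed

text \<open>A cover \<open>q Y\<close> by \<open>R^(m Y)\<close> is chosen for all members of the
  closure at once and iterated on kernels. The iteration is an ordinary recursion because the
  kernels \<open>Z i\<close> all have one type.\<close>

lemma free_pres_free_resolution:
  fixes R :: "('r, 'x) ring_scheme"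
  assumes X: "free_pres R X"
  shows "\<exists>k d e. proj_resolution R X (\<lambda>i. fr R (k i)) d e"
proof -
  have Xm: "left_module R X" using X by (simp add: free_pres_def)
  have R: "ring R" using Xm by (rule module_ring)
  obtain n e where e: "e \<in> linmap R (fr R n) X" "e ` carrier (fr R n) = carrier X"
    "ext_closure R (ker_mod (fr R n) X e)"
    using X unfolding free_pres_def by blast
  have "\<forall>Y. \<exists>m q. ext_closure R Y \<longrightarrow> q \<in> linmap R (fr R m) Y \<and> q ` carrier (fr R m) = carrier Y \<and>
      ext_closure R (ker_mod (fr R m) Y q)"
    using ext_closure_free_pres[of R] unfolding free_pres_def by blast
  then obtain m q where mq: "\<And>Y. ext_closure R Y \<Longrightarrow> q Y \<in> linmap R (fr R (m Y)) Y"
    "\<And>Y. ext_closure R Y \<Longrightarrow> q Y ` carrier (fr R (m Y)) = carrier Y"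
    "\<And>Y. ext_closure R Y \<Longrightarrow> ext_closure R (ker_mod (fr R (m Y)) Y (q Y))"
    by metis
  define Z where "Z = rec_nat (ker_mod (fr R n) X e) (\<lambda>_ Y. ker_mod (fr R (m Y)) Y (q Y))"
  have Z0: "Z 0 = ker_mod (fr R n) X e" and ZS: "Z (Suc i) = ker_mod (fr R (m (Z i))) (Z i) (q (Z i))" for i
    by (simp_all add: Z_def)
  have Z: "ext_closure R (Z i)" for i by (induction i) (simp_all add: Z0 ZS e mq)
  define k where "k = case_nat n (\<lambda>i. m (Z i))"
  have k: "k 0 = n" "\<And>i. k (Suc i) = m (Z i)" by (simp_all add: k_def)
  let ?P = "\<lambda>i. fr R (k i)"
  let ?d = "\<lambda>i. restrict (q (Z i)) (carrier (?P (Suc i)))"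
  \<comment> \<open>\<open>Z i\<close> shares zero and operations with the term \<open>P i\<close>
    that contains it, so a map into \<open>Z i\<close> is linear into \<open>P i\<close> with the
    same kernel.\<close>
  have Zsub: "\<exists>Y. Z i = (?P i)\<lparr>carrier := Y\<rparr> \<and> Y \<subseteq> carrier (?P i)" for i
    by (cases i) (auto simp: Z0 ZS k mod_ker_def)
  have d: "q (Z i) \<in> linmap R (?P (Suc i)) (?P i)" for i
    using Zsub[of i] mq(1)[OF Z, of i] linmap_out_of_sub unfolding k by metis
  have ker: "mod_ker (?P (Suc i)) (Z i) f = mod_ker (?P (Suc i)) (?P i) f" for i f
    using Zsub[of i] by (metis mod_ker_sub)
  have "proj_resolution R X ?P ?d (restrict e (carrier (?P 0)))"
    unfolding proj_resolution_def
  proof (intro conjI allI)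
    fix i
    show "projective R (?P i)" by (rule free_projective[OF R])
    show "?d i \<in> mod_hom R (?P (Suc i)) (?P i)" by (rule linmap_restrict[OF free_left_module[OF R] d])
    have "?d (Suc i) ` carrier (?P (Suc (Suc i))) = carrier (Z (Suc i))"
      using mq(2)[OF Z, of "Suc i"] by (simp add: k)
    also have "\<dots> = mod_ker (?P (Suc i)) (Z i) (q (Z i))" by (simp add: ZS k)
    also have "\<dots> = mod_ker (?P (Suc i)) (?P i) (?d i)" unfolding ker by (auto simp: mod_ker_def)
    finally show "?d (Suc i) ` carrier (?P (Suc (Suc i))) = mod_ker (?P (Suc i)) (?P i) (?d i)" .
  next
    show "restrict e (carrier (?P 0)) \<in> mod_hom R (?P 0) X"
      using e linmap_restrict[OF free_left_module[OF R]] by (simp add: k)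
    show "restrict e (carrier (?P 0)) ` carrier (?P 0) = carrier X" using e by (simp add: k)
    have "?d 0 ` carrier (?P (Suc 0)) = carrier (Z 0)"
      using mq(2)[OF Z, of 0] by (simp add: k)
    also have "\<dots> = mod_ker (?P 0) X (restrict e (carrier (?P 0)))"
      by (auto simp: Z0 k mod_ker_def)
    finally show "?d 0 ` carrier (?P (Suc 0)) = mod_ker (?P 0) X (restrict e (carrier (?P 0)))" .
  qed
  then show ?thesis by blast
qed

lemma sfp_iff_free_pres: "super_fin_pres R X \<longleftrightarrow> free_pres R X"
proof
  assume X: "free_pres R X"
  then have "left_module R X" by (simp add: free_pres_def)
  moreover obtain k d e where "proj_resolution R X (\<lambda>i. fr R (k i)) d e"
    using free_pres_free_resolution[OF X] by blast
  ultimately show "super_fin_pres R X"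
    unfolding super_fin_pres_def using fin_gen_free[OF module_ring] by blast
qed (rule sfp_free_pres)

lemma ext_closure_iff_sfp: "ext_closure R X \<longleftrightarrow> super_fin_pres R X"
  using ext_closure_free_pres ext_closure.base sfp_iff_free_pres by blast

section \<open>Closure properties of super finitely presented modules\<close>

lemma sfp_extension:
  assumes "left_module R X" "super_fin_pres R Y" "p \<in> linmap R X Y" "p ` carrier X = carrier Y"
    "super_fin_pres R (ker_mod X Y p)"
  shows "super_fin_pres R X"
  using assms free_pres_extension unfolding sfp_iff_free_pres by blast

lemma sfp_iso:
  assumes X: "super_fin_pres R X" and Y: "left_module R Y" and f: "f \<in> linmap R X Y"
    and bij: "bij_betw f (carrier X) (carrier Y)"
  shows "super_fin_pres R Y"
proof -
  note Xm = sfp_left_module[OF X]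
  interpret X: abelian_group X using Xm by (rule module_abelian)
  obtain n q where q: "q \<in> linmap R (fr R n) X" "q ` carrier (fr R n) = carrier X"
    "ext_closure R (ker_mod (fr R n) X q)"
    using X unfolding sfp_iff_free_pres free_pres_def by blast
  have "f (q x) = \<zero>\<^bsub>Y\<^esub> \<longleftrightarrow> q x = \<zero>\<^bsub>X\<^esub>" if "x \<in> carrier (fr R n)" for x
    using linmap_zero[OF Xm Y f] bij linmap_closed[OF q(1) that] X.zero_closed
    unfolding bij_betw_def inj_on_def by metis
  then have "mod_ker (fr R n) Y (\<lambda>x. f (q x)) = mod_ker (fr R n) X q"
    by (auto simp: mod_ker_def)
  moreover have "(\<lambda>x. f (q x)) ` carrier (fr R n) = carrier Y"
    using q(2) bij by (simp add: bij_betw_def flip: image_image)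
  ultimately have "free_pres R Y"
    unfolding free_pres_def using Y linmap_comp[OF q(1) f] q(3)
    by (intro conjI exI[of _ n] bexI[of _ "\<lambda>x. f (q x)"]) simp_all
  then show ?thesis by (simp add: sfp_iff_free_pres)
qed

text \<open>Pulled back to a cover of \<open>B\<close>, the kernel of \<open>R^n -> D\<close> is an
  extension of the kernel of \<open>p\<close> by the kernel of \<open>q\<close>. This is the closure
  property that propagates finiteness forward along the dual complex.\<close>

lemma sfp_cokernel:
  assumes B: "super_fin_pres R B" and D: "left_module R D" and p: "p \<in> linmap R B D"
    and surj: "p ` carrier B = carrier D" and K: "super_fin_pres R (ker_mod B D p)"
  shows "super_fin_pres R D"
proof -
  note Bm = sfp_left_module[OF B]
  note F = free_left_module[OF module_ring[OF Bm]]
  obtain n q where q: "q \<in> linmap R (fr R n) B" and qs: "q ` carrier (fr R n) = carrier B"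
    and qK: "ext_closure R (ker_mod (fr R n) B q)"
    using B unfolding sfp_iff_free_pres free_pres_def by blast
  let ?r = "\<lambda>x. p (q x)"
  have r: "?r \<in> linmap R (fr R n) D" by (rule linmap_comp[OF q p])
  have rs: "?r ` carrier (fr R n) = carrier D" using qs surj by (simp flip: image_image)
  let ?K = "ker_mod (fr R n) D ?r" and ?A = "ker_mod B D p"
  have 1: "left_module R ?K" by (rule ker_left_module[OF F D r])
  have 2: "q \<in> linmap R ?K ?A"
    using linmap_closed[OF q] by (intro linmap_into_sub linmap_from_sub q) (auto simp: mod_ker_def)
  have 3: "q ` carrier ?K = carrier ?A"
    using qs linmap_closed[OF q] by (auto simp: mod_ker_def image_iff)
  have "mod_ker ?K ?A q = mod_ker (fr R n) B q"
    using linmap_zero[OF Bm D p] by (auto simp: mod_ker_def)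
  then have "super_fin_pres R (ker_mod ?K ?A q)" using qK by (simp add: ext_closure_iff_sfp)
  then have "super_fin_pres R ?K" by (rule sfp_extension[OF 1 K 2 3])
  then have "ext_closure R ?K" by (rule ext_closure.base)
  then show ?thesis
    unfolding sfp_iff_free_pres free_pres_def using D r rs
    by (intro conjI exI[of _ n] bexI[of _ ?r])
qed

text \<open>The identity serves as cover; being idempotent, it has its kernel in the
  closure.\<close>

lemma sfp_free:
  assumes R: "ring R"
  shows "super_fin_pres R (fr R n)"
proof -
  note F = free_left_module[OF R, of "{..<n}"]
  have "ext_closure R (ker_mod (fr R n) (fr R n) (\<lambda>x. x))"
    by (rule ext_closure.idem[OF R linmap_id refl])
  then show ?thesis
    unfolding sfp_iff_free_pres free_pres_def using F linmap_id[of R "fr R n"]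
    by (intro conjI exI[of _ n] bexI[of _ "\<lambda>x. x"]) simp_all
qed

lemma sfp_free_resolution:
  assumes "super_fin_pres R X"
  obtains k d e where "resolution R X (\<lambda>i. fr R (k i)) d e"
  using free_pres_free_resolution[of R X] assms sfp_left_module[OF assms]
  unfolding sfp_iff_free_pres by (auto intro: resolution.intro)

section \<open>Finite powers of a module\<close>

definition pow_mod :: "('r, 'm, 'y) module_scheme \<Rightarrow> nat \<Rightarrow> ('r, nat \<Rightarrow> 'm) module" where
  "pow_mod M n = \<lparr>carrier = {f. (\<forall>i. f i \<in> carrier M) \<and> (\<forall>i\<ge>n. f i = \<zero>\<^bsub>M\<^esub>)},
     monoid.mult = undefined, one = undefined, ring.zero = (\<lambda>_. \<zero>\<^bsub>M\<^esub>),
     ring.add = (\<lambda>f g i. f i \<oplus>\<^bsub>M\<^esub> g i), smult = (\<lambda>a f i. a \<odot>\<^bsub>M\<^esub> f i)\<rparr>"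

lemma pow_mod_simps [simp]:
  "carrier (pow_mod M n) = {f. (\<forall>i. f i \<in> carrier M) \<and> (\<forall>i\<ge>n. f i = \<zero>\<^bsub>M\<^esub>)}"
  "\<zero>\<^bsub>pow_mod M n\<^esub> = (\<lambda>_. \<zero>\<^bsub>M\<^esub>)"
  "f \<oplus>\<^bsub>pow_mod M n\<^esub> g = (\<lambda>i. f i \<oplus>\<^bsub>M\<^esub> g i)"
  "a \<odot>\<^bsub>pow_mod M n\<^esub> f = (\<lambda>i. a \<odot>\<^bsub>M\<^esub> f i)"
  by (simp_all add: pow_mod_def)

lemma pow_left_module:
  assumes M: "left_module R M"
  shows "left_module R (pow_mod M n)"
proof -
  interpret M: abelian_group M using M by (rule module_abelian)
  show ?thesis
  proof (intro left_moduleI abelian_groupI)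
    fix f assume "f \<in> carrier (pow_mod M n)"
    then show "\<exists>g\<in>carrier (pow_mod M n). g \<oplus>\<^bsub>pow_mod M n\<^esub> f = \<zero>\<^bsub>pow_mod M n\<^esub>"
      by (intro bexI[of _ "\<lambda>i. \<ominus>\<^bsub>M\<^esub> f i"]) (auto simp: M.l_neg)
  qed (use M in \<open>auto simp: module_ring smult_zero_right left_module.smult_closed
        left_module.smult_l_distr left_module.smult_r_distr left_module.smult_assoc1
        left_module.smult_one M.a_ac\<close>)
qed

text \<open>With powers encoded as functions vanishing from n on, the kernel of the last coordinate
  on the power n + 1 literally is the power n, and extensions give the induction step.\<close>

lemma sfp_pow:
  assumes M: "super_fin_pres R M"
  shows "super_fin_pres R (pow_mod M n)"
proof (induction n)
  note Mm = sfp_left_module[OF M]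
  interpret M: abelian_group M using Mm by (rule module_abelian)
  case 0
  let ?z = "\<lambda>_::nat \<Rightarrow> 'a. \<lambda>_::nat. \<zero>\<^bsub>M\<^esub>"
  have "carrier (fr R 0) = {\<zero>\<^bsub>fr R 0\<^esub>}"
    using abelian_groupE(2)[OF module_abelian[OF free_left_module[OF module_ring[OF Mm]]], of "{..<0::nat}"]
    by (auto simp: free_carrier_iff)
  moreover have "carrier (pow_mod M 0) = {\<lambda>_. \<zero>\<^bsub>M\<^esub>}" by auto
  ultimately have "bij_betw ?z (carrier (fr R 0)) (carrier (pow_mod M 0))"
    by (simp add: bij_betw_def)
  moreover have "?z \<in> linmap R (fr R 0) (pow_mod M 0)"
    using linmap_const_zero[OF pow_left_module[OF Mm, of 0]] by simp
  ultimately show ?case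
    using sfp_iso[OF sfp_free[OF module_ring[OF Mm]] pow_left_module[OF Mm]] by blast
next
  note Mm = sfp_left_module[OF M]
  interpret M: abelian_group M using Mm by (rule module_abelian)
  case (Suc n)
  let ?p = "\<lambda>f. f n"
  have p: "?p \<in> linmap R (pow_mod M (Suc n)) M" by (rule linmapI) auto
  have surj: "?p ` carrier (pow_mod M (Suc n)) = carrier M"
  proof
    show "carrier M \<subseteq> ?p ` carrier (pow_mod M (Suc n))"
    proof
      fix x assume "x \<in> carrier M"
      then show "x \<in> ?p ` carrier (pow_mod M (Suc n))"
        by (intro image_eqI[of _ _ "\<lambda>i. if i = n then x else \<zero>\<^bsub>M\<^esub>"]) auto
    qed
  qed auto
  have "mod_ker (pow_mod M (Suc n)) M ?p = carrier (pow_mod M n)"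
    by (auto simp: mod_ker_def) (metis Suc_leI le_antisym not_le)
  then have "ker_mod (pow_mod M (Suc n)) M ?p = pow_mod M n" by (simp add: pow_mod_def)
  then show ?case using sfp_extension[OF pow_left_module[OF Mm] M p surj] Suc by simp
qed

section \<open>Weak injective and weak flat modules\<close>

definition transport :: "('m \<Rightarrow> 'n) \<Rightarrow> ('r, 'm, 'y) module_scheme \<Rightarrow> ('r, 'n) module" where
  "transport h M = (let c = inv_into (carrier M) h in
     \<lparr>carrier = h ` carrier M, monoid.mult = undefined, one = undefined, ring.zero = h \<zero>\<^bsub>M\<^esub>,
      ring.add = (\<lambda>x y. h (c x \<oplus>\<^bsub>M\<^esub> c y)), smult = (\<lambda>a x. h (a \<odot>\<^bsub>M\<^esub> c x))\<rparr>)"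

lemma transport:
  assumes M: "left_module R M" and inj: "inj_on h (carrier M)"
  shows "left_module R (transport h M)" and "h \<in> linmap R M (transport h M)"
    and "bij_betw h (carrier M) (carrier (transport h M))"
proof -
  interpret M: abelian_group M using M by (rule module_abelian)
  let ?T = "transport h M"
  note [simp] = inv_into_f_f[OF inj] left_module.smult_closed[OF M]
  have T: "carrier ?T = h ` carrier M" "\<zero>\<^bsub>?T\<^esub> = h \<zero>\<^bsub>M\<^esub>"
    "\<And>x y. \<lbrakk>x \<in> carrier M; y \<in> carrier M\<rbrakk> \<Longrightarrow> h x \<oplus>\<^bsub>?T\<^esub> h y = h (x \<oplus>\<^bsub>M\<^esub> y)"
    "\<And>a x. x \<in> carrier M \<Longrightarrow> a \<odot>\<^bsub>?T\<^esub> h x = h (a \<odot>\<^bsub>M\<^esub> x)"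
    by (simp_all add: transport_def Let_def)
  show "left_module R ?T"
  proof (intro left_moduleI abelian_groupI)
    fix x assume "x \<in> carrier ?T"
    then obtain u where "u \<in> carrier M" "x = h u" by (auto simp: T)
    then show "\<exists>y\<in>carrier ?T. y \<oplus>\<^bsub>?T\<^esub> x = \<zero>\<^bsub>?T\<^esub>"
      by (intro bexI[of _ "h (\<ominus>\<^bsub>M\<^esub> u)"]) (auto simp: T M.l_neg)
  qed (use M in \<open>auto simp: T module_ring M.a_ac left_module.smult_l_distr left_module.smult_r_distr
        left_module.smult_assoc1 left_module.smult_one\<close>)
  show "h \<in> linmap R M ?T" by (rule linmapI) (auto simp: T)
  show "bij_betw h (carrier M) (carrier ?T)" using inj by (simp add: T bij_betw_def)
qed

lemma linmap_inv:
  assumes M: "left_module R M" and N: "left_module R N" and f: "f \<in> linmap R M N"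
    and bij: "bij_betw f (carrier M) (carrier N)"
  shows "inv_into (carrier M) f \<in> linmap R N M"
    and "bij_betw (inv_into (carrier M) f) (carrier N) (carrier M)"
proof -
  interpret M: abelian_group M using M by (rule module_abelian)
  have inj: "inj_on f (carrier M)" and im: "f ` carrier M = carrier N"
    using bij by (auto simp: bij_betw_def)
  note [simp] = inv_into_f_f[OF inj]
  show "inv_into (carrier M) f \<in> linmap R N M"
    by (rule linmapI) (auto simp: im[symmetric] linmap_add[OF f, symmetric]
        linmap_smult[OF f, symmetric] left_module.smult_closed[OF M])
  show "bij_betw (inv_into (carrier M) f) (carrier N) (carrier M)" by (rule bij_betw_inv_into[OF bij])
qed

text \<open>The fibres of a surjection \<open>R\<^sup>n \<rightarrow> D\<close> form a copy of \<open>D\<close> in the type of the test modules.\<close>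

lemma sfp_copy:
  fixes R :: "('r, 'x) ring_scheme"
  assumes D: "super_fin_pres R D"
  obtains D' :: "('r, (nat \<Rightarrow> 'r) set) module" and c
  where "super_fin_pres R D'" "c \<in> linmap R D' D" "bij_betw c (carrier D') (carrier D)"
proof -
  note Dm = sfp_left_module[OF D]
  obtain n q where q: "q \<in> linmap R (fr R n) D" "q ` carrier (fr R n) = carrier D"
    using D unfolding sfp_iff_free_pres free_pres_def by blast
  define h where "h m = {x \<in> carrier (fr R n). q x = m}" for m
  have "inj_on h (carrier D)"
  proof (rule inj_onI)
    fix m m' assume m: "m \<in> carrier D" "m' \<in> carrier D" "h m = h m'"
    obtain x where "x \<in> carrier (fr R n)" "m = q x" using m(1) unfolding q(2)[symmetric] by blast
    then have "x \<in> h m" by (simp add: h_def)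
    then have "x \<in> h m'" using m(3) by simp
    then show "m = m'" using \<open>m = q x\<close> by (simp add: h_def)
  qed
  note T = transport[OF Dm this]
  show ?thesis
    by (rule that[OF sfp_iso[OF D T] linmap_inv[OF Dm T]])
qed

text \<open>Isomorphic modules share a resolution, which carries vanishing of Ext and Tor across an
  isomorphism in the first variable, even when the two modules have different element types.\<close>

lemma resolution_iso:
  assumes res: "resolution R M P d e" and N: "left_module R N" and c: "c \<in> linmap R M N"
    and bij: "bij_betw c (carrier M) (carrier N)"
  shows "resolution R N P d (\<lambda>x\<in>carrier (P 0). c (e x))"
proof -
  interpret P: resolution R M P d e by fact
  let ?e = "\<lambda>x\<in>carrier (P 0). c (e x)"
  interpret M: abelian_group M using P.M by (rule module_abelian)
  have "c (e x) = \<zero>\<^bsub>N\<^esub> \<longleftrightarrow> e x = \<zero>\<^bsub>M\<^esub>" if "x \<in> carrier (P 0)" for x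
    using linmap_zero[OF P.M N c] bij linmap_closed[OF P.e that] M.zero_closed
    unfolding bij_betw_def inj_on_def by metis
  then have "mod_ker (P 0) N ?e = mod_ker (P 0) M e" by (auto simp: mod_ker_def)
  moreover have "?e ` carrier (P 0) = carrier N"
  proof -
    have "?e ` carrier (P 0) = c ` (e ` carrier (P 0))" by (simp add: image_image)
    then show ?thesis using P.e_surj bij by (simp add: bij_betw_def)
  qed
  moreover have "?e \<in> mod_hom R (P 0) N" by (rule linmap_restrict[OF P.mod linmap_comp[OF P.e c]])
  ultimately show ?thesis
    using P.res N by (auto simp: resolution_def proj_resolution_def)
qed

text \<open>The definition quantifies over test modules of one element type only; a copy of
  \<open>D\<close> in that type has the same resolutions.\<close>

lemma weak_injective_Ext:
  assumes N: "weak_injective R N" and D: "super_fin_pres R D"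
  shows "trivial_group (Ext R D N 1)"
proof -
  have Nm: "left_module R N" using N by (simp add: weak_injective_def)
  obtain D' :: "('a, (nat \<Rightarrow> 'a) set) module" and c
    where D': "super_fin_pres R D'" and c: "c \<in> linmap R D' D" "bij_betw c (carrier D') (carrier D)"
    by (rule sfp_copy[OF D])
  note std = resolution.intro[OF sfp_left_module[OF D'] standard_resolution[OF sfp_left_module[OF D']]]
  have "trivial_group (Ext R D' N (Suc 0))" using N D' by (simp add: weak_injective_def)
  then show ?thesis
    using Ext_trivial_iff_resolution[OF std Nm, of 0]
      Ext_trivial_iff_resolution[OF resolution_iso[OF std sfp_left_module[OF D] c] Nm, of 0] by simp
qed

lemma weak_flat_Tor:
  assumes M: "weak_flat R M" and D: "super_fin_pres (opp R) D"
  shows "trivial_group (Tor R D M 1)"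
proof -
  have Mm: "left_module R M" using M by (simp add: weak_flat_def)
  obtain D' :: "('a, (nat \<Rightarrow> 'a) set) module" and c
    where D': "super_fin_pres (opp R) D'" and c: "c \<in> linmap (opp R) D' D" "bij_betw c (carrier D') (carrier D)"
    by (rule sfp_copy[OF D])
  note std = resolution.intro[OF sfp_left_module[OF D'] standard_resolution[OF sfp_left_module[OF D']]]
  have "trivial_group (Tor R D' M (Suc 0))" using M D' by (simp add: weak_flat_def)
  then show ?thesis
    using Tor_trivial_iff_resolution[OF std Mm, of 0]
      Tor_trivial_iff_resolution[OF resolution_iso[OF std sfp_left_module[OF D] c] Mm, of 0] by simp
qed

text \<open>A surjection \<open>B \<rightarrow> D\<close> with kernel \<open>A\<close> and a projective resolution \<open>P\<close> of \<open>D\<close> yield an exact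
  sequence \<open>P 1 \<rightarrow> P 0 \<oplus> A \<rightarrow> B \<rightarrow> 0\<close>.\<close>

lemma resolution_cover:
  assumes res: "resolution R D P d e" and B: "left_module R B" and p: "p \<in> linmap R B D"
    and surj: "p ` carrier B = carrier D"
  obtains \<phi> where "\<phi> \<in> linmap R (P 0) B"
    and "\<And>y. y \<in> carrier (P 1) \<Longrightarrow> \<phi> (d 0 y) \<in> mod_ker B D p"
    and "(\<lambda>(x, a). \<phi> x \<oplus>\<^bsub>B\<^esub> a) \<in> linmap R (dsum (P 0) (ker_mod B D p)) B"
    and "(\<lambda>(x, a). \<phi> x \<oplus>\<^bsub>B\<^esub> a) ` carrier (dsum (P 0) (ker_mod B D p)) = carrier B"
    and "(\<lambda>y. (d 0 y, \<ominus>\<^bsub>B\<^esub> \<phi> (d 0 y))) \<in> linmap R (P 1) (dsum (P 0) (ker_mod B D p))"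
    and "mod_ker (dsum (P 0) (ker_mod B D p)) B (\<lambda>(x, a). \<phi> x \<oplus>\<^bsub>B\<^esub> a) =
           (\<lambda>y. (d 0 y, \<ominus>\<^bsub>B\<^esub> \<phi> (d 0 y))) ` carrier (P 1)"
proof -
  interpret P: resolution R D P d e by fact
  interpret B: abelian_group B using B by (rule module_abelian)
  interpret D: abelian_group D using P.M by (rule module_abelian)
  have "e ` carrier (P 0) \<subseteq> p ` carrier B" using surj P.e_surj by simp
  then obtain \<phi> where \<phi>: "\<phi> \<in> linmap R (P 0) B" and p\<phi>: "\<And>x. x \<in> carrier (P 0) \<Longrightarrow> p (\<phi> x) = e x"
    using projective_lift[OF P.proj B P.M P.e p] by blast
  let ?A = "ker_mod B D p"
  let ?X = "dsum (P 0) ?A" and ?g = "\<lambda>(x, a). \<phi> x \<oplus>\<^bsub>B\<^esub> a"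
    and ?j = "\<lambda>y. (d 0 y, \<ominus>\<^bsub>B\<^esub> \<phi> (d 0 y))"
  note A = ker_left_module[OF B P.M p]
  interpret A: abelian_group ?A using A by (rule module_abelian)
  have d1: "d 0 y \<in> carrier (P 0)" if "y \<in> carrier (P 1)" for y
    using linmap_closed[OF P.d, of y 0] that by simp
  have \<phi>d: "\<phi> (d 0 y) \<in> mod_ker B D p" if "y \<in> carrier (P 1)" for y
    using that d1[OF that] linmap_closed[OF \<phi>] p\<phi> P.ed[of y] by (simp add: mod_ker_def)
  have neg: "\<ominus>\<^bsub>B\<^esub> a \<in> mod_ker B D p" if "a \<in> mod_ker B D p" for a
    using that linmap_neg[OF B P.M p, of a] D.minus_equality[of "\<zero>\<^bsub>D\<^esub>" "\<zero>\<^bsub>D\<^esub>"] by (simp add: mod_ker_def)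
  have g: "?g \<in> linmap R ?X B"
    by (rule linmapI)
      (auto simp: mod_ker_def linmap_closed[OF \<phi>] linmap_add[OF \<phi>] linmap_smult[OF \<phi>]
        B.add_add_swap left_module.smult_r_distr[OF B])
  have gs: "?g ` carrier ?X = carrier B"
  proof
    show "?g ` carrier ?X \<subseteq> carrier B" using linmap_closed[OF g] by blast
    show "carrier B \<subseteq> ?g ` carrier ?X"
    proof
      fix b assume b: "b \<in> carrier B"
      then have "p b \<in> e ` carrier (P 0)" using linmap_closed[OF p] P.e_surj by simp
      then obtain x where x: "x \<in> carrier (P 0)" "p b = e x" by blast
      have \<phi>x: "\<phi> x \<in> carrier B" using linmap_closed[OF \<phi> x(1)] .
      have "b \<ominus>\<^bsub>B\<^esub> \<phi> x \<in> mod_ker B D p"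
        using linmap_eq_iff_ker[OF B P.M p b \<phi>x] x p\<phi> by simp
      moreover have "b = \<phi> x \<oplus>\<^bsub>B\<^esub> (b \<ominus>\<^bsub>B\<^esub> \<phi> x)"
        using B.minus_add_cancel[OF b \<phi>x] b \<phi>x by (simp add: B.a_comm)
      ultimately show "b \<in> ?g ` carrier ?X"
        using x(1) by (intro image_eqI[of _ _ "(x, b \<ominus>\<^bsub>B\<^esub> \<phi> x)"]) auto
    qed
  qed
  have j: "?j \<in> linmap R (P 1) ?X"
  proof (rule linmapI)
    fix y z assume "y \<in> carrier (P 1)" "z \<in> carrier (P 1)"
    then show "?j (y \<oplus>\<^bsub>P 1\<^esub> z) = ?j y \<oplus>\<^bsub>?X\<^esub> ?j z"
      using linmap_add[OF P.d, of y 0 z] d1 linmap_closed[OF \<phi>]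
      by (simp add: linmap_add[OF \<phi>] B.minus_add)
  next
    fix a y assume "a \<in> carrier R" "y \<in> carrier (P 1)"
    then show "?j (a \<odot>\<^bsub>P 1\<^esub> y) = a \<odot>\<^bsub>?X\<^esub> ?j y"
      using linmap_smult[OF P.d, of a y 0] d1 linmap_closed[OF \<phi>]
      by (simp add: linmap_smult[OF \<phi>] smult_neg_right[OF B])
  qed (use d1 \<phi>d neg in simp)
  have ker: "mod_ker ?X B ?g = ?j ` carrier (P 1)"
  proof
    show "mod_ker ?X B ?g \<subseteq> ?j ` carrier (P 1)"
    proof
      fix z assume "z \<in> mod_ker ?X B ?g"
      then obtain x a where z: "z = (x, a)" "x \<in> carrier (P 0)" "a \<in> carrier B" "p a = \<zero>\<^bsub>D\<^esub>"
        "\<phi> x \<oplus>\<^bsub>B\<^esub> a = \<zero>\<^bsub>B\<^esub>"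
        by (auto simp: mod_ker_def)
      have \<phi>x: "\<phi> x \<in> carrier B" using linmap_closed[OF \<phi> z(2)] .
      have "p (\<phi> x \<oplus>\<^bsub>B\<^esub> a) = e x"
        using z(2-4) \<phi>x linmap_closed[OF P.e z(2)] by (simp add: linmap_add[OF p] p\<phi>)
      then have "e x = \<zero>\<^bsub>D\<^esub>" using z(5) linmap_zero[OF B P.M p] by simp
      then obtain y where y: "y \<in> carrier (P 1)" "x = d 0 y"
        using P.ex0 z(2) by (auto simp: mod_ker_def)
      have "\<ominus>\<^bsub>B\<^esub> \<phi> x = a"
        using z(3,5) \<phi>x by (intro B.minus_equality) (simp_all add: B.a_comm)
      then show "z \<in> ?j ` carrier (P 1)" using y z(1) by blast
    qed
    show "?j ` carrier (P 1) \<subseteq> mod_ker ?X B ?g"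
      using linmap_closed[OF j] \<phi>d by (auto simp: mod_ker_def B.r_neg)
  qed
  show ?thesis by (rule that[OF \<phi> \<phi>d g gs j ker])
qed

text \<open>The map \<open>f \<phi> d\<close> on \<open>P 1\<close> is a cocycle, so it equals
  \<open>k d\<close> because Ext^1 vanishes. On \<open>P 0 \<oplus> A\<close> the map k + f kills
  the pairs (d y, -\<phi> d y), that is, the kernel of the surjection onto \<open>B\<close>, and so
  descends to \<open>B\<close>; on pairs (0, a) it is \<open>f\<close>.\<close>

lemma weak_injective_extend:
  assumes N: "weak_injective R N" and D: "super_fin_pres R D" and B: "left_module R B"
    and p: "p \<in> linmap R B D" and surj: "p ` carrier B = carrier D"
    and f: "f \<in> linmap R (ker_mod B D p) N"
  shows "\<exists>h\<in>linmap R B N. \<forall>a\<in>mod_ker B D p. h a = f a"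
proof -
  note Dm = sfp_left_module[OF D]
  have Nm: "left_module R N" using N by (simp add: weak_injective_def)
  interpret N: abelian_group N using Nm by (rule module_abelian)
  interpret B: abelian_group B using B by (rule module_abelian)
  let ?P = "res_mod R D" and ?d = "res_diff R D"
  interpret P: resolution R D ?P ?d "restrict (res_aug R D) (carrier (?P 0))"
    by (intro resolution.intro Dm standard_resolution)
  let ?A = "ker_mod B D p"
  note A = ker_left_module[OF B Dm p]
  let ?X = "dsum (?P 0) ?A"
  have X: "left_module R ?X" by (intro dsum_left_module P.mod A)
  obtain \<phi> where \<phi>: "\<phi> \<in> linmap R (?P 0) B" "\<And>y. y \<in> carrier (?P 1) \<Longrightarrow> \<phi> (?d 0 y) \<in> mod_ker B D p"
    and g: "(\<lambda>(x, a). \<phi> x \<oplus>\<^bsub>B\<^esub> a) \<in> linmap R ?X B"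
    and gs: "(\<lambda>(x, a). \<phi> x \<oplus>\<^bsub>B\<^esub> a) ` carrier ?X = carrier B"
    and j: "(\<lambda>y. (?d 0 y, \<ominus>\<^bsub>B\<^esub> \<phi> (?d 0 y))) \<in> linmap R (?P 1) ?X"
    and ker: "mod_ker ?X B (\<lambda>(x, a). \<phi> x \<oplus>\<^bsub>B\<^esub> a) =
           (\<lambda>y. (?d 0 y, \<ominus>\<^bsub>B\<^esub> \<phi> (?d 0 y))) ` carrier (?P 1)"
    by (rule resolution_cover[OF P.resolution_axioms B p surj]) (rule that)
  have "(\<lambda>y. \<phi> (?d 0 y)) \<in> linmap R (?P 1) ?A"
    using linmap_comp[OF P.d[of 0] \<phi>(1)] \<phi>(2) by (intro linmap_into_sub) auto
  then have fl: "(\<lambda>y. f (\<phi> (?d 0 y))) \<in> linmap R (?P (Suc 0)) N"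
    using linmap_comp[OF _ f] by simp
  have fz: "\<forall>y\<in>carrier (?P (Suc (Suc 0))). f (\<phi> (?d 0 (?d (Suc 0) y))) = \<zero>\<^bsub>N\<^esub>"
    using linmap_zero[OF P.mod B \<phi>(1)] linmap_zero[OF A Nm f] by (simp add: P.dd)
  have ex: "hom_exact R N ?P ?d 0"
    using weak_injective_Ext[OF N D] Ext_trivial_iff[OF Dm Nm, of 0] by simp
  then obtain k where k: "k \<in> linmap R (?P 0) N"
    and fk: "\<And>y. y \<in> carrier (?P 1) \<Longrightarrow> f (\<phi> (?d 0 y)) = k (?d 0 y)"
    using mp[OF bspec[OF ex[unfolded hom_exact_def] fl] fz] by auto
  let ?G = "\<lambda>(x, a). k x \<oplus>\<^bsub>N\<^esub> f a"
  have G: "?G \<in> linmap R ?X N"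
    by (rule linmapI)
      (auto simp: linmap_closed[OF f] linmap_closed[OF k] linmap_add[OF k] linmap_smult[OF k]
        linmap_add[OF f, simplified] linmap_smult[OF f, simplified] N.add_add_swap
        left_module.smult_r_distr[OF Nm])
  have Gz: "?G z = \<zero>\<^bsub>N\<^esub>" if z: "z \<in> carrier ?X" "(\<lambda>(x, a). \<phi> x \<oplus>\<^bsub>B\<^esub> a) z = \<zero>\<^bsub>B\<^esub>" for z
  proof -
    have "z \<in> mod_ker ?X B (\<lambda>(x, a). \<phi> x \<oplus>\<^bsub>B\<^esub> a)" using z by (simp add: mod_ker_def)
    then obtain y where y: "y \<in> carrier (?P 1)" "z = (?d 0 y, \<ominus>\<^bsub>B\<^esub> \<phi> (?d 0 y))"
      unfolding ker by blast
    have a: "\<phi> (?d 0 y) \<in> carrier B" "\<ominus>\<^bsub>B\<^esub> \<phi> (?d 0 y) \<in> mod_ker B D p"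
      using \<phi>(2)[OF y(1)] z(1) y(2) by (auto simp: mod_ker_def)
    have "f (\<phi> (?d 0 y)) \<oplus>\<^bsub>N\<^esub> f (\<ominus>\<^bsub>B\<^esub> \<phi> (?d 0 y)) = f (\<phi> (?d 0 y) \<oplus>\<^bsub>B\<^esub> (\<ominus>\<^bsub>B\<^esub> \<phi> (?d 0 y)))"
      using linmap_add[OF f, of "\<phi> (?d 0 y)" "\<ominus>\<^bsub>B\<^esub> \<phi> (?d 0 y)"] a(2) \<phi>(2)[OF y(1)] by simp
    also have "\<dots> = \<zero>\<^bsub>N\<^esub>" using a(1) linmap_zero[OF A Nm f] by (simp add: B.r_neg)
    finally show ?thesis unfolding y(2) by (simp add: fk[OF y(1)])
  qed
  obtain h where h: "h \<in> linmap R B N" and hG: "\<And>z. z \<in> carrier ?X \<Longrightarrow> h ((\<lambda>(x, a). \<phi> x \<oplus>\<^bsub>B\<^esub> a) z) = ?G z"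
    using linmap_factor[OF X B Nm g gs G Gz] by blast
  have "h a = f a" if a: "a \<in> mod_ker B D p" for a
  proof -
    interpret P0: abelian_group "?P 0" using P.mod by (rule module_abelian)
    have "h (\<phi> \<zero>\<^bsub>?P 0\<^esub> \<oplus>\<^bsub>B\<^esub> a) = k \<zero>\<^bsub>?P 0\<^esub> \<oplus>\<^bsub>N\<^esub> f a" using hG[of "(\<zero>\<^bsub>?P 0\<^esub>, a)"] a by simp
    moreover have "\<phi> \<zero>\<^bsub>?P 0\<^esub> \<oplus>\<^bsub>B\<^esub> a = a"
      using linmap_zero[OF P.mod B \<phi>(1)] a by (simp add: mod_ker_def)
    moreover have "k \<zero>\<^bsub>?P 0\<^esub> \<oplus>\<^bsub>N\<^esub> f a = f a"
      using linmap_zero[OF P.mod Nm k] linmap_closed[OF f, of a] a by simp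
    ultimately show ?thesis by simp
  qed
  then show ?thesis using h by blast
qed

text \<open>Embed \<open>t\<close> into \<open>(P 0 \<oplus> A) \<otimes> M\<close>. It dies in
  \<open>B \<otimes> M\<close>, so right exactness makes it the image of some \<open>w\<close> in
  \<open>P 1 \<otimes> M\<close>. Its \<open>P 0\<close> component vanishes, so \<open>w\<close> is
  a cycle, hence a boundary because Tor_1 vanishes, and boundaries map to zero under
  \<open>?j\<close>. Projecting back by \<open>snd\<close> gives t = 0.\<close>

lemma weak_flat_inj:
  assumes M: "weak_flat R M" and D: "super_fin_pres (opp R) D" and B: "left_module (opp R) B"
    and p: "p \<in> linmap R B D" and surj: "p ` carrier B = carrier D"
    and t: "t \<in> carrier (tensor_ab R (ker_mod B D p) M)"
    and z: "tensor_map R (ker_mod B D p) B M (\<lambda>x. x) t = \<zero>\<^bsub>tensor_ab R B M\<^esub>"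
  shows "t = \<zero>\<^bsub>tensor_ab R (ker_mod B D p) M\<^esub>"
proof -
  note Dm = sfp_left_module[OF D]
  have Mm: "left_module R M" using M by (simp add: weak_flat_def)
  interpret B: abelian_group B using B by (rule module_abelian)
  let ?P = "res_mod (opp R) D" and ?d = "res_diff (opp R) D"
  interpret P: resolution "opp R" D ?P ?d "restrict (res_aug (opp R) D) (carrier (?P 0))"
    by (intro resolution.intro Dm standard_resolution)
  have p': "p \<in> linmap (opp R) B D" using p by simp
  let ?A = "ker_mod B D p"
  note A = ker_left_module[OF B Dm p']
  let ?X = "dsum (?P 0) ?A"
  have X: "left_module (opp R) ?X" by (intro dsum_left_module P.mod A)
  interpret P0: abelian_group "?P 0" using P.mod by (rule module_abelian)
  obtain \<phi> where \<phi>: "\<phi> \<in> linmap (opp R) (?P 0) B"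
    and g': "(\<lambda>(x, a). \<phi> x \<oplus>\<^bsub>B\<^esub> a) \<in> linmap (opp R) ?X B"
    and gs: "(\<lambda>(x, a). \<phi> x \<oplus>\<^bsub>B\<^esub> a) ` carrier ?X = carrier B"
    and j': "(\<lambda>y. (?d 0 y, \<ominus>\<^bsub>B\<^esub> \<phi> (?d 0 y))) \<in> linmap (opp R) (?P 1) ?X"
    and ker: "mod_ker ?X B (\<lambda>(x, a). \<phi> x \<oplus>\<^bsub>B\<^esub> a) =
           (\<lambda>y. (?d 0 y, \<ominus>\<^bsub>B\<^esub> \<phi> (?d 0 y))) ` carrier (?P 1)"
    by (rule resolution_cover[OF P.resolution_axioms B p' surj]) (rule that)
  let ?g = "\<lambda>(x, a). \<phi> x \<oplus>\<^bsub>B\<^esub> a" and ?j = "\<lambda>y. (?d 0 y, \<ominus>\<^bsub>B\<^esub> \<phi> (?d 0 y))"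
  let ?i = "\<lambda>a. (\<zero>\<^bsub>?P 0\<^esub>, a)"
  have g: "?g \<in> linmap R ?X B" and j: "?j \<in> linmap R (?P 1) ?X" using g' j' by simp_all
  have i: "?i \<in> linmap R ?A ?X"
    using smult_zero_right[OF P.mod, of _ 0] by (intro linmapI) auto
  have fst: "fst \<in> linmap R ?X (?P 0)" by (rule linmapI) auto
  have snd: "snd \<in> linmap R ?X ?A" by (rule linmapI) auto
  have d: "?d n \<in> linmap R (?P (Suc n)) (?P n)" for n using P.d[of n] by simp
  have incl: "(\<lambda>x. x) \<in> linmap R ?A B"
    by (rule linmap_from_sub[OF linmap_id]) (auto simp: mod_ker_def)
  note TX = tensor_pair.intro[OF X Mm]
  interpret TX: abelian_group "tensor_ab R ?X M" by (rule tensor_pair.T_ab[OF TX])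
  let ?t = "tensor_map R ?A ?X M ?i t"
  have t': "?t \<in> carrier (tensor_ab R ?X M)" by (rule ab_hom_closed[OF tensor_map_hom[OF A X Mm i] t])
  have "tensor_map R ?X B M ?g ?t = tensor_map R ?A B M (\<lambda>x. x) t"
    using linmap_zero[OF P.mod B \<phi>]
    by (intro tensor_map_comp[OF A X B Mm i g incl _ t]) (simp add: mod_ker_def)
  then have "tensor_map R ?X B M ?g ?t = \<zero>\<^bsub>tensor_ab R B M\<^esub>" using z by simp
  then have "?t \<in> tensor_map R (?P 1) ?X M ?j ` carrier (tensor_ab R (?P 1) M)"
    using tensor_right_exact[OF P.mod X B Mm j g gs _ t'] ker by blast
  then obtain w where w: "w \<in> carrier (tensor_ab R (?P 1) M)" and tw: "?t = tensor_map R (?P 1) ?X M ?j w"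
    by blast
  have "tensor_map R (?P 1) (?P 0) M (?d 0) w = tensor_map R ?X (?P 0) M fst ?t"
    unfolding tw using d[of 0] by (intro tensor_map_comp[OF P.mod X P.mod Mm j fst _ _ w, symmetric]) auto
  also have "\<dots> = tensor_map R ?A (?P 0) M (\<lambda>a. \<zero>\<^bsub>?P 0\<^esub>) t"
    by (rule tensor_map_comp[OF A X P.mod Mm i fst _ _ t])
      (use linmap_const_zero[OF P.mod, of 0] in auto)
  also have "\<dots> = \<zero>\<^bsub>tensor_ab R (?P 0) M\<^esub>"
    by (rule tensor_map_zero[OF A P.mod Mm _ refl t]) (use linmap_const_zero[OF P.mod, of 0] in auto)
  finally have dw: "tensor_map R (?P (Suc 0)) (?P 0) M (?d 0) w = \<zero>\<^bsub>tensor_ab R (?P 0) M\<^esub>" by simp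
  have "tensor_exact R M ?P ?d 0"
    using weak_flat_Tor[OF M D] Tor_trivial_iff[OF Dm Mm, of 0] by simp
  then obtain v where v: "v \<in> carrier (tensor_ab R (?P (Suc (Suc 0))) M)"
    and wv: "w = tensor_map R (?P (Suc (Suc 0))) (?P (Suc 0)) M (?d (Suc 0)) v"
    using w dw unfolding tensor_exact_def by auto
  have jd: "?j (?d (Suc 0) y) = \<zero>\<^bsub>?X\<^esub>" if "y \<in> carrier (?P (Suc (Suc 0)))" for y
    using P.dd[OF that] linmap_zero[OF P.mod B \<phi>] B.minus_equality[of "\<zero>\<^bsub>B\<^esub>" "\<zero>\<^bsub>B\<^esub>"] by simp
  have j1: "?j \<in> linmap R (?P (Suc 0)) ?X" using j by simp
  have "?t = tensor_map R (?P (Suc (Suc 0))) ?X M (\<lambda>y. ?j (?d (Suc 0) y)) v"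
    unfolding tw wv
    using tensor_map_comp[OF P.mod P.mod X Mm d j1 linmap_comp[OF d j1] _ v, OF refl] by simp
  also have "\<dots> = \<zero>\<^bsub>tensor_ab R ?X M\<^esub>"
    by (rule tensor_map_zero[OF P.mod X Mm linmap_comp[OF d j1] jd v])
  finally have t0: "?t = \<zero>\<^bsub>tensor_ab R ?X M\<^esub>" .
  have "t = tensor_map R ?A ?A M (\<lambda>x. x) t" by (rule tensor_map_id[OF A Mm linmap_id refl t, symmetric])
  also have "\<dots> = tensor_map R ?X ?A M snd ?t"
    by (rule tensor_map_comp[OF A X A Mm i snd linmap_id _ t, symmetric]) simp
  also have "\<dots> = \<zero>\<^bsub>tensor_ab R ?A M\<^esub>"
    unfolding t0
    by (rule ab_hom_zero[OF tensor_pair.T_ab[OF TX] tensor_pair.T_ab tensor_map_hom[OF X A Mm snd]])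
      (intro tensor_pair.intro A Mm)
  finally show ?thesis .
qed

text \<open>\<open>G\<close> first descends to the image of \<open>g\<close>, which is the kernel of
  \<open>h\<close>; the inclusion of that kernel in \<open>E\<close> has cokernel isomorphic to the
  image of \<open>h\<close>, so the map extends to \<open>E\<close>.\<close>

lemma weak_injective_exact:
  assumes N: "weak_injective R N" and B: "left_module R B" and E: "left_module R E"
    and D: "left_module R D" and g: "g \<in> linmap R B E" and h: "h \<in> linmap R E D"
    and ex: "mod_ker E D h = g ` carrier B"
    and sfp: "super_fin_pres R (D\<lparr>carrier := h ` carrier E\<rparr>)"
    and G: "G \<in> linmap R B N" and Gz: "\<And>x. x \<in> mod_ker B E g \<Longrightarrow> G x = \<zero>\<^bsub>N\<^esub>"
  shows "\<exists>G'\<in>linmap R E N. \<forall>x\<in>carrier B. G x = G' (g x)"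
proof -
  have Nm: "left_module R N" using N by (simp add: weak_injective_def)
  let ?I = "D\<lparr>carrier := h ` carrier E\<rparr>"
  let ?K = "ker_mod E ?I h"
  have h': "h \<in> linmap R E ?I" by (rule linmap_into_sub[OF h]) simp
  have K: "left_module R ?K" by (rule ker_left_module[OF E sfp_left_module[OF sfp] h'])
  have g': "g \<in> linmap R B ?K" by (rule linmap_into_sub[OF g]) (simp add: ex)
  obtain G1 where G1: "G1 \<in> linmap R ?K N" "\<And>x. x \<in> carrier B \<Longrightarrow> G1 (g x) = G x"
    using linmap_factor[OF B K Nm g' _ G] Gz ex by (auto simp: mod_ker_def)
  obtain G' where G': "G' \<in> linmap R E N" "\<And>x. x \<in> mod_ker E ?I h \<Longrightarrow> G' x = G1 x"
    using weak_injective_extend[OF N sfp E h' _ G1(1)] by auto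
  have "G x = G' (g x)" if "x \<in> carrier B" for x
    using that G'(2)[of "g x"] G1(2) ex by simp
  then show ?thesis using G'(1) by blast
qed

text \<open>The map induced by \<open>g\<close> factors through the tensor product with the kernel
  of \<open>h\<close>. The second factor is injective by weak flatness, and right exactness handles
  the first.\<close>

lemma weak_flat_exact:
  assumes M: "weak_flat R M" and A: "left_module (opp R) A" and B: "left_module (opp R) B"
    and E: "left_module (opp R) E" and D: "left_module (opp R) D"
    and f: "f \<in> linmap R A B" and g: "g \<in> linmap R B E" and h: "h \<in> linmap R E D"
    and ex1: "mod_ker B E g \<subseteq> f ` carrier A"
    and ex: "mod_ker E D h = g ` carrier B"
    and sfp: "super_fin_pres (opp R) (D\<lparr>carrier := h ` carrier E\<rparr>)"
    and t: "t \<in> carrier (tensor_ab R B M)"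
    and z: "tensor_map R B E M g t = \<zero>\<^bsub>tensor_ab R E M\<^esub>"
  shows "t \<in> tensor_map R A B M f ` carrier (tensor_ab R A M)"
proof -
  have Mm: "left_module R M" using M by (simp add: weak_flat_def)
  let ?I = "D\<lparr>carrier := h ` carrier E\<rparr>"
  let ?K = "ker_mod E ?I h"
  have h': "h \<in> linmap R E ?I" by (rule linmap_into_sub[OF h]) simp
  have K: "left_module (opp R) ?K" using ker_left_module[OF E sfp_left_module[OF sfp]] h' by simp
  have g': "g \<in> linmap R B ?K" by (rule linmap_into_sub[OF g]) (simp add: ex)
  have incl: "(\<lambda>x. x) \<in> linmap R ?K E"
    by (rule linmap_from_sub[OF linmap_id]) (auto simp: mod_ker_def)
  let ?t = "tensor_map R B ?K M g t"
  have t': "?t \<in> carrier (tensor_ab R ?K M)" by (rule ab_hom_closed[OF tensor_map_hom[OF B K Mm g'] t])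
  have "tensor_map R ?K E M (\<lambda>x. x) ?t = tensor_map R B E M g t"
    by (rule tensor_map_comp[OF B K E Mm g' incl g refl t])
  then have "?t = \<zero>\<^bsub>tensor_ab R ?K M\<^esub>"
    using z by (intro weak_flat_inj[OF M sfp E h' _ t']) simp_all
  then show ?thesis
    using ex1 ex by (intro tensor_right_exact[OF A B K Mm f g' _ _ t]) (simp_all add: mod_ker_def)
qed

section \<open>Bimodules and the modules built from them\<close>

lemma ab_hom_sum:
  assumes G: "abelian_group G" and H: "abelian_group H" and I: "finite I"
    and u: "\<And>j. j \<in> I \<Longrightarrow> u j \<in> ab_hom G H"
  shows "(\<lambda>x. \<Oplus>\<^bsub>H\<^esub>j\<in>I. u j x) \<in> ab_hom G H"
proof -
  interpret G: abelian_group G by fact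
  interpret H: abelian_group H by fact
  show ?thesis
  proof (rule ab_homI)
    fix x assume "x \<in> carrier G"
    then show "(\<Oplus>\<^bsub>H\<^esub>j\<in>I. u j x) \<in> carrier H"
      using u by (intro H.finsum_closed) (auto intro: ab_hom_closed)
  next
    fix x y assume xy: "x \<in> carrier G" "y \<in> carrier G"
    have "(\<Oplus>\<^bsub>H\<^esub>j\<in>I. u j (x \<oplus>\<^bsub>G\<^esub> y)) = (\<Oplus>\<^bsub>H\<^esub>j\<in>I. u j x \<oplus>\<^bsub>H\<^esub> u j y)"
      using u xy by (intro H.finsum_cong') (auto simp: ab_hom_add[OF u] ab_hom_closed[OF u])
    also have "\<dots> = (\<Oplus>\<^bsub>H\<^esub>j\<in>I. u j x) \<oplus>\<^bsub>H\<^esub> (\<Oplus>\<^bsub>H\<^esub>j\<in>I. u j y)"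
      using u xy by (intro H.finsum_addf) (auto simp: ab_hom_closed[OF u])
    finally show "(\<Oplus>\<^bsub>H\<^esub>j\<in>I. u j (x \<oplus>\<^bsub>G\<^esub> y)) = (\<Oplus>\<^bsub>H\<^esub>j\<in>I. u j x) \<oplus>\<^bsub>H\<^esub> (\<Oplus>\<^bsub>H\<^esub>j\<in>I. u j y)" .
  qed
qed

lemma free_expand:
  assumes M: "left_module R M" and f: "f \<in> linmap R (fr R n) M" and x: "x \<in> carrier (fr R n)"
  shows "f x = (\<Oplus>\<^bsub>M\<^esub>j\<in>{..<n}. x j \<odot>\<^bsub>M\<^esub> f (basis_vec R j))"
proof -
  have R: "ring R" using M by (rule module_ring)
  let ?g = "\<lambda>j. f (basis_vec R j)"
  have g: "?g j \<in> carrier M" if "j \<in> {..<n}" for j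
    by (rule linmap_closed[OF f basis_in_free[OF R that]])
  have "f x = free_lift R M ?g x"
    by (rule free_ext[OF R x M f free_lift_linmap[OF M g] free_lift_basis[OF M g, symmetric]])
  also have "\<dots> = (\<Oplus>\<^bsub>M\<^esub>j\<in>{..<n}. x j \<odot>\<^bsub>M\<^esub> ?g j)"
    using x by (intro free_lift_eq[OF M g x]) (auto simp: free_carrier_iff)
  finally show ?thesis .
qed

text \<open>Several module records are placed on one underlying additive group; through this they
  inherit its axioms.\<close>

lemma abelian_group_cong:
  assumes "abelian_group G" "carrier H = carrier G" "\<zero>\<^bsub>H\<^esub> = \<zero>\<^bsub>G\<^esub>"
    "ring.add H = ring.add G"
  shows "abelian_group H"
  using abelian_groupE[OF assms(1)] by (intro abelian_groupI) (auto simp: assms(2-4))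

lemma regular_simps [simp]:
  "carrier (regular_module R) = carrier R" "\<zero>\<^bsub>regular_module R\<^esub> = \<zero>\<^bsub>R\<^esub>"
  "ring.add (regular_module R) = ring.add R" "a \<odot>\<^bsub>regular_module R\<^esub> x = a \<otimes>\<^bsub>R\<^esub> x"
  by (simp_all add: regular_module_def)

lemma regular_left_module:
  assumes "ring R"
  shows "left_module R (regular_module R)"
proof -
  interpret R: ring R by fact
  show ?thesis
    by (intro left_moduleI abelian_group_cong[OF R.is_abelian_group] assms)
      (auto simp: R.l_distr R.r_distr R.m_assoc)
qed

lemma opp_bimod_simps [simp]:
  "carrier (opp_bimod C) = carrier C" "\<zero>\<^bsub>opp_bimod C\<^esub> = \<zero>\<^bsub>C\<^esub>"
  "ring.add (opp_bimod C) = ring.add C" "r \<odot>\<^bsub>opp_bimod C\<^esub> c = rsmult C c r"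
  "rsmult (opp_bimod C) c s = s \<odot>\<^bsub>C\<^esub> c" "opp_bimod (opp_bimod C) = C"
  by (simp_all add: opp_bimod_def)

lemma is_bimodule_opp: "is_bimodule S R C \<Longrightarrow> is_bimodule (opp R) (opp S) (opp_bimod C)"
  by (simp add: is_bimodule_def)

lemma semidualizing_opp: "semidualizing S R C \<Longrightarrow> semidualizing (opp R) (opp S) (opp_bimod C)"
  unfolding semidualizing_def using is_bimodule_opp by auto

text \<open>The dual of \<open>P\<close> with values in \<open>C\<close>: here \<open>R\<close> acts
  on the values of a map, whereas in \<open>hom_mod\<close>, where \<open>C\<close> is the source,
  it acts on the argument. Hence this is a right and \<open>hom_mod\<close> a left
  \<open>R\<close>-module.\<close>

definition cohom ::
  "('s, 'x) ring_scheme \<Rightarrow> ('s, 'r, 'c) bimodule \<Rightarrow> ('s, 'p, 'z) module_scheme \<Rightarrow> ('r, 'p \<Rightarrow> 'c) module"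
  where "cohom S C P = \<lparr>carrier = mod_hom S P C, monoid.mult = undefined, one = undefined,
     ring.zero = ring.zero (hom_ab S P C), ring.add = ring.add (hom_ab S P C),
     smult = (\<lambda>r f. \<lambda>x\<in>carrier P. rsmult C (f x) r)\<rparr>"

lemma cohom_simps [simp]:
  "carrier (cohom S C P) = mod_hom S P C" "\<zero>\<^bsub>cohom S C P\<^esub> = (\<lambda>x\<in>carrier P. \<zero>\<^bsub>C\<^esub>)"
  "f \<oplus>\<^bsub>cohom S C P\<^esub> g = (\<lambda>x\<in>carrier P. f x \<oplus>\<^bsub>C\<^esub> g x)"
  "r \<odot>\<^bsub>cohom S C P\<^esub> f = (\<lambda>x\<in>carrier P. rsmult C (f x) r)"
  by (simp_all add: cohom_def)

lemma hom_mod_simps [simp]: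
  "carrier (hom_mod S C N) = mod_hom S C N" "\<zero>\<^bsub>hom_mod S C N\<^esub> = (\<lambda>x\<in>carrier C. \<zero>\<^bsub>N\<^esub>)"
  "f \<oplus>\<^bsub>hom_mod S C N\<^esub> g = (\<lambda>x\<in>carrier C. f x \<oplus>\<^bsub>N\<^esub> g x)"
  "r \<odot>\<^bsub>hom_mod S C N\<^esub> f = (\<lambda>c\<in>carrier C. f (rsmult C c r))"
  by (simp_all add: hom_mod_def)

lemma tensor_mod_simps [simp]:
  "carrier (tensor_mod R C M) = carrier (tensor_ab R (opp_bimod C) M)"
  "\<zero>\<^bsub>tensor_mod R C M\<^esub> = \<zero>\<^bsub>tensor_ab R (opp_bimod C) M\<^esub>"
  "ring.add (tensor_mod R C M) = ring.add (tensor_ab R (opp_bimod C) M)"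
  "s \<odot>\<^bsub>tensor_mod R C M\<^esub> t = tensor_map R (opp_bimod C) (opp_bimod C) M (\<lambda>c. s \<odot>\<^bsub>C\<^esub> c) t"
  by (simp_all add: tensor_mod_def Let_def)

lemma mod_hom_closed: "\<lbrakk>f \<in> mod_hom R M N; x \<in> carrier M\<rbrakk> \<Longrightarrow> f x \<in> carrier N"
  by (auto dest: mod_hom_linmap intro: linmap_closed)

lemma compose_mod_hom:
  "\<lbrakk>left_module R A; d \<in> linmap R A B; f \<in> mod_hom R B N\<rbrakk> \<Longrightarrow> compose (carrier A) f d \<in> mod_hom R A N"
  unfolding compose_def by (rule linmap_restrict[OF _ linmap_comp[OF _ mod_hom_linmap]])

text \<open>The j-th coordinate functional of \<open>S^n\<close> times c, in other words the j-th
  inclusion of \<open>C\<close> into \<open>C^n\<close> under the identification of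
  \<open>C^n\<close> with the dual of \<open>S^n\<close>.\<close>

definition coord_smult ::
  "('s, 'x) ring_scheme \<Rightarrow> ('s, 'm, 'y) module_scheme \<Rightarrow> nat \<Rightarrow> nat \<Rightarrow> 'm \<Rightarrow> (nat \<Rightarrow> 's) \<Rightarrow> 'm" where
  "coord_smult S C n j c = (\<lambda>x\<in>carrier (fr S n). x j \<odot>\<^bsub>C\<^esub> c)"

locale bimod =
  fixes S :: "('s, 'x) ring_scheme" and R :: "('r, 'y) ring_scheme" and C :: "('s, 'r, 'c) bimodule"
  assumes bimodule: "is_bimodule S R C"
begin

lemma CS: "left_module S C" and CR: "left_module (opp R) (opp_bimod C)"
  using bimodule by (simp_all add: is_bimodule_def)

lemma S: "ring S" using CS by (rule module_ring)

lemma R: "ring R" using ring_opp[OF module_ring[OF CR]] by simp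

sublocale C: abelian_group C using CS by (rule module_abelian)

lemma s_closed: "\<lbrakk>s \<in> carrier S; c \<in> carrier C\<rbrakk> \<Longrightarrow> s \<odot>\<^bsub>C\<^esub> c \<in> carrier C"
  by (rule left_module.smult_closed[OF CS])

lemma r_closed: "\<lbrakk>r \<in> carrier R; c \<in> carrier C\<rbrakk> \<Longrightarrow> rsmult C c r \<in> carrier C"
  using left_module.smult_closed[OF CR] by simp

lemma r_add: "\<lbrakk>r \<in> carrier R; c \<in> carrier C; c' \<in> carrier C\<rbrakk> \<Longrightarrow>
    rsmult C (c \<oplus>\<^bsub>C\<^esub> c') r = rsmult C c r \<oplus>\<^bsub>C\<^esub> rsmult C c' r"
  using left_module.smult_r_distr[OF CR] by simp

lemma r_add_right: "\<lbrakk>r \<in> carrier R; r' \<in> carrier R; c \<in> carrier C\<rbrakk> \<Longrightarrow>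
    rsmult C c (r \<oplus>\<^bsub>R\<^esub> r') = rsmult C c r \<oplus>\<^bsub>C\<^esub> rsmult C c r'"
  using left_module.smult_l_distr[OF CR] by simp

lemma r_assoc: "\<lbrakk>r \<in> carrier R; r' \<in> carrier R; c \<in> carrier C\<rbrakk> \<Longrightarrow>
    rsmult C c (r \<otimes>\<^bsub>R\<^esub> r') = rsmult C (rsmult C c r) r'"
  using left_module.smult_assoc1[OF CR] by simp

lemma r_one: "c \<in> carrier C \<Longrightarrow> rsmult C c \<one>\<^bsub>R\<^esub> = c"
  using left_module.smult_one[OF CR] by simp

lemma sr_comm: "\<lbrakk>s \<in> carrier S; c \<in> carrier C; r \<in> carrier R\<rbrakk> \<Longrightarrow>
    rsmult C (s \<odot>\<^bsub>C\<^esub> c) r = s \<odot>\<^bsub>C\<^esub> (rsmult C c r)"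
  using bimodule by (simp add: is_bimodule_def)

lemma r_linmap: "r \<in> carrier R \<Longrightarrow> (\<lambda>c. rsmult C c r) \<in> linmap S C C"
  by (rule linmapI) (simp_all add: r_closed r_add sr_comm)

lemma s_linmap: "s \<in> carrier S \<Longrightarrow> (\<lambda>c. s \<odot>\<^bsub>C\<^esub> c) \<in> linmap R (opp_bimod C) (opp_bimod C)"
  by (rule linmapI) (simp_all add: s_closed left_module.smult_r_distr[OF CS] sr_comm)

text \<open>A bimodule read from the other side satisfies the same hypotheses, so each fact about
  duals of left \<open>S\<close>-modules also serves for duals of right \<open>R\<close>-modules.
  The Bass half relies on this.\<close>

lemma swap: "bimod (opp R) (opp S) (opp_bimod C)"
  by (intro bimod.intro is_bimodule_opp bimodule)

lemma hom_mod_left_module: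
  assumes N: "left_module S N"
  shows "left_module R (hom_mod S C N)"
proof -
  interpret N: abelian_group N using N by (rule module_abelian)
  have cl: "f c \<in> carrier N" if "f \<in> mod_hom S C N" "c \<in> carrier C" for f c
    by (rule mod_hom_closed[OF that])
  have add: "f (c \<oplus>\<^bsub>C\<^esub> c') = f c \<oplus>\<^bsub>N\<^esub> f c'"
    if "f \<in> mod_hom S C N" "c \<in> carrier C" "c' \<in> carrier C" for f c c'
    using linmap_add[OF mod_hom_linmap[OF that(1)]] that by simp
  show ?thesis
  proof (intro left_moduleI R)
    show "abelian_group (hom_mod S C N)"
      by (rule abelian_group_cong[OF hom_ab_abelian[OF CS N]]) (simp_all add: hom_mod_def hom_ab_def)
  next
    fix r f assume "r \<in> carrier R" "f \<in> carrier (hom_mod S C N)"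
    then show "r \<odot>\<^bsub>hom_mod S C N\<^esub> f \<in> carrier (hom_mod S C N)"
      by (auto intro!: linmap_restrict[OF CS] linmap_comp[OF r_linmap] dest: mod_hom_linmap)
  next
    fix f assume "f \<in> carrier (hom_mod S C N)"
    then show "\<one>\<^bsub>R\<^esub> \<odot>\<^bsub>hom_mod S C N\<^esub> f = f"
      by (auto simp: r_one mod_hom_iff extensional_def)
  qed (auto simp: r_closed r_add_right r_assoc add ring.ring_simprules(5)[OF R] cong: restrict_cong)
qed

lemma tensor_pair_C: "left_module R M \<Longrightarrow> tensor_pair R (opp_bimod C) M"
  by (rule tensor_pair.intro[OF CR])

lemma tensor_mod_left_module:
  assumes M: "left_module R M"
  shows "left_module S (tensor_mod R C M)"
proof -
  interpret T: tensor_pair R "opp_bimod C" M by (rule tensor_pair_C[OF M])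
  interpret S: ring S by (rule S)
  note tm = tensor_map_hom[OF CR CR M s_linmap]
  show ?thesis
  proof (intro left_moduleI S)
    show "abelian_group (tensor_mod R C M)" by (rule abelian_group_cong[OF T.T_ab]) simp_all
  next
    fix a x assume "a \<in> carrier S" "x \<in> carrier (tensor_mod R C M)"
    then show "a \<odot>\<^bsub>tensor_mod R C M\<^esub> x \<in> carrier (tensor_mod R C M)"
      using ab_hom_closed[OF tm] by simp
  next
    fix a b x assume "a \<in> carrier S" "b \<in> carrier S" "x \<in> carrier (tensor_mod R C M)"
    then show "(a \<oplus>\<^bsub>S\<^esub> b) \<odot>\<^bsub>tensor_mod R C M\<^esub> x =
        a \<odot>\<^bsub>tensor_mod R C M\<^esub> x \<oplus>\<^bsub>tensor_mod R C M\<^esub> b \<odot>\<^bsub>tensor_mod R C M\<^esub> x"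
      using tensor_map_plus[OF CR CR M s_linmap s_linmap s_linmap, of a b "a \<oplus>\<^bsub>S\<^esub> b" x]
      by (simp add: left_module.smult_l_distr[OF CS])
  next
    fix a x y assume "a \<in> carrier S" "x \<in> carrier (tensor_mod R C M)" "y \<in> carrier (tensor_mod R C M)"
    then show "a \<odot>\<^bsub>tensor_mod R C M\<^esub> (x \<oplus>\<^bsub>tensor_mod R C M\<^esub> y) =
        a \<odot>\<^bsub>tensor_mod R C M\<^esub> x \<oplus>\<^bsub>tensor_mod R C M\<^esub> a \<odot>\<^bsub>tensor_mod R C M\<^esub> y"
      using ab_hom_add[OF tm] by simp
  next
    fix a b x assume "a \<in> carrier S" "b \<in> carrier S" "x \<in> carrier (tensor_mod R C M)"
    then show "(a \<otimes>\<^bsub>S\<^esub> b) \<odot>\<^bsub>tensor_mod R C M\<^esub> x = a \<odot>\<^bsub>tensor_mod R C M\<^esub> (b \<odot>\<^bsub>tensor_mod R C M\<^esub> x)"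
      using tensor_map_comp[OF CR CR CR M s_linmap s_linmap s_linmap, of b a "a \<otimes>\<^bsub>S\<^esub> b" x]
      by (simp add: left_module.smult_assoc1[OF CS])
  next
    fix x assume "x \<in> carrier (tensor_mod R C M)"
    then show "\<one>\<^bsub>S\<^esub> \<odot>\<^bsub>tensor_mod R C M\<^esub> x = x"
      using tensor_map_id[OF CR M s_linmap, of "\<one>\<^bsub>S\<^esub>" x] by (simp add: left_module.smult_one[OF CS])
  qed
qed

lemma tensor_mod_smult_elt:
  assumes "left_module R M" "s \<in> carrier S" "c \<in> carrier C" "m \<in> carrier M"
  shows "s \<odot>\<^bsub>tensor_mod R C M\<^esub> (tensor_elt R (opp_bimod C) M c m) =
     tensor_elt R (opp_bimod C) M (s \<odot>\<^bsub>C\<^esub> c) m"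
  using tensor_map_elt[OF CR CR assms(1) s_linmap] assms by simp

lemma cohom_left_module:
  assumes P: "left_module S P"
  shows "left_module (opp R) (cohom S C P)"
proof -
  have cl: "f x \<in> carrier C" if "f \<in> mod_hom S P C" "x \<in> carrier P" for f x
    by (rule mod_hom_closed[OF that])
  show ?thesis
  proof (intro left_moduleI ring_opp R)
    show "abelian_group (cohom S C P)"
      by (rule abelian_group_cong[OF hom_ab_abelian[OF P CS]]) (simp_all add: cohom_def hom_ab_def)
  next
    fix r f assume "r \<in> carrier (opp R)" "f \<in> carrier (cohom S C P)"
    then show "r \<odot>\<^bsub>cohom S C P\<^esub> f \<in> carrier (cohom S C P)"
      by (auto intro!: linmap_restrict[OF P] linmap_comp[OF _ r_linmap] dest: mod_hom_linmap)
  next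
    fix f assume "f \<in> carrier (cohom S C P)"
    then show "\<one>\<^bsub>opp R\<^esub> \<odot>\<^bsub>cohom S C P\<^esub> f = f"
      by (auto simp: r_one cl mod_hom_iff extensional_def linmap_closed)
  qed (auto simp: cl r_closed r_add r_add_right r_assoc cong: restrict_cong)
qed

lemma cohom_eval: "x \<in> carrier P \<Longrightarrow> (\<lambda>f. f x) \<in> ab_hom (cohom S C P) C"
  by (rule ab_homI) (auto intro: mod_hom_closed)

lemma dual_map:
  assumes P: "left_module S P" and d: "d \<in> linmap S P Q"
  shows "(\<lambda>f. compose (carrier P) f d) \<in> linmap R (cohom S C Q) (cohom S C P)"
  by (rule linmapI)
    (auto simp: compose_mod_hom[OF P d] linmap_closed[OF d] compose_def cong: restrict_cong
      intro: compose_mod_hom[OF P d, unfolded compose_def])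

lemma free_S: "left_module S (fr S n)" by (rule free_left_module[OF S])

lemma coord_smult_linmap:
  "coord_smult S C n j \<in> linmap R (opp_bimod C) (cohom S C (fr S n))"
proof -
  have xj: "x j \<in> carrier S" if "x \<in> carrier (fr S n)" for x j using that by (simp add: free_carrier_iff)
  show ?thesis
  proof (rule linmapI)
    fix c assume "c \<in> carrier (opp_bimod C)"
    then have "(\<lambda>x. x j \<odot>\<^bsub>C\<^esub> c) \<in> linmap S (fr S n) C"
      by (intro linmapI)
        (auto simp: xj s_closed left_module.smult_l_distr[OF CS] left_module.smult_assoc1[OF CS])
    then show "coord_smult S C n j c \<in> carrier (cohom S C (fr S n))"
      unfolding coord_smult_def using linmap_restrict[OF free_S] by simp
  qed (auto simp: coord_smult_def xj s_closed left_module.smult_r_distr[OF CS] sr_comm cong: restrict_cong)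
qed

lemma cohom_expand:
  assumes f: "f \<in> mod_hom S (fr S n) C"
  shows "f = (\<Oplus>\<^bsub>cohom S C (fr S n)\<^esub>j\<in>{..<n}. coord_smult S C n j (f (basis_vec S j)))"
proof -
  let ?D = "cohom S C (fr S n)"
  interpret D: abelian_group ?D by (rule module_abelian[OF cohom_left_module[OF free_S]])
  have fb: "f (basis_vec S j) \<in> carrier C" if "j < n" for j
    using mod_hom_closed[OF f basis_in_free[OF S]] that by simp
  have k: "(\<lambda>j. coord_smult S C n j (f (basis_vec S j))) \<in> {..<n} \<rightarrow> carrier ?D"
    using linmap_closed[OF coord_smult_linmap] fb by (intro Pi_I) simp
  have "(\<Oplus>\<^bsub>?D\<^esub>j\<in>{..<n}. coord_smult S C n j (f (basis_vec S j))) \<in> mod_hom S (fr S n) C"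
    using D.finsum_closed[OF k] by simp
  then show ?thesis
  proof (rule mod_hom_eqI[OF f])
    fix x assume x: "x \<in> carrier (fr S n)"
    have "(\<Oplus>\<^bsub>?D\<^esub>j\<in>{..<n}. coord_smult S C n j (f (basis_vec S j))) x =
        (\<Oplus>\<^bsub>C\<^esub>j\<in>{..<n}. coord_smult S C n j (f (basis_vec S j)) x)"
      by (rule ab_hom_finsum[OF D.abelian_group_axioms C.abelian_group_axioms cohom_eval[OF x] _ k]) simp
    also have "\<dots> = f x"
      unfolding free_expand[OF CS mod_hom_linmap[OF f] x] using x by (simp add: coord_smult_def)
    finally show "f x = (\<Oplus>\<^bsub>?D\<^esub>j\<in>{..<n}. coord_smult S C n j (f (basis_vec S j))) x" by simp
  qed
qed

text \<open>Evaluation at the basis vectors identifies the dual of \<open>S^n\<close> with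
  \<open>C^n\<close> as right \<open>R\<close>-modules.\<close>

lemma sfp_cohom:
  assumes C: "super_fin_pres (opp R) (opp_bimod C)"
  shows "super_fin_pres (opp R) (cohom S C (fr S n))"
proof -
  let ?D = "cohom S C (fr S n)" and ?W = "pow_mod (opp_bimod C) n"
  note D = cohom_left_module[OF free_S, of n]
  let ?v = "\<lambda>f j. if j < n then f (basis_vec S j) else \<zero>\<^bsub>C\<^esub>"
  have b: "basis_vec S j \<in> carrier (fr S n)" if "j < n" for j by (rule basis_in_free[OF S]) (use that in simp)
  have rz: "rsmult C \<zero>\<^bsub>C\<^esub> r = \<zero>\<^bsub>C\<^esub>" if "r \<in> carrier R" for r
    using smult_zero_right[OF CR] that by simp
  have v: "?v \<in> linmap (opp R) ?D ?W"
    by (rule linmapI) (auto simp: b rz fun_eq_iff mod_hom_closed[OF _ b])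
  have "bij_betw ?v (carrier ?D) (carrier ?W)"
    unfolding bij_betw_def
  proof
    show "inj_on ?v (carrier ?D)"
    proof (rule inj_onI)
      fix f g assume fg: "f \<in> carrier ?D" "g \<in> carrier ?D" "?v f = ?v g"
      then have f: "f \<in> mod_hom S (fr S n) C" and g: "g \<in> mod_hom S (fr S n) C" by simp_all
      have eq: "f (basis_vec S j) = g (basis_vec S j)" if "j \<in> {..<n}" for j
        using fun_cong[OF fg(3), of j] that by simp
      show "f = g"
        by (rule mod_hom_eqI[OF f g free_ext[OF S _ CS mod_hom_linmap[OF f] mod_hom_linmap[OF g] eq]])
    qed
    show "?v ` carrier ?D = carrier ?W"
    proof
      show "?v ` carrier ?D \<subseteq> carrier ?W" using linmap_closed[OF v] by blast
      show "carrier ?W \<subseteq> ?v ` carrier ?D"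
      proof
        fix u assume u: "u \<in> carrier ?W"
        then have uC: "\<And>j. j \<in> {..<n} \<Longrightarrow> u j \<in> carrier C" by simp
        let ?f = "restrict (free_lift S C u) (carrier (fr S n))"
        have "?f \<in> carrier ?D" using linmap_restrict[OF free_S free_lift_linmap[OF CS uC]] by simp
        moreover have "free_lift S C u (basis_vec S j) = u j" if "j < n" for j
          using that by (intro free_lift_basis[where X = "{..<n}", OF CS]) (use uC in auto)
        then have "u = ?v ?f" using u b by (auto simp: fun_eq_iff)
        ultimately show "u \<in> ?v ` carrier ?D" by blast
      qed
    qed
  qed
  from linmap_inv[OF D pow_left_module[OF CR] v this]
  show ?thesis by (rule sfp_iso[OF sfp_pow[OF C] D])
qed

end

section \<open>The dual complex of a resolution of a semidualizing bimodule\<close>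

locale semidual = bimod S R C
  for S :: "('s, 'x) ring_scheme" and R :: "('r, 'y) ring_scheme" and C :: "('s, 'r, 'c) bimodule" +
  fixes k :: "nat \<Rightarrow> nat" and d :: "nat \<Rightarrow> (nat \<Rightarrow> 's) \<Rightarrow> nat \<Rightarrow> 's" and e :: "(nat \<Rightarrow> 's) \<Rightarrow> 'c"
  assumes semidual: "semidualizing S R C" and res: "resolution S C (\<lambda>i. fr S (k i)) d e"
begin

abbreviation "P i \<equiv> fr S (k i)"
abbreviation "D i \<equiv> cohom S C (P i)"

definition \<delta> where "\<delta> i f = compose (carrier (P (Suc i))) f (d i)"

text \<open>The coaugmentation of the dual complex: the homothety map from \<open>R\<close> to the
  endomorphisms of \<open>C\<close>, followed by precomposition with the augmentation
  \<open>e\<close>.\<close>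

definition \<epsilon> where "\<epsilon> r = (\<lambda>x\<in>carrier (P 0). rsmult C (e x) r)"

sublocale P: resolution S C P d e by (rule res)

lemma D: "left_module (opp R) (D i)" by (rule cohom_left_module[OF free_S])

lemma reg: "left_module (opp R) (regular_module (opp R))" by (intro regular_left_module ring_opp R)

lemma \<delta>: "\<delta> i \<in> linmap R (D i) (D (Suc i))"
  unfolding \<delta>_def by (rule dual_map[OF free_S P.d])

lemma \<delta>_apply: "x \<in> carrier (P (Suc i)) \<Longrightarrow> \<delta> i f x = f (d i x)"
  by (simp add: \<delta>_def compose_def)

lemma \<delta>_eq_zero_iff:
  assumes "f \<in> carrier (D i)"
  shows "\<delta> i f = \<zero>\<^bsub>D (Suc i)\<^esub> \<longleftrightarrow> (\<forall>x\<in>carrier (P (Suc i)). f (d i x) = \<zero>\<^bsub>C\<^esub>)"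
proof
  assume z: "\<delta> i f = \<zero>\<^bsub>D (Suc i)\<^esub>"
  show "\<forall>x\<in>carrier (P (Suc i)). f (d i x) = \<zero>\<^bsub>C\<^esub>"
    using fun_cong[OF z] by (auto simp: \<delta>_apply[symmetric])
qed (auto simp: \<delta>_def compose_def intro!: restrict_ext)

lemma \<epsilon>: "\<epsilon> \<in> linmap R (regular_module (opp R)) (D 0)"
proof (rule linmapI)
  fix r assume "r \<in> carrier (regular_module (opp R))"
  then show "\<epsilon> r \<in> carrier (D 0)"
    unfolding \<epsilon>_def using linmap_restrict[OF free_S linmap_comp[OF P.e r_linmap]] by simp
qed (auto simp: \<epsilon>_def linmap_closed[OF P.e] r_add_right r_assoc cong: restrict_cong)

lemma homothety_bij: "bij_betw (homothety R C) (carrier R) (mod_hom S C C)"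
  using semidual by (simp add: semidualizing_def mod_iso_def)

lemma \<epsilon>_inj:
  assumes r: "r \<in> carrier R" and z: "\<epsilon> r = \<zero>\<^bsub>D 0\<^esub>"
  shows "r = \<zero>\<^bsub>R\<^esub>"
proof -
  interpret R: ring R by (rule R)
  have "rsmult C c r = \<zero>\<^bsub>C\<^esub>" if c: "c \<in> carrier C" for c
  proof -
    obtain x where "x \<in> carrier (P 0)" "c = e x"
      using c unfolding P.e_surj[symmetric] by blast
    then show ?thesis using fun_cong[OF z, of x] by (simp add: \<epsilon>_def)
  qed
  moreover have "rsmult C c \<zero>\<^bsub>R\<^esub> = \<zero>\<^bsub>C\<^esub>" if "c \<in> carrier C" for c
    using smult_zero_left[OF CR] that by simp
  ultimately have "homothety R C r = homothety R C \<zero>\<^bsub>R\<^esub>"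
    using r by (auto simp: homothety_def)
  then show ?thesis using homothety_bij r unfolding bij_betw_def inj_on_def by blast
qed

text \<open>A map on \<open>P 0\<close> that kills the image of \<open>d 0\<close> factors through
  \<open>e\<close> as an endomorphism of \<open>C\<close>, and by the homothety isomorphism this is
  multiplication by a ring element.\<close>

lemma exact_0: "mod_ker (D 0) (D (Suc 0)) (\<delta> 0) = \<epsilon> ` carrier R"
proof
  show "mod_ker (D 0) (D (Suc 0)) (\<delta> 0) \<subseteq> \<epsilon> ` carrier R"
  proof
    fix f assume "f \<in> mod_ker (D 0) (D (Suc 0)) (\<delta> 0)"
    then have f: "f \<in> mod_hom S (P 0) C" and z: "\<forall>x\<in>carrier (P (Suc 0)). f (d 0 x) = \<zero>\<^bsub>C\<^esub>"
      using \<delta>_eq_zero_iff[of f 0] by (auto simp: mod_ker_def simp del: cohom_simps(2))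
    have "f x = \<zero>\<^bsub>C\<^esub>" if "x \<in> carrier (P 0)" "e x = \<zero>\<^bsub>C\<^esub>" for x
      using that z P.ex0 by (force simp: mod_ker_def)
    then obtain g where g: "g \<in> linmap S C C" "\<And>x. x \<in> carrier (P 0) \<Longrightarrow> g (e x) = f x"
      using linmap_factor[OF free_S CS CS P.e P.e_surj mod_hom_linmap[OF f]] by blast
    have "restrict g (carrier C) \<in> homothety R C ` carrier R"
      using linmap_restrict[OF CS g(1)] homothety_bij by (simp add: bij_betw_def)
    then obtain r where r: "r \<in> carrier R" "restrict g (carrier C) = homothety R C r" by blast
    have "f = \<epsilon> r"
    proof (rule mod_hom_eqI[OF f])
      show "\<epsilon> r \<in> mod_hom S (P 0) C" using linmap_closed[OF \<epsilon>] r(1) by simp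
      fix x assume x: "x \<in> carrier (P 0)"
      have "f x = restrict g (carrier C) (e x)" using g(2)[OF x] linmap_closed[OF P.e x] by simp
      then show "f x = \<epsilon> r x"
        unfolding r(2) using x r(1) linmap_closed[OF P.e x] by (simp add: homothety_def \<epsilon>_def)
    qed
    then show "f \<in> \<epsilon> ` carrier R" using r(1) by blast
  qed
  show "\<epsilon> ` carrier R \<subseteq> mod_ker (D 0) (D (Suc 0)) (\<delta> 0)"
  proof
    fix f assume "f \<in> \<epsilon> ` carrier R"
    then obtain r where r: "r \<in> carrier R" "f = \<epsilon> r" by blast
    have f: "f \<in> carrier (D 0)" using linmap_closed[OF \<epsilon>] r by simp
    have "f (d 0 x) = \<zero>\<^bsub>C\<^esub>" if "x \<in> carrier (P (Suc 0))" for x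
      using P.ed[OF that] linmap_closed[OF P.d that] smult_zero_right[OF CR] r by (simp add: \<epsilon>_def)
    then show "f \<in> mod_ker (D 0) (D (Suc 0)) (\<delta> 0)"
      using f \<delta>_eq_zero_iff[OF f] by (simp add: mod_ker_def)
  qed
qed

text \<open>The vanishing of Ext^(i+1)(C, C), read off on the resolution \<open>P\<close>.\<close>

lemma exact_Suc: "mod_ker (D (Suc i)) (D (Suc (Suc i))) (\<delta> (Suc i)) = \<delta> i ` carrier (D i)"
proof
  have "trivial_group (Ext S C C (Suc i))" using semidual by (simp add: semidualizing_def)
  then have ex: "hom_exact S C P d i" using Ext_trivial_iff_resolution[OF res CS] by simp
  show "mod_ker (D (Suc i)) (D (Suc (Suc i))) (\<delta> (Suc i)) \<subseteq> \<delta> i ` carrier (D i)"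
  proof
    fix f assume "f \<in> mod_ker (D (Suc i)) (D (Suc (Suc i))) (\<delta> (Suc i))"
    then have f: "f \<in> mod_hom S (P (Suc i)) C"
      and z: "\<forall>x\<in>carrier (P (Suc (Suc i))). f (d (Suc i) x) = \<zero>\<^bsub>C\<^esub>"
      using \<delta>_eq_zero_iff[of f "Suc i"] by (auto simp: mod_ker_def simp del: cohom_simps(2))
    obtain g where g: "g \<in> linmap S (P i) C" "\<forall>x\<in>carrier (P (Suc i)). f x = g (d i x)"
      using ex mod_hom_linmap[OF f] z unfolding hom_exact_def by blast
    let ?g = "restrict g (carrier (P i))"
    have g': "?g \<in> mod_hom S (P i) C" by (rule linmap_restrict[OF free_S g(1)])
    have "f = \<delta> i ?g"
      using g linmap_closed[OF P.d] linmap_closed[OF \<delta>, of ?g i] g'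
      by (intro mod_hom_eqI[OF f]) (auto simp: \<delta>_apply)
    then show "f \<in> \<delta> i ` carrier (D i)" using g' by auto
  qed
  show "\<delta> i ` carrier (D i) \<subseteq> mod_ker (D (Suc i)) (D (Suc (Suc i))) (\<delta> (Suc i))"
  proof
    fix f assume "f \<in> \<delta> i ` carrier (D i)"
    then obtain g where g: "g \<in> mod_hom S (P i) C" "f = \<delta> i g" by auto
    have f: "f \<in> carrier (D (Suc i))" using linmap_closed[OF \<delta>] g by simp
    have "f (d (Suc i) x) = \<zero>\<^bsub>C\<^esub>" if x: "x \<in> carrier (P (Suc (Suc i)))" for x
      using P.dd[OF x] linmap_closed[OF P.d x] linmap_zero[OF free_S CS mod_hom_linmap[OF g(1)]]
      by (simp add: g(2) \<delta>_apply)
    then show "f \<in> mod_ker (D (Suc i)) (D (Suc (Suc i))) (\<delta> (Suc i))"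
      using f \<delta>_eq_zero_iff[OF f] by (simp add: mod_ker_def)
  qed
qed

lemma sfp_D: "super_fin_pres (opp R) (D i)"
  using sfp_cohom semidual by (simp add: semidualizing_def)

text \<open>By injectivity of \<open>\<epsilon>\<close> the image is a copy of the free module of
  rank one, with coordinate \<open>v 0\<close>.\<close>

lemma sfp_\<epsilon>: "super_fin_pres (opp R) ((D 0)\<lparr>carrier := \<epsilon> ` carrier R\<rparr>)"
proof -
  interpret R: ring R by (rule R)
  let ?I = "(D 0)\<lparr>carrier := \<epsilon> ` carrier R\<rparr>" and ?F = "fr (opp R) 1"
  note F = free_left_module[OF ring_opp[OF R], of "{..<1::nat}"]
  have \<epsilon>': "\<epsilon> \<in> linmap (opp R) (regular_module (opp R)) (D 0)" using \<epsilon> by simp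
  have I: "left_module (opp R) ?I" using image_left_module[OF reg D \<epsilon>'] by simp
  have v0: "(\<lambda>v. v 0) \<in> linmap (opp R) ?F (regular_module (opp R))"
    by (rule linmapI) (auto simp: free_carrier_iff)
  let ?g = "\<lambda>v. \<epsilon> (v 0)"
  have g: "?g \<in> linmap (opp R) ?F ?I"
    by (rule linmap_into_sub[OF linmap_comp[OF v0 \<epsilon>']]) (auto simp: free_carrier_iff)
  have "bij_betw ?g (carrier ?F) (carrier ?I)"
    unfolding bij_betw_def
  proof
    show "inj_on ?g (carrier ?F)"
    proof (rule inj_onI)
      fix v w assume vw: "v \<in> carrier ?F" "w \<in> carrier ?F" "\<epsilon> (v 0) = \<epsilon> (w 0)"
      then have vR: "v 0 \<in> carrier R" "w 0 \<in> carrier R" by (auto simp: free_carrier_iff)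
      have "v 0 \<ominus>\<^bsub>regular_module (opp R)\<^esub> w 0 \<in> mod_ker (regular_module (opp R)) (D 0) \<epsilon>"
        using linmap_eq_iff_ker[OF reg D \<epsilon>', of "v 0" "w 0"] vR vw(3) by simp
      then have "v 0 \<ominus>\<^bsub>regular_module (opp R)\<^esub> w 0 = \<zero>\<^bsub>regular_module (opp R)\<^esub>"
        using \<epsilon>_inj by (auto simp: mod_ker_def simp del: cohom_simps)
      then have "v 0 = w 0"
        using abelian_group.minus_zero_iff[OF module_abelian[OF reg]] vR by simp
      moreover have "v i = w i" if "i \<noteq> 0" for i using vw(1,2) that by (simp add: free_carrier_iff)
      ultimately have "v i = w i" for i by (cases "i = 0") simp_all
      then show "v = w" by (simp add: fun_eq_iff)
    qed
    show "?g ` carrier ?F = carrier ?I"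
    proof
      show "?g ` carrier ?F \<subseteq> carrier ?I" using linmap_closed[OF g] by blast
      show "carrier ?I \<subseteq> ?g ` carrier ?F"
      proof
        fix f assume "f \<in> carrier ?I"
        then obtain r where r: "r \<in> carrier R" "f = \<epsilon> r" by auto
        have "finite {i::nat. (if i = 0 then r else \<zero>\<^bsub>R\<^esub>) \<noteq> \<zero>\<^bsub>R\<^esub>}"
          by (rule finite_subset[of _ "{0::nat}"]) auto
        then have "(\<lambda>i. if i = 0 then r else \<zero>\<^bsub>R\<^esub>) \<in> carrier ?F" using r by (auto simp: free_carrier_iff)
        then show "f \<in> ?g ` carrier ?F" using r(2) by (intro image_eqI) auto
      qed
    qed
  qed
  then show ?thesis by (rule sfp_iso[OF sfp_free[OF ring_opp[OF R]] I g])
qed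

text \<open>The image of \<open>\<delta> i\<close> is the cokernel of the inclusion of its kernel in
  \<open>D i\<close>, and by exactness that kernel is the preceding image, for i = 0 the image of
  \<open>\<epsilon>\<close>. Thus finiteness spreads from \<open>R\<close> through the whole
  complex.\<close>

lemma sfp_coimage: "super_fin_pres (opp R) ((D (Suc i))\<lparr>carrier := \<delta> i ` carrier (D i)\<rparr>)"
proof (induction i)
  have coker: "super_fin_pres (opp R) ((D (Suc i))\<lparr>carrier := \<delta> i ` carrier (D i)\<rparr>)"
    if K: "super_fin_pres (opp R) (ker_mod (D i) (D (Suc i)) (\<delta> i))" for i
  proof -
    let ?I = "(D (Suc i))\<lparr>carrier := \<delta> i ` carrier (D i)\<rparr>"
    have \<delta>': "\<delta> i \<in> linmap (opp R) (D i) (D (Suc i))" using \<delta> by simp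
    have "left_module (opp R) ?I" by (rule image_left_module[OF D D \<delta>'])
    moreover have "\<delta> i \<in> linmap (opp R) (D i) ?I" by (rule linmap_into_sub[OF \<delta>']) simp
    moreover have "\<delta> i ` carrier (D i) = carrier ?I" by simp
    moreover have "super_fin_pres (opp R) (ker_mod (D i) ?I (\<delta> i))" using K by simp
    ultimately show ?thesis by (rule sfp_cokernel[OF sfp_D])
  qed
  case 0
  show ?case by (rule coker) (use sfp_\<epsilon> in \<open>simp add: exact_0\<close>)
  case (Suc i)
  then show ?case by (intro coker) (simp only: exact_Suc)
qed

end

section \<open>Two natural isomorphisms\<close>

lemma hom_ab_eval: "x \<in> carrier P \<Longrightarrow> (\<lambda>f. f x) \<in> ab_hom (hom_ab R P N) N"
  by (rule ab_homI) (auto intro: mod_hom_closed)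

context bimod
begin

text \<open>The natural map \<open>Hom\<^sub>S(P, C) \<otimes>\<^sub>R M \<rightarrow> Hom\<^sub>S(P, C \<otimes>\<^sub>R M)\<close>.\<close>

definition \<tau> where
  "\<tau> M P = tensor_lift R (cohom S C P) M (hom_ab S P (tensor_mod R C M))
     (\<lambda>f m. \<lambda>x\<in>carrier P. tensor_elt R (opp_bimod C) M (f x) m)"

text \<open>The natural map \<open>Q \<otimes>\<^sub>R Hom\<^sub>S(C, N) \<rightarrow> Hom\<^sub>S(Hom\<^bsub>R\<^sup>o\<^sup>p\<^esub>(Q, C), N)\<close>.\<close>

definition \<sigma> where
  "\<sigma> N Q = tensor_lift R Q (hom_mod S C N) (hom_ab S (cohom (opp R) (opp_bimod C) Q) N)
     (\<lambda>q h. \<lambda>f\<in>mod_hom (opp R) Q (opp_bimod C). h (f q))"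

section \<open>The map \<tau> on finite free modules\<close>

context
  fixes M :: "('r, 'm, 'z) module_scheme"
  assumes M: "left_module R M"
begin

interpretation T: tensor_pair R "opp_bimod C" M by (rule tensor_pair_C[OF M])

abbreviation "CM \<equiv> tensor_mod R C M"

lemma CM: "left_module S CM" by (rule tensor_mod_left_module[OF M])

lemma cohom_pair: "left_module S P \<Longrightarrow> tensor_pair R (cohom S C P) M"
  by (rule tensor_pair.intro[OF cohom_left_module M])

lemma \<tau>_balanced:
  fixes P :: "('s, 'p, 'w) module_scheme"
  assumes P: "left_module S P"
  shows "balanced R (cohom S C P) M (hom_ab S P CM)
     (\<lambda>f m. \<lambda>x\<in>carrier P. tensor_elt R (opp_bimod C) M (f x) m)"
proof -
  interpret P: abelian_group P using P by (rule module_abelian)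
  have lin: "(\<lambda>x. tensor_elt R (opp_bimod C) M (f x) m) \<in> linmap S P CM"
    if f: "f \<in> mod_hom S P C" and m: "m \<in> carrier M" for f m
  proof (rule linmapI)
    note fl = mod_hom_linmap[OF f]
    show "tensor_elt R (opp_bimod C) M (f x) m \<in> carrier CM" if "x \<in> carrier P" for x
      using T.elt_closed[of "f x" m] m linmap_closed[OF fl that] by simp
    show "tensor_elt R (opp_bimod C) M (f (x \<oplus>\<^bsub>P\<^esub> y)) m =
        tensor_elt R (opp_bimod C) M (f x) m \<oplus>\<^bsub>CM\<^esub> tensor_elt R (opp_bimod C) M (f y) m"
      if "x \<in> carrier P" "y \<in> carrier P" for x y
      using T.elt_add_left[of "f x" "f y" m] m linmap_closed[OF fl] that by (simp add: linmap_add[OF fl])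
    show "tensor_elt R (opp_bimod C) M (f (a \<odot>\<^bsub>P\<^esub> x)) m = a \<odot>\<^bsub>CM\<^esub> tensor_elt R (opp_bimod C) M (f x) m"
      if "a \<in> carrier S" "x \<in> carrier P" for a x
      using tensor_mod_smult_elt[OF M that(1) linmap_closed[OF fl that(2)] m] that
      by (simp add: linmap_smult[OF fl])
  qed
  show ?thesis
    unfolding balanced_def
  proof (intro conjI ballI)
    fix f m assume "f \<in> carrier (cohom S C P)" "m \<in> carrier M"
    then show "(\<lambda>x\<in>carrier P. tensor_elt R (opp_bimod C) M (f x) m) \<in> carrier (hom_ab S P CM)"
      using linmap_restrict[OF P lin] by simp
  next
    fix f g m assume "f \<in> carrier (cohom S C P)" "g \<in> carrier (cohom S C P)" "m \<in> carrier M"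
    then show "(\<lambda>x\<in>carrier P. tensor_elt R (opp_bimod C) M ((f \<oplus>\<^bsub>cohom S C P\<^esub> g) x) m) =
        (\<lambda>x\<in>carrier P. tensor_elt R (opp_bimod C) M (f x) m) \<oplus>\<^bsub>hom_ab S P CM\<^esub>
        (\<lambda>x\<in>carrier P. tensor_elt R (opp_bimod C) M (g x) m)"
      using T.elt_add_left mod_hom_closed[of f S P C] mod_hom_closed[of g S P C]
      by (auto intro!: restrict_ext)
  next
    fix f m m' assume "f \<in> carrier (cohom S C P)" "m \<in> carrier M" "m' \<in> carrier M"
    then show "(\<lambda>x\<in>carrier P. tensor_elt R (opp_bimod C) M (f x) (m \<oplus>\<^bsub>M\<^esub> m')) =
        (\<lambda>x\<in>carrier P. tensor_elt R (opp_bimod C) M (f x) m) \<oplus>\<^bsub>hom_ab S P CM\<^esub>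
        (\<lambda>x\<in>carrier P. tensor_elt R (opp_bimod C) M (f x) m')"
      using T.elt_add_right mod_hom_closed[of f S P C] by (auto intro!: restrict_ext)
  next
    fix r f m assume "r \<in> carrier R" "f \<in> carrier (cohom S C P)" "m \<in> carrier M"
    then show "(\<lambda>x\<in>carrier P. tensor_elt R (opp_bimod C) M ((r \<odot>\<^bsub>cohom S C P\<^esub> f) x) m) =
        (\<lambda>x\<in>carrier P. tensor_elt R (opp_bimod C) M (f x) (r \<odot>\<^bsub>M\<^esub> m))"
      using T.elt_smult mod_hom_closed[of f S P C] by (auto intro!: restrict_ext)
  qed
qed

lemma \<tau>_hom: "left_module S P \<Longrightarrow> \<tau> M P \<in> ab_hom (tensor_ab R (cohom S C P) M) (hom_ab S P CM)"
  unfolding \<tau>_def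
  by (rule tensor_pair.tensor_lift_hom[OF cohom_pair hom_ab_abelian[OF _ CM] \<tau>_balanced])

lemma \<tau>_elt:
  assumes "left_module S P" "f \<in> mod_hom S P C" "m \<in> carrier M" "x \<in> carrier P"
  shows "\<tau> M P (tensor_elt R (cohom S C P) M f m) x = tensor_elt R (opp_bimod C) M (f x) m"
  unfolding \<tau>_def
  using tensor_pair.tensor_lift_elt[OF cohom_pair hom_ab_abelian[OF _ CM] \<tau>_balanced, of P f m] assms
  by simp

lemma \<tau>_eval_hom:
  assumes "left_module S P" "x \<in> carrier P"
  shows "(\<lambda>t. \<tau> M P t x) \<in> ab_hom (tensor_ab R (cohom S C P) M) (tensor_ab R (opp_bimod C) M)"
proof -
  have "(\<lambda>t. \<tau> M P t x) \<in> ab_hom (tensor_ab R (cohom S C P) M) CM"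
    by (rule ab_hom_comp[OF \<tau>_hom[OF assms(1)] hom_ab_eval[OF assms(2)]])
  then show ?thesis by (simp add: ab_hom_def)
qed

lemma \<tau>_natural:
  assumes P: "left_module S P" and Q: "left_module S Q" and d: "d \<in> linmap S P Q"
    and t: "t \<in> carrier (tensor_ab R (cohom S C Q) M)" and x: "x \<in> carrier P"
  shows "\<tau> M P (tensor_map R (cohom S C Q) (cohom S C P) M (\<lambda>f. compose (carrier P) f d) t) x =
     \<tau> M Q t (d x)"
proof -
  note dual = dual_map[OF P d]
  note dx = linmap_closed[OF d x]
  show ?thesis
  proof (rule tensor_pair.T_hom_eq[OF cohom_pair[OF Q] ab_hom_comp[OF
        tensor_map_hom[OF cohom_left_module[OF Q] cohom_left_module[OF P] M dual] \<tau>_eval_hom[OF P x]]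
        \<tau>_eval_hom[OF Q dx] t])
    fix f m assume f: "f \<in> carrier (cohom S C Q)" and m: "m \<in> carrier M"
    have f': "f \<in> mod_hom S Q C" using f by simp
    have fd: "compose (carrier P) f d \<in> mod_hom S P C" by (rule compose_mod_hom[OF P d f'])
    show "\<tau> M P (tensor_map R (cohom S C Q) (cohom S C P) M (\<lambda>f. compose (carrier P) f d)
        (tensor_elt R (cohom S C Q) M f m)) x = \<tau> M Q (tensor_elt R (cohom S C Q) M f m) (d x)"
      unfolding tensor_map_elt[OF cohom_left_module[OF Q] cohom_left_module[OF P] M dual f m]
        \<tau>_elt[OF P fd m x] \<tau>_elt[OF Q f' m dx]
      using x by (simp add: compose_def)
  qed
qed

context
  fixes n :: nat
begin

abbreviation "Dn \<equiv> cohom S C (fr S n)"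

lemma coord_tensor_hom:
  "tensor_map R (opp_bimod C) Dn M (coord_smult S C n j) \<in> ab_hom CM (tensor_ab R Dn M)"
  using tensor_map_hom[OF CR cohom_left_module[OF free_S] M coord_smult_linmap] by (simp add: ab_hom_def)

text \<open>The inverse of \<open>\<tau>\<close> sends a map g to the sum over j of the value of g
  at the j-th basis vector, pushed along the j-th inclusion \<open>coord_smult S C n j\<close>. On a
  pure tensor this is \<open>cohom_expand\<close> in the first factor.\<close>

lemma \<tau>_left_inverse:
  assumes t: "t \<in> carrier (tensor_ab R Dn M)"
  shows "(\<Oplus>\<^bsub>tensor_ab R Dn M\<^esub>j\<in>{..<n}. tensor_map R (opp_bimod C) Dn M (coord_smult S C n j)
     (\<tau> M (fr S n) t (basis_vec S j))) = t"
proof -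
  interpret DM: tensor_pair R Dn M by (rule cohom_pair[OF free_S])
  have b: "basis_vec S j \<in> carrier (fr S n)" if "j \<in> {..<n}" for j by (rule basis_in_free[OF S that])
  have id: "(\<lambda>t. t) \<in> ab_hom DM.T DM.T" by (simp add: ab_hom_def)
  have hom: "(\<lambda>t. \<Oplus>\<^bsub>DM.T\<^esub>j\<in>{..<n}. tensor_map R (opp_bimod C) Dn M (coord_smult S C n j)
     (\<tau> M (fr S n) t (basis_vec S j))) \<in> ab_hom DM.T DM.T"
    using ab_hom_comp[OF \<tau>_eval_hom[OF free_S b]
        tensor_map_hom[OF CR cohom_left_module[OF free_S] M coord_smult_linmap]]
    by (intro ab_hom_sum DM.T_ab) simp_all
  show ?thesis
  proof (rule DM.T_hom_eq[OF hom id t])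
    fix f m assume f: "f \<in> carrier Dn" and m: "m \<in> carrier M"
    have f': "f \<in> mod_hom S (fr S n) C" using f by simp
    have fb: "f (basis_vec S j) \<in> carrier C" if "j \<in> {..<n}" for j by (rule mod_hom_closed[OF f' b[OF that]])
    have k: "(\<lambda>j. coord_smult S C n j (f (basis_vec S j))) \<in> {..<n} \<rightarrow> carrier Dn"
      using linmap_closed[OF coord_smult_linmap] fb by (intro Pi_I) simp
    have "(\<Oplus>\<^bsub>DM.T\<^esub>j\<in>{..<n}. tensor_map R (opp_bimod C) Dn M (coord_smult S C n j)
         (\<tau> M (fr S n) (tensor_elt R Dn M f m) (basis_vec S j))) =
       (\<Oplus>\<^bsub>DM.T\<^esub>j\<in>{..<n}. tensor_elt R Dn M (coord_smult S C n j (f (basis_vec S j))) m)"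
    proof (rule DM.T.finsum_cong')
      show "(\<lambda>j. tensor_elt R Dn M (coord_smult S C n j (f (basis_vec S j))) m) \<in> {..<n} \<rightarrow> carrier DM.T"
        using k m DM.elt_closed by (simp add: Pi_iff)
      show "tensor_map R (opp_bimod C) Dn M (coord_smult S C n j)
           (\<tau> M (fr S n) (tensor_elt R Dn M f m) (basis_vec S j)) =
         tensor_elt R Dn M (coord_smult S C n j (f (basis_vec S j))) m" if j: "j \<in> {..<n}" for j
        using tensor_map_elt[OF CR cohom_left_module[OF free_S] M coord_smult_linmap] fb[OF j] m
        by (simp add: \<tau>_elt[OF free_S f' m b[OF j]])
    qed simp
    also have "\<dots> = tensor_elt R Dn M (\<Oplus>\<^bsub>Dn\<^esub>j\<in>{..<n}. coord_smult S C n j (f (basis_vec S j))) m"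
      by (rule ab_hom_finsum[OF DM.A.abelian_group_axioms DM.T_ab DM.elt_left_hom[OF m] _ k, symmetric]) simp
    also have "\<dots> = tensor_elt R Dn M f m" using cohom_expand[OF f'] by simp
    finally show "(\<Oplus>\<^bsub>DM.T\<^esub>j\<in>{..<n}. tensor_map R (opp_bimod C) Dn M (coord_smult S C n j)
         (\<tau> M (fr S n) (tensor_elt R Dn M f m) (basis_vec S j))) = tensor_elt R Dn M f m" .
  qed
qed

lemma \<tau>_inj:
  assumes "t \<in> carrier (tensor_ab R Dn M)" "t' \<in> carrier (tensor_ab R Dn M)"
    and "\<And>x. x \<in> carrier (fr S n) \<Longrightarrow> \<tau> M (fr S n) t x = \<tau> M (fr S n) t' x"
  shows "t = t'"
proof -
  interpret DM: tensor_pair R Dn M by (rule cohom_pair[OF free_S])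
  have b: "basis_vec S j \<in> carrier (fr S n)" if "j \<in> {..<n}" for j by (rule basis_in_free[OF S that])
  have "t = (\<Oplus>\<^bsub>DM.T\<^esub>j\<in>{..<n}. tensor_map R (opp_bimod C) Dn M (coord_smult S C n j)
     (\<tau> M (fr S n) t' (basis_vec S j)))"
    using \<tau>_left_inverse[OF assms(1)] ab_hom_closed[OF \<tau>_eval_hom[OF free_S b] assms(2)]
      ab_hom_closed[OF coord_tensor_hom]
    by (subst (asm) DM.T.finsum_cong'[OF refl _ arg_cong[OF assms(3)[OF b]]]) simp_all
  then show ?thesis using \<tau>_left_inverse[OF assms(2)] by simp
qed

lemma \<tau>_surj:
  assumes g: "g \<in> linmap S (fr S n) CM"
  shows "\<exists>t\<in>carrier (tensor_ab R Dn M). \<forall>x\<in>carrier (fr S n). \<tau> M (fr S n) t x = g x"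
proof -
  interpret DM: tensor_pair R Dn M by (rule cohom_pair[OF free_S])
  interpret CMg: abelian_group CM by (rule module_abelian[OF CM])
  let ?k = "\<lambda>j. tensor_map R (opp_bimod C) Dn M (coord_smult S C n j)"
  have gb: "g (basis_vec S j) \<in> carrier CM" if "j \<in> {..<n}" for j
    by (rule linmap_closed[OF g basis_in_free[OF S that]])
  have k: "(\<lambda>j. ?k j (g (basis_vec S j))) \<in> {..<n} \<rightarrow> carrier DM.T"
    using ab_hom_closed[OF coord_tensor_hom gb] by (intro Pi_I)
  let ?t = "\<Oplus>\<^bsub>DM.T\<^esub>j\<in>{..<n}. ?k j (g (basis_vec S j))"
  have "\<tau> M (fr S n) ?t x = g x" if x: "x \<in> carrier (fr S n)" for x
  proof -
    have xj: "x j \<in> carrier S" for j using x by (simp add: free_carrier_iff)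
    have hom: "(\<lambda>t. \<tau> M (fr S n) t x) \<in> ab_hom DM.T CM"
      using \<tau>_eval_hom[OF free_S x] by (simp add: ab_hom_def)
    \<comment> \<open>A tensor u pushed along the j-th inclusion is, under \<open>\<tau>\<close>,
      the map that sends x to x_j u. So the sum \<open>?t\<close> acts as the coordinate expansion
      of \<open>g\<close>.\<close>
    have step: "\<tau> M (fr S n) (?k j u) x = x j \<odot>\<^bsub>CM\<^esub> u" if u: "u \<in> carrier T.T" for j u
    proof (rule T.T_hom_eq[OF ab_hom_comp[OF tensor_map_hom[OF CR cohom_left_module[OF free_S] M
            coord_smult_linmap] \<tau>_eval_hom[OF free_S x]] _ u])
      show "(\<lambda>u. x j \<odot>\<^bsub>CM\<^esub> u) \<in> ab_hom T.T T.T"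
        using smult_ab_hom[OF CM xj] by (simp add: ab_hom_def)
      fix c m assume c: "c \<in> carrier (opp_bimod C)" and m: "m \<in> carrier M"
      have kc: "coord_smult S C n j c \<in> mod_hom S (fr S n) C"
        using linmap_closed[OF coord_smult_linmap c] by simp
      have "\<tau> M (fr S n) (?k j (T.elt c m)) x = T.elt (x j \<odot>\<^bsub>C\<^esub> c) m"
        using \<tau>_elt[OF free_S kc m x] x
        by (simp add: tensor_map_elt[OF CR cohom_left_module[OF free_S] M coord_smult_linmap c m]
            coord_smult_def)
      also have "\<dots> = x j \<odot>\<^bsub>CM\<^esub> T.elt c m" using tensor_mod_smult_elt[OF M xj _ m] c by simp
      finally show "\<tau> M (fr S n) (?k j (T.elt c m)) x = x j \<odot>\<^bsub>CM\<^esub> T.elt c m" .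
    qed
    have "\<tau> M (fr S n) ?t x = (\<Oplus>\<^bsub>CM\<^esub>j\<in>{..<n}. \<tau> M (fr S n) (?k j (g (basis_vec S j))) x)"
      by (rule ab_hom_finsum[OF DM.T_ab CMg.abelian_group_axioms hom _ k]) simp
    also have "\<dots> = (\<Oplus>\<^bsub>CM\<^esub>j\<in>{..<n}. x j \<odot>\<^bsub>CM\<^esub> g (basis_vec S j))"
      using gb step left_module.smult_closed[OF CM xj gb]
      by (intro CMg.finsum_cong') (simp_all add: Pi_iff del: tensor_mod_simps(4))
    also have "\<dots> = g x" by (rule free_expand[OF CM g x, symmetric])
    finally show ?thesis .
  qed
  then show ?thesis using DM.T.finsum_closed[OF k] by blast
qed

end

end

section \<open>The map \<sigma> on finite free modules\<close>

context
  fixes N :: "('s, 'n, 'z) module_scheme"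
  assumes N: "left_module S N"
begin

abbreviation "H \<equiv> hom_mod S C N"
abbreviation "coD Q \<equiv> cohom (opp R) (opp_bimod C) Q"

lemma H: "left_module R H" by (rule hom_mod_left_module[OF N])

lemma coD: "left_module (opp R) Q \<Longrightarrow> left_module S (coD Q)"
  using bimod.cohom_left_module[OF swap] by simp

lemma H_pair: "left_module (opp R) Q \<Longrightarrow> tensor_pair R Q H"
  by (rule tensor_pair.intro[OF _ H])

lemma \<sigma>_balanced:
  fixes Q :: "('r, 'q, 'w) module_scheme"
  assumes Q: "left_module (opp R) Q"
  shows "balanced R Q H (hom_ab S (coD Q) N) (\<lambda>q h. \<lambda>f\<in>mod_hom (opp R) Q (opp_bimod C). h (f q))"
proof -
  interpret Q: abelian_group Q using Q by (rule module_abelian)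
  have fq: "f q \<in> carrier C" if "f \<in> mod_hom (opp R) Q (opp_bimod C)" "q \<in> carrier Q" for f q
    using mod_hom_closed[OF that] by simp
  have fadd: "f (q \<oplus>\<^bsub>Q\<^esub> q') = f q \<oplus>\<^bsub>C\<^esub> f q'"
    if "f \<in> mod_hom (opp R) Q (opp_bimod C)" "q \<in> carrier Q" "q' \<in> carrier Q" for f q q'
    using linmap_add[OF mod_hom_linmap[OF that(1)] that(2,3)] by simp
  have fsm: "f (r \<odot>\<^bsub>Q\<^esub> q) = rsmult C (f q) r"
    if "f \<in> mod_hom (opp R) Q (opp_bimod C)" "r \<in> carrier R" "q \<in> carrier Q" for f r q
    using linmap_smult[OF mod_hom_linmap[OF that(1)], of r q] that(2,3) by simp
  have hadd: "h (c \<oplus>\<^bsub>C\<^esub> c') = h c \<oplus>\<^bsub>N\<^esub> h c'"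
    if "h \<in> mod_hom S C N" "c \<in> carrier C" "c' \<in> carrier C" for h c c'
    by (rule linmap_add[OF mod_hom_linmap[OF that(1)] that(2,3)])
  have hsm: "h (s \<odot>\<^bsub>C\<^esub> c) = s \<odot>\<^bsub>N\<^esub> h c"
    if "h \<in> mod_hom S C N" "s \<in> carrier S" "c \<in> carrier C" for h s c
    by (rule linmap_smult[OF mod_hom_linmap[OF that(1)] that(2,3)])
  have lin: "(\<lambda>f. h (f q)) \<in> linmap S (coD Q) N" if h: "h \<in> mod_hom S C N" and q: "q \<in> carrier Q" for h q
    using h q fq mod_hom_closed[OF h]
    by (intro linmapI) (auto simp: hadd hsm simp del: mod_hom_opp)
  show ?thesis
    unfolding balanced_def
  proof (intro conjI ballI)
    fix q h assume "q \<in> carrier Q" "h \<in> carrier H"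
    then show "(\<lambda>f\<in>mod_hom (opp R) Q (opp_bimod C). h (f q)) \<in> carrier (hom_ab S (coD Q) N)"
      using linmap_restrict[OF coD[OF Q] lin[of h q]] by (simp del: mod_hom_opp)
  next
    fix q q' h assume "q \<in> carrier Q" "q' \<in> carrier Q" "h \<in> carrier H"
    then show "(\<lambda>f\<in>mod_hom (opp R) Q (opp_bimod C). h (f (q \<oplus>\<^bsub>Q\<^esub> q'))) =
        (\<lambda>f\<in>mod_hom (opp R) Q (opp_bimod C). h (f q)) \<oplus>\<^bsub>hom_ab S (coD Q) N\<^esub>
        (\<lambda>f\<in>mod_hom (opp R) Q (opp_bimod C). h (f q'))"
      by (auto simp: fadd hadd fq simp del: mod_hom_opp intro!: restrict_ext)
  next
    fix q h h' assume "q \<in> carrier Q" "h \<in> carrier H" "h' \<in> carrier H"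
    then show "(\<lambda>f\<in>mod_hom (opp R) Q (opp_bimod C). (h \<oplus>\<^bsub>H\<^esub> h') (f q)) =
        (\<lambda>f\<in>mod_hom (opp R) Q (opp_bimod C). h (f q)) \<oplus>\<^bsub>hom_ab S (coD Q) N\<^esub>
        (\<lambda>f\<in>mod_hom (opp R) Q (opp_bimod C). h' (f q))"
      by (auto simp: fq simp del: mod_hom_opp intro!: restrict_ext)
  next
    fix r q h assume "r \<in> carrier R" "q \<in> carrier Q" "h \<in> carrier H"
    then show "(\<lambda>f\<in>mod_hom (opp R) Q (opp_bimod C). h (f (r \<odot>\<^bsub>Q\<^esub> q))) =
        (\<lambda>f\<in>mod_hom (opp R) Q (opp_bimod C). (r \<odot>\<^bsub>H\<^esub> h) (f q))"
      by (auto simp: fq fsm simp del: mod_hom_opp intro!: restrict_ext)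
  qed
qed

lemma \<sigma>_hom:
  "left_module (opp R) Q \<Longrightarrow> \<sigma> N Q \<in> ab_hom (tensor_ab R Q H) (hom_ab S (coD Q) N)"
  unfolding \<sigma>_def
  by (rule tensor_pair.tensor_lift_hom[OF H_pair hom_ab_abelian[OF coD N] \<sigma>_balanced])

lemma \<sigma>_elt:
  assumes "left_module (opp R) Q" "q \<in> carrier Q" "h \<in> mod_hom S C N"
    "f \<in> mod_hom (opp R) Q (opp_bimod C)"
  shows "\<sigma> N Q (tensor_elt R Q H q h) f = h (f q)"
  unfolding \<sigma>_def
  using tensor_pair.tensor_lift_elt[OF H_pair hom_ab_abelian[OF coD N] \<sigma>_balanced, of Q q h] assms
  by simp

lemma \<sigma>_eval_hom:
  assumes "left_module (opp R) Q" "f \<in> mod_hom (opp R) Q (opp_bimod C)"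
  shows "(\<lambda>t. \<sigma> N Q t f) \<in> ab_hom (tensor_ab R Q H) N"
  by (rule ab_hom_comp[OF \<sigma>_hom[OF assms(1)] hom_ab_eval]) (use assms(2) in simp)

lemma \<sigma>_natural:
  assumes P: "left_module (opp R) P" and Q: "left_module (opp R) Q" and d: "d \<in> linmap R P Q"
    and t: "t \<in> carrier (tensor_ab R P H)" and f: "f \<in> mod_hom (opp R) Q (opp_bimod C)"
  shows "\<sigma> N Q (tensor_map R P Q H d t) f = \<sigma> N P t (compose (carrier P) f d)"
proof -
  have d': "d \<in> linmap (opp R) P Q" using d by simp
  have fd: "compose (carrier P) f d \<in> mod_hom (opp R) P (opp_bimod C)"
    by (rule compose_mod_hom[OF P d' f])
  show ?thesis
  proof (rule tensor_pair.T_hom_eq[OF H_pair[OF P] ab_hom_comp[OF tensor_map_hom[OF P Q H d]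
        \<sigma>_eval_hom[OF Q f]] \<sigma>_eval_hom[OF P fd] t])
    fix p h assume p: "p \<in> carrier P" and h: "h \<in> carrier H"
    then show "\<sigma> N Q (tensor_map R P Q H d (tensor_elt R P H p h)) f =
        \<sigma> N P (tensor_elt R P H p h) (compose (carrier P) f d)"
      using \<sigma>_elt[OF Q linmap_closed[OF d p] _ f] \<sigma>_elt[OF P p _ fd]
      by (simp add: tensor_map_elt[OF P Q H d p h] compose_def)
  qed
qed

context
  fixes n :: nat
begin

abbreviation "Qn \<equiv> fr (opp R) n"
abbreviation "co j \<equiv> coord_smult (opp R) (opp_bimod C) n j"

lemma Qn: "left_module (opp R) Qn" by (rule bimod.free_S[OF swap])

lemma co_linmap: "co j \<in> linmap S C (coD Qn)"
  using bimod.coord_smult_linmap[OF swap, of n j] by simp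

text \<open>The j-th component of G when maps out of the dual of \<open>Qn\<close>, a power of
  \<open>C\<close>, are read as tuples of maps out of \<open>C\<close>.\<close>

definition pull where "pull j = (\<lambda>G. compose (carrier C) G (co j))"

lemma pull_hom: "pull j \<in> ab_hom (hom_ab S (coD Qn) N) H"
proof -
  have "(\<lambda>G. compose (carrier C) G (co j)) \<in> ab_hom (hom_ab S (coD Qn) N) (hom_ab S C N)"
    by (rule precompose_hom[OF CS coD[OF Qn] co_linmap])
  then show ?thesis unfolding pull_def ab_hom_def by simp
qed

text \<open>The inverse of \<open>\<sigma>\<close> sends G to the sum of the basis vectors tensored
  with the components \<open>pull j G\<close>. For a pure tensor of q and h the j-th component is
  q_j h; moving q_j across the tensor sign reassembles q.\<close>

lemma \<sigma>_left_inverse: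
  assumes t: "t \<in> carrier (tensor_ab R Qn H)"
  shows "(\<Oplus>\<^bsub>tensor_ab R Qn H\<^esub>j\<in>{..<n}. tensor_elt R Qn H (basis_vec (opp R) j) (pull j (\<sigma> N Qn t))) = t"
proof -
  interpret QH: tensor_pair R Qn H by (rule H_pair[OF Qn])
  have b: "basis_vec (opp R) j \<in> carrier Qn" if "j \<in> {..<n}" for j
    by (rule basis_in_free[OF ring_opp[OF R] that])
  have id: "(\<lambda>t. t) \<in> ab_hom QH.T QH.T" by (simp add: ab_hom_def)
  have hom: "(\<lambda>t. \<Oplus>\<^bsub>QH.T\<^esub>j\<in>{..<n}. tensor_elt R Qn H (basis_vec (opp R) j) (pull j (\<sigma> N Qn t)))
      \<in> ab_hom QH.T QH.T"
    using ab_hom_comp[OF ab_hom_comp[OF \<sigma>_hom[OF Qn] pull_hom] QH.elt_right_hom[OF b]]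
    by (intro ab_hom_sum QH.T_ab) simp_all
  show ?thesis
  proof (rule QH.T_hom_eq[OF hom id t])
    fix q h assume q: "q \<in> carrier Qn" and h: "h \<in> carrier H"
    have qj: "q j \<in> carrier R" for j using q by (simp add: free_carrier_iff)
    have pull: "pull j (\<sigma> N Qn (tensor_elt R Qn H q h)) = q j \<odot>\<^bsub>H\<^esub> h" for j
    proof -
      have "\<sigma> N Qn (tensor_elt R Qn H q h) (co j c) = h (rsmult C c (q j))" if "c \<in> carrier C" for c
        using \<sigma>_elt[OF Qn q _, of h "co j c"] h linmap_closed[OF co_linmap that] q
        by (simp add: coord_smult_def)
      then show ?thesis by (auto simp: pull_def compose_def)
    qed
    have "(\<Oplus>\<^bsub>QH.T\<^esub>j\<in>{..<n}. tensor_elt R Qn H (basis_vec (opp R) j)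
         (pull j (\<sigma> N Qn (tensor_elt R Qn H q h)))) =
       (\<Oplus>\<^bsub>QH.T\<^esub>j\<in>{..<n}. tensor_elt R Qn H (q j \<odot>\<^bsub>Qn\<^esub> basis_vec (opp R) j) h)"
    proof (rule QH.T.finsum_cong')
      show "(\<lambda>j. tensor_elt R Qn H (q j \<odot>\<^bsub>Qn\<^esub> basis_vec (opp R) j) h) \<in> {..<n} \<rightarrow> carrier QH.T"
        using b h qj left_module.smult_closed[OF Qn] by (intro Pi_I QH.elt_closed) auto
      show "tensor_elt R Qn H (basis_vec (opp R) j) (pull j (\<sigma> N Qn (tensor_elt R Qn H q h))) =
          tensor_elt R Qn H (q j \<odot>\<^bsub>Qn\<^esub> basis_vec (opp R) j) h" if "j \<in> {..<n}" for j
        unfolding pull by (rule QH.elt_smult[OF qj b[OF that] h, symmetric])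
    qed simp
    also have "\<dots> = tensor_elt R Qn H (\<Oplus>\<^bsub>Qn\<^esub>j\<in>{..<n}. q j \<odot>\<^bsub>Qn\<^esub> basis_vec (opp R) j) h"
      using b qj left_module.smult_closed[OF Qn]
      by (intro ab_hom_finsum[OF QH.A.abelian_group_axioms QH.T_ab QH.elt_left_hom[OF h], symmetric]) auto
    also have "(\<Oplus>\<^bsub>Qn\<^esub>j\<in>{..<n}. q j \<odot>\<^bsub>Qn\<^esub> basis_vec (opp R) j) = q"
      by (rule free_expand[OF Qn linmap_id q, symmetric])
    finally show "(\<Oplus>\<^bsub>QH.T\<^esub>j\<in>{..<n}. tensor_elt R Qn H (basis_vec (opp R) j)
         (pull j (\<sigma> N Qn (tensor_elt R Qn H q h)))) = tensor_elt R Qn H q h" .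
  qed
qed

lemma \<sigma>_inj:
  assumes "t \<in> carrier (tensor_ab R Qn H)" "t' \<in> carrier (tensor_ab R Qn H)"
    and "\<And>f. f \<in> mod_hom (opp R) Qn (opp_bimod C) \<Longrightarrow> \<sigma> N Qn t f = \<sigma> N Qn t' f"
  shows "t = t'"
proof -
  have eq: "\<sigma> N Qn t = \<sigma> N Qn t'"
    using ab_hom_closed[OF \<sigma>_hom[OF Qn] assms(1)] ab_hom_closed[OF \<sigma>_hom[OF Qn] assms(2)] assms(3)
    by (intro mod_hom_eqI[of _ S "coD Qn" N]) simp_all
  show ?thesis
    by (rule \<sigma>_left_inverse[OF assms(1), unfolded eq \<sigma>_left_inverse[OF assms(2)], symmetric])
qed

text \<open>The candidate is the sum given by the inverse. Evaluated at f it yields the sum of the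
  values of G at the coordinate parts of f, which is G f by additivity and
  \<open>cohom_expand\<close> for the opposite bimodule.\<close>

lemma \<sigma>_surj:
  assumes G: "G \<in> linmap S (coD Qn) N"
  shows "\<exists>t\<in>carrier (tensor_ab R Qn H). \<forall>f\<in>mod_hom (opp R) Qn (opp_bimod C). \<sigma> N Qn t f = G f"
proof -
  interpret QH: tensor_pair R Qn H by (rule H_pair[OF Qn])
  interpret Ng: abelian_group N by (rule module_abelian[OF N])
  have b: "basis_vec (opp R) j \<in> carrier Qn" if "j \<in> {..<n}" for j
    by (rule basis_in_free[OF ring_opp[OF R] that])
  let ?u = "\<lambda>j. tensor_elt R Qn H (basis_vec (opp R) j) (pull j G)"
  have pull: "pull j G \<in> carrier H" for j
    unfolding pull_def compose_def using linmap_restrict[OF CS linmap_comp[OF co_linmap G]] by simp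
  have u: "?u \<in> {..<n} \<rightarrow> carrier QH.T" using b pull by (intro Pi_I QH.elt_closed)
  let ?t = "\<Oplus>\<^bsub>QH.T\<^esub>j\<in>{..<n}. ?u j"
  have "\<sigma> N Qn ?t f = G f" if f: "f \<in> mod_hom (opp R) Qn (opp_bimod C)" for f
  proof -
    have fb: "f (basis_vec (opp R) j) \<in> carrier C" if "j \<in> {..<n}" for j
      using mod_hom_closed[OF f b[OF that]] by simp
    have cof: "co j (f (basis_vec (opp R) j)) \<in> carrier (coD Qn)" if "j \<in> {..<n}" for j
      by (rule linmap_closed[OF co_linmap fb[OF that]])
    have "\<sigma> N Qn ?t f = (\<Oplus>\<^bsub>N\<^esub>j\<in>{..<n}. \<sigma> N Qn (?u j) f)"
      by (rule ab_hom_finsum[OF QH.T_ab Ng.abelian_group_axioms \<sigma>_eval_hom[OF Qn f] _ u]) simp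
    also have "\<dots> = (\<Oplus>\<^bsub>N\<^esub>j\<in>{..<n}. G (co j (f (basis_vec (opp R) j))))"
    proof (rule Ng.finsum_cong')
      show "(\<lambda>j. G (co j (f (basis_vec (opp R) j)))) \<in> {..<n} \<rightarrow> carrier N"
        using linmap_closed[OF G cof] by (intro Pi_I)
      show "\<sigma> N Qn (?u j) f = G (co j (f (basis_vec (opp R) j)))" if j: "j \<in> {..<n}" for j
        using \<sigma>_elt[OF Qn b[OF j] _ f, of "pull j G"] pull fb[OF j] by (simp add: pull_def compose_def)
    qed simp
    also have "\<dots> = G (\<Oplus>\<^bsub>coD Qn\<^esub>j\<in>{..<n}. co j (f (basis_vec (opp R) j)))"
      using cof
      by (intro ab_hom_finsum[OF module_abelian[OF coD[OF Qn]] Ng.abelian_group_axioms linmap_ab_hom[OF G],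
            symmetric]) auto
    also have "(\<Oplus>\<^bsub>coD Qn\<^esub>j\<in>{..<n}. co j (f (basis_vec (opp R) j))) = f"
      by (rule bimod.cohom_expand[OF swap f, symmetric])
    finally show ?thesis .
  qed
  then show ?thesis using QH.T.finsum_closed[OF u] by blast
qed

end

end

end

section \<open>The Auslander and Bass classes\<close>

lemma opp_opp: "opp (opp R) = R"
  by simp

text \<open>Higher degrees reduce to degree one because the syzygies of \<open>A\<close> are again
  super finitely presented. Exactness in degree j + 1 rests on the image of
  \<open>d (j - 1)\<close>, and for j = 0 on \<open>A\<close> itself, the image of
  \<open>e\<close>.\<close>

lemma weak_flat_Tor_all:
  assumes M: "weak_flat R M" and A: "super_fin_pres (opp R) A"
  shows "trivial_group (Tor R A M (Suc j))"
proof -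
  have Mm: "left_module R M" using M by (simp add: weak_flat_def)
  obtain k d e where res: "resolution (opp R) A (\<lambda>i. fr (opp R) (k i)) d e"
    by (rule sfp_free_resolution[OF A])
  interpret Q: resolution "opp R" A "\<lambda>i. fr (opp R) (k i)" d e by (rule res)
  have d: "d i \<in> linmap R (fr (opp R) (k (Suc i))) (fr (opp R) (k i))" for i using Q.d[of i] by simp
  have e: "e \<in> linmap R (fr (opp R) (k 0)) A" using Q.e by simp
  have fg: "fin_gen (opp R) (fr (opp R) (k i))" for i by (rule fin_gen_free[OF module_ring[OF Q.M]])
  have "tensor_exact R M (\<lambda>i. fr (opp R) (k i)) d j"
    unfolding tensor_exact_def
  proof (intro ballI impI)
    fix t assume t: "t \<in> carrier (tensor_ab R (fr (opp R) (k (Suc j))) M)"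
      and z: "tensor_map R (fr (opp R) (k (Suc j))) (fr (opp R) (k j)) M (d j) t =
        \<zero>\<^bsub>tensor_ab R (fr (opp R) (k j)) M\<^esub>"
    show "t \<in> tensor_map R (fr (opp R) (k (Suc (Suc j)))) (fr (opp R) (k (Suc j))) M (d (Suc j)) `
        carrier (tensor_ab R (fr (opp R) (k (Suc (Suc j)))) M)"
    proof (cases j)
      case 0
      have "super_fin_pres (opp R) (A\<lparr>carrier := e ` carrier (fr (opp R) (k 0))\<rparr>)"
        using A by (simp add: Q.e_surj)
      then show ?thesis
        using weak_flat_exact[OF M Q.mod Q.mod Q.mod Q.M d d e _ Q.ex0[symmetric] _ t[unfolded 0] z[unfolded 0]]
          Q.exS[of 0] 0 by simp
    next
      case (Suc i)
      show ?thesis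
        using weak_flat_exact[OF M Q.mod Q.mod Q.mod Q.mod d d d _ Q.exS[symmetric] sfp_image[OF res fg]
            t[unfolded Suc] z[unfolded Suc]]
          Q.exS[of "Suc i"] Suc by simp
    qed
  qed
  then show ?thesis using Tor_trivial_iff_resolution[OF res Mm] by simp
qed

lemma weak_injective_Ext_all:
  assumes N: "weak_injective R N" and A: "super_fin_pres R A"
  shows "trivial_group (Ext R A N (Suc j))"
proof -
  have Nm: "left_module R N" using N by (simp add: weak_injective_def)
  obtain k d e where res: "resolution R A (\<lambda>i. fr R (k i)) d e"
    by (rule sfp_free_resolution[OF A])
  interpret Q: resolution R A "\<lambda>i. fr R (k i)" d e by (rule res)
  have fg: "fin_gen R (fr R (k i))" for i by (rule fin_gen_free[OF module_ring[OF Q.M]])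
  have "hom_exact R N (\<lambda>i. fr R (k i)) d j"
    unfolding hom_exact_def
  proof (intro ballI impI)
    fix f assume f: "f \<in> linmap R (fr R (k (Suc j))) N"
      and "\<forall>x\<in>carrier (fr R (k (Suc (Suc j)))). f (d (Suc j) x) = \<zero>\<^bsub>N\<^esub>"
    then have z: "f x = \<zero>\<^bsub>N\<^esub>" if "x \<in> mod_ker (fr R (k (Suc j))) (fr R (k j)) (d j)" for x
      using that unfolding Q.exS[symmetric] by blast
    show "\<exists>g\<in>linmap R (fr R (k j)) N. \<forall>x\<in>carrier (fr R (k (Suc j))). f x = g (d j x)"
    proof (cases j)
      case 0
      have "super_fin_pres R (A\<lparr>carrier := e ` carrier (fr R (k 0))\<rparr>)"
        using A by (simp add: Q.e_surj)
      then show ?thesis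
        using weak_injective_exact[OF N Q.mod Q.mod Q.M Q.d Q.e Q.ex0[symmetric] _ f[unfolded 0]] z
        unfolding 0 by blast
    next
      case (Suc i)
      show ?thesis
        using weak_injective_exact[OF N Q.mod Q.mod Q.mod Q.d Q.d Q.exS[symmetric] sfp_image[OF res fg]
            f[unfolded Suc]] z
        unfolding Suc by blast
    qed
  qed
  then show ?thesis using Ext_trivial_iff_resolution[OF res Nm] by simp
qed

section \<open>The Auslander class\<close>

context semidual
begin

context
  fixes M :: "('r, 'm) module"
  assumes wf: "weak_flat R M"
begin

lemma Mm: "left_module R M" using wf by (simp add: weak_flat_def)

abbreviation "CT \<equiv> tensor_mod R C M"

lemma CT: "left_module S CT" by (rule tensor_mod_left_module[OF Mm])

lemma DM_pair: "tensor_pair R (D i) M" by (rule tensor_pair.intro[OF D Mm])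

lemma \<tau>_\<delta>:
  assumes "t \<in> carrier (tensor_ab R (D i) M)" "x \<in> carrier (P (Suc i))"
  shows "\<tau> M (P (Suc i)) (tensor_map R (D i) (D (Suc i)) M (\<delta> i) t) x = \<tau> M (P i) t (d i x)"
proof -
  have eq: "\<delta> i = (\<lambda>f. compose (carrier (P (Suc i))) f (d i))" by (simp add: \<delta>_def fun_eq_iff)
  show ?thesis unfolding eq by (rule \<tau>_natural[OF Mm free_S free_S P.d assms])
qed

text \<open>Injectivity of \<open>\<tau>\<close> translates the cocycle condition in the complex of
  maps from \<open>P\<close> to \<open>C \<otimes> M\<close> into the cycle condition in the dual
  complex tensored with \<open>M\<close>.\<close>

lemma \<delta>_tensor_zero:
  assumes t: "t \<in> carrier (tensor_ab R (D i) M)"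
    and z: "\<And>x. x \<in> carrier (P (Suc i)) \<Longrightarrow> \<tau> M (P i) t (d i x) = \<zero>\<^bsub>CT\<^esub>"
  shows "tensor_map R (D i) (D (Suc i)) M (\<delta> i) t = \<zero>\<^bsub>tensor_ab R (D (Suc i)) M\<^esub>"
proof (rule \<tau>_inj[OF Mm])
  interpret DM: tensor_pair R "D (Suc i)" M by (rule DM_pair)
  show "tensor_map R (D i) (D (Suc i)) M (\<delta> i) t \<in> carrier (tensor_ab R (D (Suc i)) M)"
    by (rule ab_hom_closed[OF tensor_map_hom[OF D D Mm \<delta>] t])
  show "\<zero>\<^bsub>tensor_ab R (D (Suc i)) M\<^esub> \<in> carrier (tensor_ab R (D (Suc i)) M)" by simp
  fix x assume x: "x \<in> carrier (P (Suc i))"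
  have "\<tau> M (P (Suc i)) \<zero>\<^bsub>tensor_ab R (D (Suc i)) M\<^esub> x = \<zero>\<^bsub>tensor_ab R (opp_bimod C) M\<^esub>"
    by (rule ab_hom_zero[OF DM.T_ab tensor_pair.T_ab[OF tensor_pair_C[OF Mm]] \<tau>_eval_hom[OF Mm free_S x]])
  then show "\<tau> M (P (Suc i)) (tensor_map R (D i) (D (Suc i)) M (\<delta> i) t) x =
      \<tau> M (P (Suc i)) \<zero>\<^bsub>tensor_ab R (D (Suc i)) M\<^esub> x"
    using \<tau>_\<delta>[OF t x] z[OF x] by simp
qed

text \<open>Through \<open>\<tau>\<close> the complex that computes these Ext groups is
  \<open>D \<otimes> M\<close>, and weak flatness makes it exact since all images in
  \<open>D\<close> are super finitely presented.\<close>

lemma auslander_Ext: "trivial_group (Ext S C CT (Suc j))"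
proof -
  have "hom_exact S CT P d j"
    unfolding hom_exact_def
  proof (intro ballI impI)
    fix f assume f: "f \<in> linmap S (P (Suc j)) CT"
      and z: "\<forall>x\<in>carrier (P (Suc (Suc j))). f (d (Suc j) x) = \<zero>\<^bsub>CT\<^esub>"
    obtain t where t: "t \<in> carrier (tensor_ab R (D (Suc j)) M)"
      and tf: "\<And>x. x \<in> carrier (P (Suc j)) \<Longrightarrow> \<tau> M (P (Suc j)) t x = f x"
      using \<tau>_surj[OF Mm f] by blast
    have "tensor_map R (D (Suc j)) (D (Suc (Suc j))) M (\<delta> (Suc j)) t = \<zero>\<^bsub>tensor_ab R (D (Suc (Suc j))) M\<^esub>"
      using z tf linmap_closed[OF P.d] by (intro \<delta>_tensor_zero[OF t]) metis
    then have "t \<in> tensor_map R (D j) (D (Suc j)) M (\<delta> j) ` carrier (tensor_ab R (D j) M)"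
      by (intro weak_flat_exact[OF wf D D D D \<delta> \<delta> \<delta> _ exact_Suc sfp_coimage t]) (simp only: exact_Suc)
    then obtain w where w: "w \<in> carrier (tensor_ab R (D j) M)"
      and tw: "t = tensor_map R (D j) (D (Suc j)) M (\<delta> j) w" by blast
    have "\<tau> M (P j) w \<in> linmap S (P j) CT"
      using ab_hom_closed[OF \<tau>_hom[OF Mm free_S] w] by (simp add: mod_hom_linmap)
    moreover have "f x = \<tau> M (P j) w (d j x)" if "x \<in> carrier (P (Suc j))" for x
      using tf[OF that] \<tau>_\<delta>[OF w that] tw by simp
    ultimately show "\<exists>g\<in>linmap S (P j) CT. \<forall>x\<in>carrier (P (Suc j)). f x = g (d j x)"
      by (intro bexI[of _ "\<tau> M (P j) w"] ballI)
  qed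
  then show ?thesis using Ext_trivial_iff_resolution[OF res CT] by simp
qed

abbreviation "RR \<equiv> regular_module (opp R)"

lemma RM_pair: "tensor_pair R RR M" by (rule tensor_pair.intro[OF reg Mm])

text \<open>Together with \<open>regular_tensor_inj\<close> this is the isomorphism of
  \<open>R \<otimes> M\<close> with \<open>M\<close>, split into the two halves that are used: every
  tensor has the form 1 \<otimes> m, and m is determined by it.\<close>

lemma regular_tensor:
  assumes "t \<in> carrier (tensor_ab R RR M)"
  shows "\<exists>m\<in>carrier M. t = tensor_elt R RR M \<one>\<^bsub>R\<^esub> m"
proof -
  interpret RM: tensor_pair R RR M by (rule RM_pair)
  interpret R: ring R by (rule R)
  show ?thesis using assms
  proof (induction t rule: RM.T_induct)
    case (elt a m)
    then have "tensor_elt R RR M (a \<odot>\<^bsub>RR\<^esub> \<one>\<^bsub>R\<^esub>) m = tensor_elt R RR M \<one>\<^bsub>R\<^esub> (a \<odot>\<^bsub>M\<^esub> m)"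
      by (intro RM.elt_smult) auto
    then show ?case using elt left_module.smult_closed[OF Mm, of a m] by auto
  next
    case (add s t)
    then obtain m m' where m: "m \<in> carrier M" "m' \<in> carrier M"
      "s = tensor_elt R RR M \<one>\<^bsub>R\<^esub> m" "t = tensor_elt R RR M \<one>\<^bsub>R\<^esub> m'" by blast
    then show ?case using RM.elt_add_right[of "\<one>\<^bsub>R\<^esub>" m m'] by auto
  qed
qed

lemma regular_tensor_inj:
  assumes m: "m \<in> carrier M" and z: "tensor_elt R RR M \<one>\<^bsub>R\<^esub> m = \<zero>\<^bsub>tensor_ab R RR M\<^esub>"
  shows "m = \<zero>\<^bsub>M\<^esub>"
proof -
  interpret RM: tensor_pair R RR M by (rule RM_pair)
  interpret R: ring R by (rule R)
  have bal: "balanced R RR M M (\<lambda>a m. a \<odot>\<^bsub>M\<^esub> m)"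
    using left_module.smult_closed[OF Mm] left_module.smult_l_distr[OF Mm]
      left_module.smult_r_distr[OF Mm] left_module.smult_assoc1[OF Mm]
    by (simp add: balanced_def)
  note L = RM.tensor_lift_hom[OF module_abelian[OF Mm] bal]
  have "tensor_lift R RR M M (\<lambda>a m. a \<odot>\<^bsub>M\<^esub> m) (tensor_elt R RR M \<one>\<^bsub>R\<^esub> m) = m"
    using RM.tensor_lift_elt[OF module_abelian[OF Mm] bal, of "\<one>\<^bsub>R\<^esub>" m] m left_module.smult_one[OF Mm m] by simp
  then show ?thesis unfolding z using ab_hom_zero[OF RM.T_ab module_abelian[OF Mm] L] by simp
qed

text \<open>Under \<open>\<tau>\<close> the coaugmentation tensored with \<open>M\<close> becomes
  \<open>auslander_eval\<close> followed by precomposition with \<open>e\<close>. This links the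
  evaluation map to the start of the tensored dual complex.\<close>

lemma \<tau>_\<epsilon>:
  assumes m: "m \<in> carrier M" and x: "x \<in> carrier (P 0)"
  shows "\<tau> M (P 0) (tensor_map R RR (D 0) M \<epsilon> (tensor_elt R RR M \<one>\<^bsub>R\<^esub> m)) x =
     tensor_elt R (opp_bimod C) M (e x) m"
proof -
  interpret R: ring R by (rule R)
  have one: "\<one>\<^bsub>R\<^esub> \<in> carrier RR" by simp
  have \<epsilon>1: "\<epsilon> \<one>\<^bsub>R\<^esub> \<in> mod_hom S (P 0) C" using linmap_closed[OF \<epsilon> one] by simp
  show ?thesis
    unfolding tensor_map_elt[OF reg D Mm \<epsilon> one m] \<tau>_elt[OF Mm free_S \<epsilon>1 m x]
    using x linmap_closed[OF P.e x] by (simp add: \<epsilon>_def r_one)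
qed

text \<open>Bijectivity is the exactness of the tensored dual complex at its first two terms
  \<open>R \<otimes> M\<close> and \<open>D 0 \<otimes> M\<close>, carried over to maps on
  \<open>P 0\<close> by \<open>\<tau>\<close>.\<close>

lemma auslander_eval_iso: "auslander_eval R C M \<in> mod_iso R M (hom_mod S C CT)"
proof -
  interpret T: tensor_pair R "opp_bimod C" M by (rule tensor_pair_C[OF Mm])
  interpret RM: tensor_pair R RR M by (rule RM_pair)
  interpret D0M: tensor_pair R "D 0" M by (rule DM_pair)
  interpret R: ring R by (rule R)
  let ?\<mu> = "auslander_eval R C M" and ?H = "hom_mod S C CT"
  have H: "left_module R ?H" by (rule hom_mod_left_module[OF CT])
  have \<mu>: "?\<mu> m c = tensor_elt R (opp_bimod C) M c m" if "m \<in> carrier M" "c \<in> carrier C" for m c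
    using that by (simp add: auslander_eval_def)
  have \<mu>m: "?\<mu> m \<in> carrier ?H" if m: "m \<in> carrier M" for m
  proof -
    have "(\<lambda>c. tensor_elt R (opp_bimod C) M c m) \<in> linmap S C CT"
      by (rule linmapI)
        (use m T.elt_closed T.elt_add_left tensor_mod_smult_elt[OF Mm] in
          \<open>simp_all del: tensor_mod_simps(4)\<close>)
    then show ?thesis using m linmap_restrict[OF CS] by (simp add: auslander_eval_def)
  qed
  have lin: "?\<mu> \<in> linmap R M ?H"
  proof (rule linmapI[OF \<mu>m])
    fix m m' assume "m \<in> carrier M" "m' \<in> carrier M"
    then show "?\<mu> (m \<oplus>\<^bsub>M\<^esub> m') = ?\<mu> m \<oplus>\<^bsub>?H\<^esub> ?\<mu> m'"
      using T.elt_add_right by (auto simp: auslander_eval_def intro!: restrict_ext)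
  next
    fix r m assume "r \<in> carrier R" "m \<in> carrier M"
    then show "?\<mu> (r \<odot>\<^bsub>M\<^esub> m) = r \<odot>\<^bsub>?H\<^esub> ?\<mu> m"
      using T.elt_smult[of r _ m] left_module.smult_closed[OF Mm, of r m] r_closed
      by (auto simp: auslander_eval_def intro!: restrict_ext)
  qed
  have ker: "m = \<zero>\<^bsub>M\<^esub>" if m: "m \<in> carrier M" and z: "?\<mu> m = \<zero>\<^bsub>?H\<^esub>" for m
  proof -
    let ?t = "tensor_elt R RR M \<one>\<^bsub>R\<^esub> m"
    have t: "?t \<in> carrier RM.T" using m by (intro RM.elt_closed) auto
    have "tensor_elt R (opp_bimod C) M c m = \<zero>\<^bsub>CT\<^esub>" if "c \<in> carrier C" for c
      using \<mu>[OF m that] fun_cong[OF z, of c] that by simp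
    then have "\<tau> M (P 0) (tensor_map R RR (D 0) M \<epsilon> ?t) x = \<tau> M (P 0) \<zero>\<^bsub>D0M.T\<^esub> x"
      if x: "x \<in> carrier (P 0)" for x
      using \<tau>_\<epsilon>[OF m x] linmap_closed[OF P.e x] ab_hom_zero[OF D0M.T_ab T.T_ab \<tau>_eval_hom[OF Mm free_S x]]
      by simp
    then have "tensor_map R RR (D 0) M \<epsilon> ?t = \<zero>\<^bsub>D0M.T\<^esub>"
      using ab_hom_closed[OF tensor_map_hom[OF reg D Mm \<epsilon>] t] by (intro \<tau>_inj[OF Mm]) auto
    \<comment> \<open>Injectivity of \<open>\<epsilon> \<otimes> M\<close> is obtained from
      \<open>weak_flat_exact\<close> by putting the zero map of \<open>RR\<close> in front: the
      kernel then lies in the image of zero.\<close>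
    moreover have "mod_ker RR (D 0) \<epsilon> \<subseteq> (\<lambda>_. \<zero>\<^bsub>RR\<^esub>) ` carrier RR"
      using \<epsilon>_inj by (auto simp: mod_ker_def simp del: cohom_simps(2))
    moreover have "mod_ker (D 0) (D (Suc 0)) (\<delta> 0) = \<epsilon> ` carrier RR" using exact_0 by simp
    moreover have zl: "(\<lambda>_. \<zero>\<^bsub>RR\<^esub>) \<in> linmap R RR RR" using linmap_const_zero[OF reg] by simp
    ultimately have "?t \<in> tensor_map R RR RR M (\<lambda>_. \<zero>\<^bsub>RR\<^esub>) ` carrier RM.T"
      by (intro weak_flat_exact[OF wf reg reg D D _ \<epsilon> \<delta> _ _ sfp_coimage t])
    then have "?t = \<zero>\<^bsub>RM.T\<^esub>"
      using tensor_map_zero[OF reg reg Mm zl refl] by auto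
    then show ?thesis by (rule regular_tensor_inj[OF m])
  qed
  have "bij_betw ?\<mu> (carrier M) (carrier ?H)"
    unfolding bij_betw_def
  proof
    show "inj_on ?\<mu> (carrier M)"
    proof (rule inj_onI)
      fix m m' assume m: "m \<in> carrier M" "m' \<in> carrier M" "?\<mu> m = ?\<mu> m'"
      then have "m \<ominus>\<^bsub>M\<^esub> m' \<in> mod_ker M ?H ?\<mu>" using linmap_eq_iff_ker[OF Mm H lin] by blast
      then have "m \<ominus>\<^bsub>M\<^esub> m' = \<zero>\<^bsub>M\<^esub>" using ker by (auto simp: mod_ker_def simp del: hom_mod_simps)
      then show "m = m'" using m T.M.minus_zero_iff by blast
    qed
    show "?\<mu> ` carrier M = carrier ?H"
    proof
      show "?\<mu> ` carrier M \<subseteq> carrier ?H" using \<mu>m by blast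
      show "carrier ?H \<subseteq> ?\<mu> ` carrier M"
      proof
        fix g assume "g \<in> carrier ?H"
        then have g: "g \<in> mod_hom S C CT" by simp
        \<comment> \<open>The tensor represents the composite of \<open>g\<close> with
          \<open>e\<close>. As \<open>e d\<close> is zero, \<open>t\<close> is a cycle and therefore
          comes from \<open>R \<otimes> M\<close>, that is, from some m; surjectivity of
          \<open>e\<close> then gives equality with the evaluation at m.\<close>
        obtain t where t: "t \<in> carrier D0M.T" and tg: "\<And>x. x \<in> carrier (P 0) \<Longrightarrow> \<tau> M (P 0) t x = g (e x)"
          using \<tau>_surj[OF Mm linmap_comp[OF P.e mod_hom_linmap[OF g]]] by blast
        have "\<tau> M (P 0) t (d 0 x) = \<zero>\<^bsub>CT\<^esub>" if "x \<in> carrier (P (Suc 0))" for x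
          using tg[OF linmap_closed[OF P.d that]] P.ed[OF that] linmap_zero[OF CS CT mod_hom_linmap[OF g]]
          by simp
        then have "tensor_map R (D 0) (D (Suc 0)) M (\<delta> 0) t = \<zero>\<^bsub>tensor_ab R (D (Suc 0)) M\<^esub>"
          by (rule \<delta>_tensor_zero[OF t])
        then have "t \<in> tensor_map R RR (D 0) M \<epsilon> ` carrier RM.T"
          using exact_0 by (intro weak_flat_exact[OF wf reg D D D \<epsilon> \<delta> \<delta> _ exact_Suc sfp_coimage t]) simp_all
        then obtain m where m: "m \<in> carrier M"
          and tm: "t = tensor_map R RR (D 0) M \<epsilon> (tensor_elt R RR M \<one>\<^bsub>R\<^esub> m)"
          using regular_tensor by blast
        have "g = ?\<mu> m"
        proof (rule mod_hom_eqI[OF g])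
          show "?\<mu> m \<in> mod_hom S C CT" using \<mu>m[OF m] by simp
          fix c assume c: "c \<in> carrier C"
          then obtain x where x: "x \<in> carrier (P 0)" "c = e x" unfolding P.e_surj[symmetric] by blast
          show "g c = ?\<mu> m c" using tg[OF x(1)] \<tau>_\<epsilon>[OF m x(1)] \<mu>[OF m c] x(2) tm by simp
        qed
        then show "g \<in> ?\<mu> ` carrier M" using m by blast
      qed
    qed
  qed
  moreover have "?\<mu> \<in> mod_hom R M ?H" using lin by (simp add: mod_hom_iff auslander_eval_def)
  ultimately show ?thesis by (simp add: mod_iso_def)
qed

end

end

lemma all_ge_1_iff: "(\<forall>i\<ge>1. Q i) \<longleftrightarrow> (\<forall>j. Q (Suc j))"
  by (auto simp: Suc_le_eq gr0_conv_Suc)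

lemma auslander_contains_weak_flat:
  assumes C: "semidualizing S R C" and M: "weak_flat R M"
  shows "M \<in> auslander_class S R C"
proof -
  have "super_fin_pres S C" "super_fin_pres (opp R) (opp_bimod C)" "is_bimodule S R C"
    using C by (simp_all add: semidualizing_def)
  moreover from this obtain k d e where "resolution S C (\<lambda>i. fr S (k i)) d e"
    using sfp_free_resolution by blast
  ultimately interpret semidual S R C k d e
    using C by (intro semidual.intro bimod.intro semidual_axioms.intro)
  show ?thesis
    unfolding auslander_class_def
    using M auslander_Ext[OF M] auslander_eval_iso[OF M]
      weak_flat_Tor_all[OF M \<open>super_fin_pres (opp R) (opp_bimod C)\<close>]
    by (simp only: all_ge_1_iff weak_flat_def mem_Collect_eq simp_thms)
qed

section \<open>The Bass class\<close>

lemma tensor_map_surj: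
  assumes A: "left_module (opp R) A" and B: "left_module (opp R) B" and M: "left_module R M"
    and f: "f \<in> linmap R A B" and surj: "f ` carrier A = carrier B"
    and u: "u \<in> carrier (tensor_ab R B M)"
  shows "\<exists>t\<in>carrier (tensor_ab R A M). tensor_map R A B M f t = u"
proof -
  interpret A: tensor_pair R A M by (rule tensor_pair.intro) fact+
  interpret B: tensor_pair R B M by (rule tensor_pair.intro) fact+
  note tm = tensor_map_hom[OF A B M f]
  show ?thesis using u
  proof (induction u rule: B.T_induct)
    case (elt b m)
    then obtain a where "a \<in> carrier A" "b = f a" unfolding surj[symmetric] by blast
    then show ?case using tensor_map_elt[OF A B M f _ elt(2)] A.elt_closed[OF _ elt(2)] by blast
  next
    case (add s t)
    then obtain s' t' where "s' \<in> carrier A.T" "t' \<in> carrier A.T"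
      "tensor_map R A B M f s' = s" "tensor_map R A B M f t' = t" by blast
    then show ?case using ab_hom_add[OF tm] by (intro bexI[of _ "s' \<oplus>\<^bsub>A.T\<^esub> t'"]) auto
  qed
qed

context bimod
begin

context
  fixes N :: "('s, 'n) module" and k d e
  assumes wi: "weak_injective S N" and sw: "semidual (opp R) (opp S) (opp_bimod C) k d e"
begin

lemma Nm: "left_module S N" using wi by (simp add: weak_injective_def)

abbreviation "HN \<equiv> hom_mod S C N"
abbreviation "Q i \<equiv> fr (opp R) (k i)"
abbreviation "dQ i \<equiv> cohom (opp R) (opp_bimod C) (Q i)"

lemma HN: "left_module R HN" by (rule hom_mod_left_module[OF Nm])

interpretation sw: semidual "opp R" "opp S" "opp_bimod C" k d e by (rule sw)

lemma Qm: "left_module (opp R) (Q i)" by (rule sw.free_S)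

lemma dQ: "left_module S (dQ i)" using sw.D[of i] by simp

lemma dR: "d i \<in> linmap R (Q (Suc i)) (Q i)" using sw.P.d[of i] by simp

lemma eR: "e \<in> linmap R (Q 0) (opp_bimod C)" using sw.P.e by simp

text \<open>The terms \<open>dQ i\<close> are the duals of a resolution \<open>Q\<close> of the
  right module \<open>C\<close>, with differentials \<open>sw.\<delta>\<close>. By this square
  \<open>\<sigma>\<close> identifies \<open>Q \<otimes> HN\<close> with the complex of maps from
  \<open>dQ\<close> to \<open>N\<close>.\<close>

lemma \<sigma>_d:
  assumes "t \<in> carrier (tensor_ab R (Q (Suc i)) HN)" "f \<in> mod_hom (opp R) (Q i) (opp_bimod C)"
  shows "\<sigma> N (Q i) (tensor_map R (Q (Suc i)) (Q i) HN (d i) t) f = \<sigma> N (Q (Suc i)) t (sw.\<delta> i f)"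
  using \<sigma>_natural[OF Nm Qm Qm dR assms] by (simp add: sw.\<delta>_def)

lemma \<sigma>_linmap:
  "t \<in> carrier (tensor_ab R (Q i) HN) \<Longrightarrow> \<sigma> N (Q i) t \<in> linmap S (dQ i) N"
  using ab_hom_closed[OF \<sigma>_hom[OF Nm Qm]] by (auto dest: mod_hom_linmap)

text \<open>Seen through \<open>\<sigma>\<close>, \<open>t\<close> is a map on \<open>dQ i\<close>
  that vanishes on the kernel of the differential. Weak injectivity makes it factor through
  \<open>dQ (i + 1)\<close>, and surjectivity of \<open>\<sigma>\<close> realizes the factor by a
  tensor. Degree 0 is included, as needed for the evaluation map.\<close>

lemma \<sigma>_factor:
  assumes t: "t \<in> carrier (tensor_ab R (Q i) HN)"
    and z: "\<And>f. f \<in> mod_ker (dQ i) (dQ (Suc i)) (sw.\<delta> i) \<Longrightarrow> \<sigma> N (Q i) t f = \<zero>\<^bsub>N\<^esub>"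
  shows "t \<in> tensor_map R (Q (Suc i)) (Q i) HN (d i) ` carrier (tensor_ab R (Q (Suc i)) HN)"
proof -
  have \<delta>: "sw.\<delta> i \<in> linmap S (dQ i) (dQ (Suc i))" for i using sw.\<delta>[of i] by simp
  obtain G where G: "G \<in> linmap S (dQ (Suc i)) N"
    "\<And>f. f \<in> carrier (dQ i) \<Longrightarrow> \<sigma> N (Q i) t f = G (sw.\<delta> i f)"
    using weak_injective_exact[OF wi dQ dQ dQ \<delta> \<delta> sw.exact_Suc sw.sfp_coimage[unfolded opp_opp]
        \<sigma>_linmap[OF t]] z by blast
  obtain w where w: "w \<in> carrier (tensor_ab R (Q (Suc i)) HN)"
    "\<And>f. f \<in> mod_hom (opp R) (Q (Suc i)) (opp_bimod C) \<Longrightarrow> \<sigma> N (Q (Suc i)) w f = G f"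
    using \<sigma>_surj[OF Nm G(1)] by blast
  have "t = tensor_map R (Q (Suc i)) (Q i) HN (d i) w"
  proof (rule \<sigma>_inj[OF Nm t])
    show "tensor_map R (Q (Suc i)) (Q i) HN (d i) w \<in> carrier (tensor_ab R (Q i) HN)"
      by (rule ab_hom_closed[OF tensor_map_hom[OF Qm Qm HN dR] w(1)])
    fix f assume f: "f \<in> mod_hom (opp R) (Q i) (opp_bimod C)"
    then have "sw.\<delta> i f \<in> mod_hom (opp R) (Q (Suc i)) (opp_bimod C)"
      using linmap_closed[OF \<delta>, of f i] by simp
    then show "\<sigma> N (Q i) t f = \<sigma> N (Q i) (tensor_map R (Q (Suc i)) (Q i) HN (d i) w) f"
      unfolding \<sigma>_d[OF w(1) f] using w(2) G(2)[of f] f by simp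
  qed
  then show ?thesis using w(1) by blast
qed

text \<open>For a cycle \<open>t\<close> the map \<open>\<sigma> t\<close> vanishes on the image of
  the preceding dual differential, which by exactness is the kernel required in
  \<open>\<sigma>_factor\<close>.\<close>

lemma bass_Tor: "trivial_group (Tor R (opp_bimod C) HN (Suc j))"
proof -
  have "tensor_exact R HN Q d j"
    unfolding tensor_exact_def
  proof (intro ballI impI)
    fix t assume t: "t \<in> carrier (tensor_ab R (Q (Suc j)) HN)"
      and z: "tensor_map R (Q (Suc j)) (Q j) HN (d j) t = \<zero>\<^bsub>tensor_ab R (Q j) HN\<^esub>"
    show "t \<in> tensor_map R (Q (Suc (Suc j))) (Q (Suc j)) HN (d (Suc j)) ` carrier (tensor_ab R (Q (Suc (Suc j))) HN)"
    proof (rule \<sigma>_factor[OF t])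
      fix f assume "f \<in> mod_ker (dQ (Suc j)) (dQ (Suc (Suc j))) (sw.\<delta> (Suc j))"
      then obtain g where g: "g \<in> mod_hom (opp R) (Q j) (opp_bimod C)" "f = sw.\<delta> j g"
        unfolding sw.exact_Suc by (auto simp del: mod_hom_opp)
      have "\<sigma> N (Q (Suc j)) t f = \<sigma> N (Q j) \<zero>\<^bsub>tensor_ab R (Q j) HN\<^esub> g"
        using \<sigma>_d[OF t g(1)] unfolding z g(2) by simp
      also have "\<dots> = \<zero>\<^bsub>N\<^esub>"
        by (rule ab_hom_zero[OF tensor_pair.T_ab[OF H_pair[OF Nm Qm]] module_abelian[OF Nm] \<sigma>_eval_hom[OF Nm Qm g(1)]])
      finally show "\<sigma> N (Q (Suc j)) t f = \<zero>\<^bsub>N\<^esub>" .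
    qed
  qed
  then show ?thesis using Tor_trivial_iff_resolution[OF sw.res HN] by simp
qed

lemma bass_eval_balanced: "balanced R (opp_bimod C) HN N (\<lambda>c f. f c)"
proof -
  have add: "f (c \<oplus>\<^bsub>C\<^esub> c') = f c \<oplus>\<^bsub>N\<^esub> f c'"
    if "f \<in> mod_hom S C N" "c \<in> carrier C" "c' \<in> carrier C" for f c c'
    by (rule linmap_add[OF mod_hom_linmap[OF that(1)] that(2,3)])
  show ?thesis by (auto simp: balanced_def add intro: mod_hom_closed)
qed

lemma bass_eval_hom: "bass_eval S R C N \<in> ab_hom (tensor_ab R (opp_bimod C) HN) N"
  unfolding bass_eval_def
  by (rule tensor_pair.tensor_lift_hom[OF tensor_pair_C[OF HN] module_abelian[OF Nm] bass_eval_balanced])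

lemma bass_eval_elt:
  "\<lbrakk>c \<in> carrier C; h \<in> mod_hom S C N\<rbrakk> \<Longrightarrow> bass_eval S R C N (tensor_elt R (opp_bimod C) HN c h) = h c"
  unfolding bass_eval_def
  using tensor_pair.tensor_lift_elt[OF tensor_pair_C[OF HN] module_abelian[OF Nm] bass_eval_balanced] by simp

lemma bass_eval_linmap: "bass_eval S R C N \<in> linmap S (tensor_mod R C HN) N"
proof -
  interpret T: tensor_pair R "opp_bimod C" HN by (rule tensor_pair_C[OF HN])
  let ?\<nu> = "bass_eval S R C N"
  have "?\<nu> (s \<odot>\<^bsub>tensor_mod R C HN\<^esub> t) = s \<odot>\<^bsub>N\<^esub> ?\<nu> t" if s: "s \<in> carrier S" and t: "t \<in> carrier T.T" for s t
  proof (rule T.T_hom_eq[OF _ ab_hom_comp[OF bass_eval_hom smult_ab_hom[OF Nm s]] t])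
    show "(\<lambda>t. ?\<nu> (s \<odot>\<^bsub>tensor_mod R C HN\<^esub> t)) \<in> ab_hom T.T N"
      using ab_hom_comp[OF tensor_map_hom[OF CR CR HN s_linmap[OF s]] bass_eval_hom] by simp
    fix c h assume c: "c \<in> carrier (opp_bimod C)" and h: "h \<in> carrier HN"
    then have "?\<nu> (s \<odot>\<^bsub>tensor_mod R C HN\<^esub> T.elt c h) = h (s \<odot>\<^bsub>C\<^esub> c)"
      using tensor_mod_smult_elt[OF HN s _ h, of c] bass_eval_elt[of "s \<odot>\<^bsub>C\<^esub> c" h] s_closed[OF s] by simp
    also have "\<dots> = s \<odot>\<^bsub>N\<^esub> ?\<nu> (T.elt c h)"
      using c h s linmap_smult[OF mod_hom_linmap, of h S C N s c] bass_eval_elt[of c h] by simp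
    finally show "?\<nu> (s \<odot>\<^bsub>tensor_mod R C HN\<^esub> T.elt c h) = s \<odot>\<^bsub>N\<^esub> ?\<nu> (T.elt c h)" .
  qed
  moreover have "?\<nu> \<in> ab_hom (tensor_mod R C HN) N" using bass_eval_hom by (simp add: ab_hom_def)
  ultimately show ?thesis by (simp add: linmap_def del: tensor_mod_simps(4))
qed

text \<open>\<open>sw.\<epsilon> \<one>\<close> is the augmentation \<open>e\<close> itself,
  regarded as an element of the dual \<open>dQ 0\<close>.\<close>

lemma \<epsilon>1: "sw.\<epsilon> \<one>\<^bsub>S\<^esub> \<in> mod_hom (opp R) (Q 0) (opp_bimod C)"
  using linmap_closed[OF sw.\<epsilon>, of "\<one>\<^bsub>S\<^esub>"] ring.ring_simprules(6)[OF S] by simp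

text \<open>On pure tensors both sides are h (e q): lifted to \<open>Q 0 \<otimes> HN\<close>, the
  evaluation map becomes evaluation of \<open>\<sigma> t\<close> at the element e of
  \<open>dQ 0\<close>.\<close>

lemma bass_eval_\<sigma>:
  assumes t: "t \<in> carrier (tensor_ab R (Q 0) HN)"
  shows "bass_eval S R C N (tensor_map R (Q 0) (opp_bimod C) HN e t) = \<sigma> N (Q 0) t (sw.\<epsilon> \<one>\<^bsub>S\<^esub>)"
proof (rule tensor_pair.T_hom_eq[OF H_pair[OF Nm Qm] ab_hom_comp[OF tensor_map_hom[OF Qm CR HN eR]
      bass_eval_hom] \<sigma>_eval_hom[OF Nm Qm \<epsilon>1] t])
  fix q h assume q: "q \<in> carrier (Q 0)" and h: "h \<in> carrier HN"
  have eq: "e q \<in> carrier C" using linmap_closed[OF eR q] by simp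
  have "sw.\<epsilon> \<one>\<^bsub>S\<^esub> q = e q" using q eq by (simp add: sw.\<epsilon>_def left_module.smult_one[OF CS])
  then show "bass_eval S R C N (tensor_map R (Q 0) (opp_bimod C) HN e (tensor_elt R (Q 0) HN q h)) =
      \<sigma> N (Q 0) (tensor_elt R (Q 0) HN q h) (sw.\<epsilon> \<one>\<^bsub>S\<^esub>)"
    using \<sigma>_elt[OF Nm Qm q _ \<epsilon>1, of h] h bass_eval_elt[OF eq, of h]
    by (simp add: tensor_map_elt[OF Qm CR HN eR q h])
qed

lemma \<epsilon>_linmap: "sw.\<epsilon> \<in> linmap S (regular_module S) (dQ 0)"
  using sw.\<epsilon> by simp

lemma \<epsilon>_eq: "s \<in> carrier S \<Longrightarrow> sw.\<epsilon> s = s \<odot>\<^bsub>dQ 0\<^esub> sw.\<epsilon> \<one>\<^bsub>S\<^esub>"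
  using linmap_smult[OF \<epsilon>_linmap, of s "\<one>\<^bsub>S\<^esub>"] ring.ring_simprules(6)[OF S] monoid.r_one[OF ring.is_monoid[OF S]]
  by simp

text \<open>For injectivity lift \<open>u\<close> to \<open>t\<close> over \<open>Q 0\<close>. Then
  \<open>\<sigma> t\<close> vanishes at e, hence by linearity on all multiples of e, which form the
  kernel of the first dual differential. So \<open>t\<close> is a boundary \<open>d w\<close> and u
  = e d w = 0. Surjectivity asks for a map on \<open>dQ 0\<close> with a prescribed value at
  e.\<close>

lemma bass_eval_iso: "bass_eval S R C N \<in> mod_iso S (tensor_mod R C HN) N"
proof -
  interpret T: tensor_pair R "opp_bimod C" HN by (rule tensor_pair_C[OF HN])
  interpret S: ring S by (rule S)
  interpret Ng: abelian_group N by (rule module_abelian[OF Nm])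
  let ?\<nu> = "bass_eval S R C N" and ?RS = "regular_module S"
  have RS: "left_module S ?RS" by (rule regular_left_module[OF S])
  have \<delta>: "sw.\<delta> i \<in> linmap S (dQ i) (dQ (Suc i))" for i using sw.\<delta>[of i] by simp
  have ex0: "mod_ker (dQ 0) (dQ (Suc 0)) (sw.\<delta> 0) = sw.\<epsilon> ` carrier S" using sw.exact_0 by simp
  have ker: "u = \<zero>\<^bsub>T.T\<^esub>" if u: "u \<in> carrier T.T" and z: "?\<nu> u = \<zero>\<^bsub>N\<^esub>" for u
  proof -
    obtain t where t: "t \<in> carrier (tensor_ab R (Q 0) HN)"
      and tu: "tensor_map R (Q 0) (opp_bimod C) HN e t = u"
      using tensor_map_surj[OF Qm CR HN eR _ u] sw.P.e_surj by auto
    have z1: "\<sigma> N (Q 0) t (sw.\<epsilon> \<one>\<^bsub>S\<^esub>) = \<zero>\<^bsub>N\<^esub>" using bass_eval_\<sigma>[OF t] tu z by simp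
    have "\<sigma> N (Q 0) t f = \<zero>\<^bsub>N\<^esub>" if f: "f \<in> mod_ker (dQ 0) (dQ (Suc 0)) (sw.\<delta> 0)" for f
    proof -
      obtain s where s: "s \<in> carrier S" "f = sw.\<epsilon> s" using f unfolding ex0 by blast
      have "\<sigma> N (Q 0) t f = s \<odot>\<^bsub>N\<^esub> \<sigma> N (Q 0) t (sw.\<epsilon> \<one>\<^bsub>S\<^esub>)"
        unfolding s(2) \<epsilon>_eq[OF s(1)] using \<epsilon>1 by (intro linmap_smult[OF \<sigma>_linmap[OF t] s(1)]) simp
      then show ?thesis using z1 smult_zero_right[OF Nm s(1)] by simp
    qed
    then obtain w where w: "w \<in> carrier (tensor_ab R (Q (Suc 0)) HN)"
      and tw: "t = tensor_map R (Q (Suc 0)) (Q 0) HN (d 0) w"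
      using \<sigma>_factor[OF t] by blast
    have "u = tensor_map R (Q (Suc 0)) (opp_bimod C) HN (\<lambda>x. e (d 0 x)) w"
      unfolding tu[symmetric] tw
      by (rule tensor_map_comp[OF Qm Qm CR HN dR eR linmap_comp[OF dR eR] _ w]) (rule refl)
    also have "\<dots> = \<zero>\<^bsub>T.T\<^esub>"
      by (rule tensor_map_zero[OF Qm CR HN linmap_comp[OF dR eR] sw.P.ed w])
    finally show ?thesis .
  qed
  have "bij_betw ?\<nu> (carrier (tensor_mod R C HN)) (carrier N)"
    unfolding bij_betw_def
  proof
    show "inj_on ?\<nu> (carrier (tensor_mod R C HN))"
    proof (rule inj_onI)
      fix u v assume uv: "u \<in> carrier (tensor_mod R C HN)" "v \<in> carrier (tensor_mod R C HN)" "?\<nu> u = ?\<nu> v"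
      then have "?\<nu> (u \<ominus>\<^bsub>T.T\<^esub> v) = \<zero>\<^bsub>N\<^esub>"
        using ab_hom_minus[OF T.T_ab Ng.abelian_group_axioms bass_eval_hom]
          Ng.minus_zero_iff[of "?\<nu> u" "?\<nu> v"] ab_hom_closed[OF bass_eval_hom] by simp
      then have "u \<ominus>\<^bsub>T.T\<^esub> v = \<zero>\<^bsub>T.T\<^esub>" using uv by (intro ker) auto
      then show "u = v" using uv T.T.minus_zero_iff by simp
    qed
    show "?\<nu> ` carrier (tensor_mod R C HN) = carrier N"
    proof
      show "?\<nu> ` carrier (tensor_mod R C HN) \<subseteq> carrier N" using ab_hom_closed[OF bass_eval_hom] by auto
      show "carrier N \<subseteq> ?\<nu> ` carrier (tensor_mod R C HN)"
      proof
        fix n assume n: "n \<in> carrier N"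
        \<comment> \<open>The assignment s e -> s n is well defined because
          \<open>sw.\<epsilon>\<close> is injective. Weak injectivity extends it to all of
          \<open>dQ 0\<close>, and a tensor representing the extension is mapped to its value n at
          e.\<close>
        have G0: "(\<lambda>s. s \<odot>\<^bsub>N\<^esub> n) \<in> linmap S ?RS N"
          using n left_module.smult_closed[OF Nm] left_module.smult_l_distr[OF Nm]
            left_module.smult_assoc1[OF Nm] by (intro linmapI) simp_all
        have "s \<odot>\<^bsub>N\<^esub> n = \<zero>\<^bsub>N\<^esub>" if "s \<in> mod_ker ?RS (dQ 0) sw.\<epsilon>" for s
          using that sw.\<epsilon>_inj[of s] smult_zero_left[OF Nm n] by (auto simp: mod_ker_def)
        then obtain G where G: "G \<in> linmap S (dQ 0) N" "\<And>s. s \<in> carrier S \<Longrightarrow> s \<odot>\<^bsub>N\<^esub> n = G (sw.\<epsilon> s)"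
          using weak_injective_exact[OF wi RS dQ dQ \<epsilon>_linmap \<delta> _ sw.sfp_coimage[unfolded opp_opp] G0] ex0
          by auto
        obtain t where t: "t \<in> carrier (tensor_ab R (Q 0) HN)"
          "\<And>f. f \<in> mod_hom (opp R) (Q 0) (opp_bimod C) \<Longrightarrow> \<sigma> N (Q 0) t f = G f"
          using \<sigma>_surj[OF Nm G(1)] by blast
        have "?\<nu> (tensor_map R (Q 0) (opp_bimod C) HN e t) = n"
          using bass_eval_\<sigma>[OF t(1)] t(2)[OF \<epsilon>1] G(2)[of "\<one>\<^bsub>S\<^esub>"] left_module.smult_one[OF Nm n] by simp
        then show "n \<in> ?\<nu> ` carrier (tensor_mod R C HN)"
          using ab_hom_closed[OF tensor_map_hom[OF Qm CR HN eR] t(1)] by force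
      qed
    qed
  qed
  moreover have "?\<nu> \<in> mod_hom S (tensor_mod R C HN) N"
    using bass_eval_linmap by (simp add: mod_hom_iff bass_eval_def tensor_lift_def)
  ultimately show ?thesis by (simp add: mod_iso_def)
qed

end

end

lemma bass_contains_weak_injective:
  assumes C: "semidualizing S R C" and N: "weak_injective S N"
  shows "N \<in> bass_class S R C"
proof -
  have sfp: "super_fin_pres S C" "super_fin_pres (opp R) (opp_bimod C)" and bi: "is_bimodule S R C"
    using C by (simp_all add: semidualizing_def)
  obtain k d e where res: "resolution (opp R) (opp_bimod C) (\<lambda>i. fr (opp R) (k i)) d e"
    using sfp_free_resolution[OF sfp(2)] by blast
  interpret bimod S R C by (rule bimod.intro[OF bi])
  have sw: "semidual (opp R) (opp S) (opp_bimod C) k d e"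
    by (intro semidual.intro semidual_axioms.intro swap semidualizing_opp C res)
  show ?thesis
    unfolding bass_class_def
    using N bass_Tor[OF N sw] bass_eval_iso[OF N sw] weak_injective_Ext_all[OF N sfp(1)]
    by (simp only: all_ge_1_iff weak_injective_def mem_Collect_eq simp_thms)
qed

theorem theorem2p2:
  fixes S :: "'s ring" and R :: "'r ring" and C :: "('s, 'r, 'c) bimodule"
  assumes "ring S" and "ring R" and "semidualizing S R C"
  shows "{M :: ('r, 'm) module. weak_flat R M} \<subseteq> auslander_class S R C \<and>
         {N :: ('s, 'n) module. weak_injective S N} \<subseteq> bass_class S R C"
  using auslander_contains_weak_flat[OF assms(3)] bass_contains_weak_injective[OF assms(3)] by blast

end
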